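(* Let $p$ be an odd prime and $\Gamma$ a pro-$p$-group minimally generated by $\{\sigma_1,\sigma_2\}\cup\{\sigma_i\}_{i\in\mathcal{I}}$ subject to a single relation (i.e. the relator) $$\sigma_1^q\cdot{}^f[\sigma_1,\sigma_2]\cdot\prod_{(i,j)\in\mathcal{J}}[\sigma_i,\sigma_j]\cdot\prod_{k\in\mathcal{K}}[\sigma_1^p,\sigma_k]$$ for some $2\le f\le p-1$, some $q\in\mathbb{N}\cup\{0\}$ with $q\equiv0\pmod{p^2}$, a finite ordered set of pairs $\mathcal{J}\subset\mathcal{I}\times\mathcal{I}$, and a finite ordered subset $\mathcal{K}$ of $\mathcal{I}$. Then $\Gamma$ is not an absolute Galois group.
   Context: $\mathcal{I}$ is an index set (disjoint from $\{1,2\}$); $\Gamma$ is the quotient of the free pro-$p$-group on the generators by the closed normal subgroup generated by the displayed relator. Notation: $[\sigma,\tau]={}^1[\sigma,\tau]=\sigma\tau\sigma^{-1}\tau^{-1}$ and ${}^n[\sigma,\tau]=[\sigma,{}^{n-1}[\sigma,\tau]]$ for $n\ge2$. A profinite group is an absolute Galois group if it is isomorphic (as a topological group) to $G_F=\mathrm{Gal}(F^{s}/F)$ for some field $F$ with separable closure $F^s$. *)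

theory Defs
  imports
    "HOL-Analysis.Analysis"
    "HOL-Algebra.Algebra"
    "HOL-Algebra.Algebraic_Closure_Type"
    "HOL-Number_Theory.Cong"
begin

section \<open>Topological, profinite and pro-\<open>p\<close> groups\<close>

definition topological_group :: "('g, 'm) monoid_scheme \<Rightarrow> 'g topology \<Rightarrow> bool" where
  "topological_group G T \<longleftrightarrow>
     group G \<and> topspace T = carrier G \<and>
     continuous_map (prod_topology T T) T (\<lambda>(x, y). x \<otimes>\<^bsub>G\<^esub> y) \<and>
     continuous_map T T (\<lambda>x. inv\<^bsub>G\<^esub> x)"

definition totally_disconnected_space :: "'a topology \<Rightarrow> bool" where
  "totally_disconnected_space T \<longleftrightarrow>
     (\<forall>x \<in> topspace T. connected_component_of_set T x = {x})"

definition profinite_group :: "('g, 'm) monoid_scheme \<Rightarrow> 'g topology \<Rightarrow> bool" where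
  "profinite_group G T \<longleftrightarrow>
     topological_group G T \<and> compact_space T \<and> Hausdorff_space T \<and> totally_disconnected_space T"

definition pro_p_group :: "nat \<Rightarrow> ('g, 'm) monoid_scheme \<Rightarrow> 'g topology \<Rightarrow> bool" where
  "pro_p_group p G T \<longleftrightarrow>
     profinite_group G T \<and>
     (\<forall>N. N \<lhd> G \<and> openin T N \<longrightarrow> (\<exists>n. card (rcosets\<^bsub>G\<^esub> N) = p ^ n))"

definition topological_group_iso ::
  "('g, 'm) monoid_scheme \<Rightarrow> 'g topology \<Rightarrow> ('h, 'n) monoid_scheme \<Rightarrow> 'h topology \<Rightarrow> bool" where
  "topological_group_iso G T H U \<longleftrightarrow> (\<exists>\<phi>. \<phi> \<in> iso G H \<and> homeomorphic_map T U \<phi>)"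

definition topologically_generates ::
  "('g, 'm) monoid_scheme \<Rightarrow> 'g topology \<Rightarrow> 'g set \<Rightarrow> bool" where
  "topologically_generates G T A \<longleftrightarrow>
     A \<subseteq> carrier G \<and> T closure_of (generate G A) = carrier G"

definition minimally_generated_by ::
  "('g, 'm) monoid_scheme \<Rightarrow> 'g topology \<Rightarrow> 'i set \<Rightarrow> ('i \<Rightarrow> 'g) \<Rightarrow> bool" where
  "minimally_generated_by G T A \<sigma> \<longleftrightarrow>
     topologically_generates G T (\<sigma> ` A) \<and>
     (\<forall>B. B \<subset> A \<longrightarrow> \<not> topologically_generates G T (\<sigma> ` B))"

definition closed_normal_closure ::
  "('g, 'm) monoid_scheme \<Rightarrow> 'g topology \<Rightarrow> 'g set \<Rightarrow> 'g set" where
  "closed_normal_closure G T A = \<Inter> {N. N \<lhd> G \<and> closedin T N \<and> A \<subseteq> N}"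


section \<open>Commutators and ordered products\<close>

definition commutator :: "('g, 'm) monoid_scheme \<Rightarrow> 'g \<Rightarrow> 'g \<Rightarrow> 'g" where
  "commutator G x y = x \<otimes>\<^bsub>G\<^esub> y \<otimes>\<^bsub>G\<^esub> inv\<^bsub>G\<^esub> x \<otimes>\<^bsub>G\<^esub> inv\<^bsub>G\<^esub> y"

text \<open>
  \<open>iterated_commutator G n x y\<close> is \<open>[x, [x, \<dots>, [x, y] \<dots>]]\<close> with \<open>n\<close> occurrences of \<open>x\<close>;
  the value at \<open>0\<close> is chosen such that the value at \<open>1\<close> is \<open>[x, y]\<close>.
\<close>

primrec iterated_commutator :: "('g, 'm) monoid_scheme \<Rightarrow> nat \<Rightarrow> 'g \<Rightarrow> 'g \<Rightarrow> 'g" where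
  "iterated_commutator G 0 x y = y"
| "iterated_commutator G (Suc n) x y = commutator G x (iterated_commutator G n x y)"

lemma iterated_commutator_1: "iterated_commutator G 1 x y = commutator G x y"
  by simp

definition ordered_product :: "('g, 'm) monoid_scheme \<Rightarrow> 'g list \<Rightarrow> 'g" where
  "ordered_product G xs = foldr (\<otimes>\<^bsub>G\<^esub>) xs \<one>\<^bsub>G\<^esub>"


section \<open>The free group on a set\<close>

text \<open>
  Elements are reduced words; the letter \<open>(x, True)\<close> stands for \<open>x\<close> and \<open>(x, False)\<close> for its
  inverse. \<open>red_Cons\<close> multiplies a reduced word by a letter from the left.
\<close>

definition reduced :: "('i \<times> bool) list \<Rightarrow> bool" where
  "reduced w \<longleftrightarrow> successively (\<lambda>a b. fst a = fst b \<longrightarrow> snd a = snd b) w"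

fun red_Cons :: "'i \<times> bool \<Rightarrow> ('i \<times> bool) list \<Rightarrow> ('i \<times> bool) list" where
  "red_Cons a [] = [a]"
| "red_Cons a (b # w) = (if fst a = fst b \<and> snd a \<noteq> snd b then w else a # b # w)"

definition free_group :: "'i set \<Rightarrow> ('i \<times> bool) list monoid" where
  "free_group A =
     \<lparr>carrier = {w \<in> lists (A \<times> UNIV). reduced w},
      monoid.mult = (\<lambda>u v. foldr red_Cons u v),
      one = []\<rparr>"

lemma reduced_Nil [simp]: "reduced []"
  by (simp add: reduced_def)

lemma reduced_Cons:
  "reduced (a # w) \<longleftrightarrow> reduced w \<and> (w \<noteq> [] \<longrightarrow> fst a = fst (hd w) \<longrightarrow> snd a = snd (hd w))"
  by (cases w) (auto simp: reduced_def)

lemma reduced_red_Cons: "reduced w \<Longrightarrow> reduced (red_Cons a w)"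
  by (cases w) (auto simp: reduced_Cons)

lemma red_Cons_reduced: "reduced (a # w) \<Longrightarrow> red_Cons a w = a # w"
  by (cases w) (auto simp: reduced_Cons)

lemma red_Cons_cancel: "reduced w \<Longrightarrow> red_Cons (x, s) (red_Cons (x, \<not> s) w) = w"
  by (cases w; cases "tl w") (auto simp: reduced_Cons split: if_splits prod.splits)

lemma set_red_Cons: "set (red_Cons a w) \<subseteq> insert a (set w)"
  by (cases w) auto

lemma reduced_foldr: "reduced v \<Longrightarrow> reduced (foldr red_Cons u v)"
  by (induction u) (auto intro: reduced_red_Cons)

lemma set_foldr_red_Cons: "set (foldr red_Cons u v) \<subseteq> set u \<union> set v"
  using set_red_Cons by (induction u) fastforce+

lemma foldr_red_Cons_Nil: "reduced u \<Longrightarrow> foldr red_Cons u [] = u"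
  by (induction u) (auto simp: reduced_Cons red_Cons_reduced)

lemma foldr_red_Cons_red_Cons:
  assumes "reduced w"
  shows "foldr red_Cons (red_Cons a v) w = red_Cons a (foldr red_Cons v w)"
proof (cases v)
  case (Cons b v')
  show ?thesis
  proof (cases "fst a = fst b \<and> snd a \<noteq> snd b")
    case True
    then have "a = (fst b, \<not> snd b)" by (cases a) auto
    then show ?thesis
      using Cons True red_Cons_cancel[OF reduced_foldr[OF assms], of "fst b" "\<not> snd b" v'] by simp
  next
    case False
    then show ?thesis using Cons by auto
  qed
qed simp

lemma foldr_red_Cons_assoc:
  "reduced w \<Longrightarrow> foldr red_Cons (foldr red_Cons u v) w = foldr red_Cons u (foldr red_Cons v w)"
  by (induction u) (auto simp: foldr_red_Cons_red_Cons)

lemma foldr_red_Cons_inverse: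
  "reduced w \<Longrightarrow> foldr red_Cons (rev (map (\<lambda>(x, s). (x, \<not> s)) u)) (foldr red_Cons u w) = w"
proof (induction u)
  case (Cons a u)
  then show ?case
    using red_Cons_cancel[OF reduced_foldr[of w u], of "fst a" "\<not> snd a"]
    by (cases a) simp
qed simp

lemma group_free_group: "group (free_group A)"
proof (rule groupI)
  fix u assume "u \<in> carrier (free_group A)"
  then have u: "reduced u" "set u \<subseteq> A \<times> UNIV" by (auto simp: free_group_def)
  let ?v = "foldr red_Cons (rev (map (\<lambda>(x, s). (x, \<not> s)) u)) []"
  have "foldr red_Cons ?v u = []"
    using foldr_red_Cons_inverse[of "[]" u] u by (simp add: foldr_red_Cons_assoc foldr_red_Cons_Nil)
  moreover have "set ?v \<subseteq> A \<times> UNIV"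
    using set_foldr_red_Cons[of "rev (map (\<lambda>(x, s). (x, \<not> s)) u)" "[]"] u by auto
  then have "?v \<in> carrier (free_group A)"
    by (auto simp: free_group_def reduced_foldr)
  ultimately show "\<exists>v \<in> carrier (free_group A). v \<otimes>\<^bsub>free_group A\<^esub> u = \<one>\<^bsub>free_group A\<^esub>"
    by (auto simp: free_group_def)
next
  fix u v assume "u \<in> carrier (free_group A)" "v \<in> carrier (free_group A)"
  then show "u \<otimes>\<^bsub>free_group A\<^esub> v \<in> carrier (free_group A)"
    using set_foldr_red_Cons[of u v] by (auto simp: free_group_def reduced_foldr)
qed (auto simp: free_group_def foldr_red_Cons_assoc)


section \<open>The free pro-\<open>p\<close> group on a set\<close>

text \<open>
  For infinite \<open>A\<close> the convention is the usual one, namely that the generators converge to \<open>1\<close>: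
  every open subgroup contains all but finitely many of them. So the free pro-\<open>p\<close> group on \<open>A\<close> is
  the inverse limit of the discrete \<open>p\<close>-groups \<open>F/N\<close>, where \<open>F\<close> is the abstract free group and
  \<open>N\<close> ranges over the normal subgroups of \<open>p\<close>-power index that contain almost all of \<open>A\<close>.
  As the elements of \<open>F/N\<close> are cosets, compatibility of the components at \<open>N \<subseteq> M\<close> is inclusion.
\<close>

definition free_pro_p_index :: "nat \<Rightarrow> 'i set \<Rightarrow> ('i \<times> bool) list set set" where
  "free_pro_p_index p A =
     {N. N \<lhd> free_group A \<and> (\<exists>n. card (rcosets\<^bsub>free_group A\<^esub> N) = p ^ n) \<and>
         finite {x \<in> A. [(x, True)] \<notin> N}}"

definition free_pro_p_group ::
  "nat \<Rightarrow> 'i set \<Rightarrow> (('i \<times> bool) list set \<Rightarrow> ('i \<times> bool) list set) monoid" where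
  "free_pro_p_group p A =
     (let P = product_group (free_pro_p_index p A) (\<lambda>N. free_group A Mod N) in
      P\<lparr>carrier := {c \<in> carrier P.
         \<forall>N \<in> free_pro_p_index p A. \<forall>M \<in> free_pro_p_index p A. N \<subseteq> M \<longrightarrow> c N \<subseteq> c M}\<rparr>)"

definition free_pro_p_topology ::
  "nat \<Rightarrow> 'i set \<Rightarrow> (('i \<times> bool) list set \<Rightarrow> ('i \<times> bool) list set) topology" where
  "free_pro_p_topology p A =
     subtopology
       (product_topology (\<lambda>N. discrete_topology (carrier (free_group A Mod N)))
         (free_pro_p_index p A))
       (carrier (free_pro_p_group p A))"

definition free_pro_p_gen ::
  "nat \<Rightarrow> 'i set \<Rightarrow> 'i \<Rightarrow> (('i \<times> bool) list set \<Rightarrow> ('i \<times> bool) list set)" where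
  "free_pro_p_gen p A x = (\<lambda>N \<in> free_pro_p_index p A. N #>\<^bsub>free_group A\<^esub> [(x, True)])"

lemma free_pro_p_indexD: "N \<in> free_pro_p_index p A \<Longrightarrow> N \<lhd> free_group A"
  by (simp add: free_pro_p_index_def)

lemma subgroup_free_pro_p_group:
  "subgroup (carrier (free_pro_p_group p A))
     (product_group (free_pro_p_index p A) (\<lambda>N. free_group A Mod N))"
proof -
  let ?I = "free_pro_p_index p A" and ?F = "free_group A"
  let ?P = "product_group ?I (\<lambda>N. ?F Mod N)"
  interpret F: group ?F by (rule group_free_group)
  have Q: "group (?F Mod N)" if "N \<in> ?I" for N
    using that by (intro normal.factorgroup_is_group) (auto dest: free_pro_p_indexD)
  have P: "group ?P" using Q by simp
  show ?thesis
  proof (rule group.subgroupI[OF P])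
    show "carrier (free_pro_p_group p A) \<subseteq> carrier ?P"
      by (auto simp: free_pro_p_group_def Let_def)
    have "\<one>\<^bsub>?P\<^esub> \<in> carrier (free_pro_p_group p A)"
      using monoid.one_closed[OF group.is_monoid[OF P]]
      by (auto simp: free_pro_p_group_def Let_def FactGroup_def)
    then show "carrier (free_pro_p_group p A) \<noteq> {}" by auto
  next
    fix a assume "a \<in> carrier (free_pro_p_group p A)"
    then have a: "a \<in> carrier ?P"
      "\<And>N M. N \<in> ?I \<Longrightarrow> M \<in> ?I \<Longrightarrow> N \<subseteq> M \<Longrightarrow> a N \<subseteq> a M"
      by (auto simp: free_pro_p_group_def Let_def)
    have i: "inv\<^bsub>?P\<^esub> a = (\<lambda>N\<in>?I. set_inv\<^bsub>?F\<^esub> (a N))"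
      using a(1) Q by (subst inv_product_group)
        (auto intro!: restrict_ext normal.inv_FactGroup dest: free_pro_p_indexD)
    show "inv\<^bsub>?P\<^esub> a \<in> carrier (free_pro_p_group p A)"
    proof -
      have "set_inv\<^bsub>?F\<^esub> (a N) \<subseteq> set_inv\<^bsub>?F\<^esub> (a M)"
        if "N \<in> ?I" "M \<in> ?I" "N \<subseteq> M" for N M
        using a(2)[OF that] by (auto simp: SET_INV_def)
      moreover have "(\<lambda>N\<in>?I. set_inv\<^bsub>?F\<^esub> (a N)) \<in> carrier ?P"
        using group.inv_closed[OF P a(1)] unfolding i .
      ultimately show ?thesis
        unfolding i by (simp add: free_pro_p_group_def Let_def)
    qed
  next
    fix a b assume "a \<in> carrier (free_pro_p_group p A)" "b \<in> carrier (free_pro_p_group p A)"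
    then have ab: "a \<in> carrier ?P" "b \<in> carrier ?P"
      "\<And>N M. N \<in> ?I \<Longrightarrow> M \<in> ?I \<Longrightarrow> N \<subseteq> M \<Longrightarrow> a N \<subseteq> a M"
      "\<And>N M. N \<in> ?I \<Longrightarrow> M \<in> ?I \<Longrightarrow> N \<subseteq> M \<Longrightarrow> b N \<subseteq> b M"
      by (auto simp: free_pro_p_group_def Let_def)
    show "a \<otimes>\<^bsub>?P\<^esub> b \<in> carrier (free_pro_p_group p A)"
    proof -
      have "a N <#>\<^bsub>?F\<^esub> b N \<subseteq> a M <#>\<^bsub>?F\<^esub> b M"
        if "N \<in> ?I" "M \<in> ?I" "N \<subseteq> M" for N M
        using ab(3,4)[OF that] unfolding set_mult_def by blast
      then show ?thesis
        using monoid.m_closed[OF group.is_monoid[OF P] ab(1,2)]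
        by (simp add: free_pro_p_group_def Let_def FactGroup_def)
    qed
  qed
qed

lemma group_free_pro_p_group: "group (free_pro_p_group p A)"
proof -
  have "group (product_group (free_pro_p_index p A) (\<lambda>N. free_group A Mod N))"
    by (rule product_group) (auto intro: normal.factorgroup_is_group dest: free_pro_p_indexD)
  then show ?thesis
    using subgroup.subgroup_is_group[OF subgroup_free_pro_p_group[of p A]]
    by (simp add: free_pro_p_group_def Let_def)
qed

lemma free_pro_p_gen_in_carrier:
  assumes "x \<in> A"
  shows "free_pro_p_gen p A x \<in> carrier (free_pro_p_group p A)"
proof -
  have "[(x, True)] \<in> carrier (free_group A)"
    using assms by (simp add: free_group_def reduced_def)
  then have "N #>\<^bsub>free_group A\<^esub> [(x, True)] \<in> carrier (free_group A Mod N)" for N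
    by (auto simp: FactGroup_def RCOSETS_def)
  moreover have "N #>\<^bsub>free_group A\<^esub> [(x, True)] \<subseteq> M #>\<^bsub>free_group A\<^esub> [(x, True)]"
    if "N \<subseteq> M" for N M
    using that unfolding r_coset_def by blast
  ultimately show ?thesis
    by (simp add: free_pro_p_group_def free_pro_p_gen_def Let_def)
qed

text \<open>
  \<open>G\<close> is the quotient of the free pro-\<open>p\<close> group on \<open>A\<close> by the closed normal subgroup generated by
  \<open>R\<close>, with \<open>\<sigma> x\<close> the image of the free generator \<open>x\<close>.
\<close>

definition pro_p_presentation ::
  "nat \<Rightarrow> 'i set \<Rightarrow> (('i \<times> bool) list set \<Rightarrow> ('i \<times> bool) list set) set \<Rightarrow>
    ('g, 'm) monoid_scheme \<Rightarrow> 'g topology \<Rightarrow> ('i \<Rightarrow> 'g) \<Rightarrow> bool" where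
  "pro_p_presentation p A R G T \<sigma> \<longleftrightarrow>
     (\<exists>\<pi>. \<pi> \<in> hom (free_pro_p_group p A) G \<and>
          quotient_map (free_pro_p_topology p A) T \<pi> \<and>
          kernel (free_pro_p_group p A) G \<pi> =
            closed_normal_closure (free_pro_p_group p A) (free_pro_p_topology p A) R \<and>
          (\<forall>x \<in> A. \<pi> (free_pro_p_gen p A x) = \<sigma> x))"


section \<open>Absolute Galois groups\<close>

text \<open>The separable closure is taken inside the algebraic closure of the field \<open>'f\<close>.\<close>

definition separable_over_base :: "'f::field alg_closure \<Rightarrow> bool" where
  "separable_over_base x \<longleftrightarrow>
     (\<exists>P :: 'f poly. Factorial_Ring.irreducible P \<and> rsquarefree (map_poly to_ac P) \<and>
        poly (map_poly to_ac P) x = 0)"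

definition separable_closure :: "'f::field alg_closure set" where
  "separable_closure = {x. separable_over_base x}"

lemma to_ac_in_separable_closure: "to_ac a \<in> separable_closure"
proof -
  let ?P = "[:- a, 1:]"
  have P: "map_poly to_ac ?P = [:- to_ac a, 1:]"
    by (simp add: map_poly_pCons)
  have "Polynomial.order b [:- to_ac a, 1:] \<le> 1" for b
    using order_degree[of "[:- to_ac a, 1:]" b] by simp
  then have "rsquarefree (map_poly to_ac ?P)"
    unfolding P rsquarefree_def by (simp add: le_Suc_eq)
  moreover have "Factorial_Ring.irreducible ?P"
    by (simp add: irreducible_linear_field_poly)
  moreover have "poly (map_poly to_ac ?P) (to_ac a) = 0"
    by (simp add: P)
  ultimately show ?thesis
    unfolding separable_closure_def separable_over_base_def by blast
qed

definition absolute_Galois_group ::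
  "('f::field alg_closure \<Rightarrow> 'f alg_closure) monoid" where
  "absolute_Galois_group =
     (BijGroup separable_closure)
       \<lparr>carrier := {\<phi> \<in> Bij separable_closure.
          (\<forall>x \<in> separable_closure. \<forall>y \<in> separable_closure.
             \<phi> (x + y) = \<phi> x + \<phi> y \<and> \<phi> (x * y) = \<phi> x * \<phi> y) \<and>
          (\<forall>a. \<phi> (to_ac a) = to_ac a)}\<rparr>"

definition finite_subextension :: "'f::field alg_closure set \<Rightarrow> bool" where
  "finite_subextension E \<longleftrightarrow>
     E \<subseteq> separable_closure \<and> range to_ac \<subseteq> E \<and>
     (\<forall>x \<in> E. \<forall>y \<in> E. x - y \<in> E \<and> x * y \<in> E \<and> inverse x \<in> E) \<and>
     (\<exists>B. finite B \<and> B \<subseteq> E \<and> (\<forall>x \<in> E. \<exists>c. x = (\<Sum>b \<in> B. to_ac (c b) * b)))"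

definition fixing_subgroup ::
  "'f::field alg_closure set \<Rightarrow> ('f alg_closure \<Rightarrow> 'f alg_closure) set" where
  "fixing_subgroup E = {\<phi> \<in> carrier absolute_Galois_group. \<forall>x \<in> E. \<phi> x = x}"

definition Krull_topology ::
  "('f::field alg_closure \<Rightarrow> 'f alg_closure) topology" where
  "Krull_topology =
     topology_generated_by
       {\<phi> <#\<^bsub>absolute_Galois_group\<^esub> fixing_subgroup E | \<phi> E.
          \<phi> \<in> carrier absolute_Galois_group \<and> finite_subextension E}"

text \<open>
  The field is given by the type \<open>'f\<close>: a topological group is an absolute Galois group iff this
  holds for some instance of \<open>'f\<close>, and it is not one iff the negation holds for all of them.
\<close>

definition is_absolute_Galois_group ::
  "'f::field itself \<Rightarrow> ('g, 'm) monoid_scheme \<Rightarrow> 'g topology \<Rightarrow> bool" where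
  "is_absolute_Galois_group TYPE('f) G T \<longleftrightarrow>
     topological_group_iso G T
       (absolute_Galois_group :: ('f alg_closure \<Rightarrow> 'f alg_closure) monoid) Krull_topology"

end

theory Submission
  imports Defs "HOL-Number_Theory.Residues"
begin

text \<open>
  Let \<open>H\<close> be the kernel of the character \<open>x1\<close> of \<open>\<Gamma>\<close> modulo \<open>p\<close> that is \<open>1\<close> on \<open>\<sigma> i1\<close> and \<open>0\<close> on the
  other generators, and let \<open>x2\<close> be the corresponding character for \<open>\<sigma> i2\<close>. The proof compares
  two facts about the characters \<open>\<psi>\<close> of \<open>H\<close> modulo \<open>p\<close> and their norms, the sums of the conjugates
  of \<open>\<psi>\<close> under the powers of \<open>\<sigma> i1\<close>.

  If \<open>\<Gamma>\<close> is the absolute Galois group of \<open>F\<close>, then \<open>x2\<close>, restricted to \<open>H\<close>, is a norm. Suppose that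
  \<open>F\<close> does not have characteristic \<open>p\<close>. It contains the \<open>p\<close>-th roots of unity, as \<open>\<Gamma>\<close> is a pro-\<open>p\<close>
  group, so Kummer theory turns the claim into this: the element \<open>b\<close> of \<open>F\<close> that belongs to \<open>x2\<close> is a
  norm from the extension \<open>E\<close> that belongs to \<open>x1\<close>. That holds because the cup product of \<open>x1\<close> and
  \<open>x2\<close> vanishes; concretely, the relator becomes trivial in the Heisenberg group modulo \<open>p\<close>, as
  \<open>f \<ge> 2\<close>, and so \<open>(x1, x2)\<close> lifts to a homomorphism from \<open>\<Gamma>\<close> to this group. In characteristic
  \<open>p\<close> Artin-Schreier theory and the surjectivity of the trace give the same result. This is
  \<open>is_norm_mod_of_Heisenberg\<close>.

  By group theory it is not a norm (\<open>norm_vanishes_by_relator\<close>). All factors of the relator but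
  the iterated commutator are killed by every conjugate of \<open>\<psi>\<close>: the first one because \<open>p\<^sup>2\<close>
  divides \<open>q\<close>, the others because they are commutators of elements of \<open>H\<close>. Hence the iterated
  commutator is killed too. If \<open>D\<close> is conjugation by \<open>\<sigma> i1\<close> minus the identity, acting on characters
  of \<open>H\<close>, this says that \<open>D ^ f\<close> applied to \<open>\<psi>\<close>, and so \<open>D ^ (p - 1)\<close> applied to \<open>\<psi>\<close>, vanishes at
  \<open>\<sigma> i2\<close>. But modulo \<open>p\<close> the operator \<open>D ^ (p - 1)\<close> is the norm, and \<open>x2\<close> is \<open>1\<close> at \<open>\<sigma> i2\<close>.

  The Galois theory is developed directly on the separable closure. It is closed under the field
  operations and under the roots above because in positive characteristic \<open>l\<close> separability of a
  finite-dimensional algebra means that it is spanned by its \<open>l\<close>-th powers. Hilbert 90 is obtained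
  from the independence of characters on a monoid generated by a finite set whose fixer lies in the
  kernel of the given cocycle.
\<close>

section \<open>Separable elements of the algebraic closure\<close>

interpretation ac: vector_space "\<lambda>(a :: 'f::field) (x :: 'f alg_closure). to_ac a * x"
  by unfold_locales (simp_all add: algebra_simps)

abbreviation ac_poly :: "'f::field poly \<Rightarrow> 'f alg_closure poly" where
  "ac_poly \<equiv> map_poly to_ac"

lemma coeff_ac_poly: "Polynomial.coeff (ac_poly P) n = to_ac (Polynomial.coeff P n)"
  by (simp add: coeff_map_poly)

lemma ac_poly_add: "ac_poly (P + Q) = ac_poly P + ac_poly Q"
  by (rule poly_eqI) (simp add: coeff_ac_poly)

lemma ac_poly_mult: "ac_poly (P * Q) = ac_poly P * ac_poly Q"
  by (rule poly_eqI) (simp add: coeff_ac_poly coeff_mult to_ac_sum)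

lemma ac_poly_pderiv: "ac_poly (pderiv P) = pderiv (ac_poly P)"
  by (rule poly_eqI) (simp add: coeff_ac_poly coeff_pderiv)

lemma degree_ac_poly: "Polynomial.degree (ac_poly P) = Polynomial.degree P"
  by (rule degree_map_poly) simp

lemma ac_poly_eq_0_iff: "ac_poly P = 0 \<longleftrightarrow> P = 0"
  by (rule map_poly_eq_0_iff) auto

lemma poly_ac_poly: "poly (ac_poly P) x = (\<Sum>i\<le>Polynomial.degree P. to_ac (Polynomial.coeff P i) * x ^ i)"
  by (simp add: poly_altdef degree_ac_poly coeff_ac_poly)

lemma minimal_polynomial:
  fixes x :: "'f::field alg_closure"
  obtains m :: "'f poly" where "Factorial_Ring.irreducible m" "poly (ac_poly m) x = 0"
    "\<And>P. poly (ac_poly P) x = 0 \<Longrightarrow> m dvd P"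
proof -
  define R where "R = (\<lambda>P :: 'f poly. P \<noteq> 0 \<and> poly (ac_poly P) x = 0)"
  have "\<exists>P. R P" using alg_closure_algebraic[of x] unfolding R_def by metis
  then obtain m where m: "R m" and min: "\<And>P. R P \<Longrightarrow> Polynomial.degree m \<le> Polynomial.degree P"
    using exists_least_iff[of "\<lambda>n. \<exists>P. R P \<and> Polynomial.degree P = n"]
    by (metis not_le)
  have dvd: "m dvd P" if "poly (ac_poly P) x = 0" for P
  proof -
    have "P = m * (P div m) + P mod m" by simp
    then have "ac_poly P = ac_poly m * ac_poly (P div m) + ac_poly (P mod m)"
      by (metis ac_poly_add ac_poly_mult)
    then have "poly (ac_poly (P mod m)) x = 0"
      using that m by (simp add: R_def)
    then have "P mod m = 0"
      using min[of "P mod m"] m degree_mod_less[of m P] by (force simp: R_def)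
    then show ?thesis by auto
  qed
  have "Factorial_Ring.irreducible m"
  proof (rule Factorial_Ring.irreducibleI)
    show "m \<noteq> 0" using m by (simp add: R_def)
    show "\<not> is_unit m"
    proof
      assume "is_unit m"
      then obtain c where "m = [:c:]" "c \<noteq> 0" using \<open>m \<noteq> 0\<close> by (auto simp: is_unit_poly_iff)
      then show False using m by (simp add: R_def map_poly_pCons)
    qed
    fix a b assume ab: "m = a * b"
    then have "a \<noteq> 0" "b \<noteq> 0" using \<open>m \<noteq> 0\<close> by auto
    have "poly (ac_poly a) x = 0 \<or> poly (ac_poly b) x = 0"
      using m ab by (auto simp: R_def ac_poly_mult)
    then have "m dvd a \<or> m dvd b" using dvd by blast
    then show "is_unit a \<or> is_unit b"
      using ab \<open>a \<noteq> 0\<close> \<open>b \<noteq> 0\<close>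
      by (metis dvd_mult_cancel_left dvd_mult_cancel_right mult.comm_neutral mult.left_neutral)
  qed
  then show ?thesis using that m dvd unfolding R_def by blast
qed

lemma degree_pderiv_less:
  assumes "pderiv P \<noteq> 0"
  shows "Polynomial.degree (pderiv P) < Polynomial.degree P"
proof -
  have "Polynomial.coeff (pderiv P) n = 0" if "n \<ge> Polynomial.degree P" for n
    using that by (simp add: coeff_pderiv coeff_eq_0)
  then show ?thesis
    using assms by (metis leading_coeff_0_iff not_le)
qed

text \<open>
  If \<open>x\<close> is a simple root of some \<open>P\<close>, then the minimal polynomial \<open>m\<close> of \<open>x\<close> has a non-zero
  derivative. No root of \<open>m\<close> is multiple, since \<open>m\<close> is also its minimal polynomial, up to a unit,
  and the derivative has too small a degree to be a multiple of it.
\<close>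

lemma separable_over_baseI:
  fixes x :: "'f::field alg_closure"
  assumes P: "poly (ac_poly P) x = 0" "poly (ac_poly (pderiv P)) x \<noteq> 0"
  shows "separable_over_base x"
proof -
  obtain m :: "'f poly" where m: "Factorial_Ring.irreducible m" "poly (ac_poly m) x = 0"
    and min: "\<And>P. poly (ac_poly P) x = 0 \<Longrightarrow> m dvd P"
    using minimal_polynomial[of x] by blast
  have "m \<noteq> 0" using m(1) by auto
  obtain Q where Q: "P = m * Q" using min[OF P(1)] by blast
  have "pderiv m \<noteq> 0"
    using P(2) m(2) by (auto simp: Q pderiv_mult ac_poly_mult)
  then have deg: "Polynomial.degree (pderiv m) < Polynomial.degree m"
    by (rule degree_pderiv_less)
  have simple: "poly (pderiv (ac_poly m)) a \<noteq> 0" if a: "poly (ac_poly m) a = 0" for a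
  proof
    assume "poly (pderiv (ac_poly m)) a = 0"
    moreover obtain n :: "'f poly" where n: "Factorial_Ring.irreducible n" "poly (ac_poly n) a = 0"
      and minn: "\<And>P. poly (ac_poly P) a = 0 \<Longrightarrow> n dvd P"
      using minimal_polynomial[of a] by blast
    ultimately have "n dvd pderiv m" by (simp add: ac_poly_pderiv)
    moreover have "n dvd m" using minn a by blast
    then have "m dvd n" using m(1) n(1)
      by (metis irreducibleD' Factorial_Ring.irreducible_not_unit)
    ultimately have "m dvd pderiv m" by (rule dvd_trans[rotated])
    from dvd_imp_degree_le[OF this \<open>pderiv m \<noteq> 0\<close>] show False using deg by simp
  qed
  have "rsquarefree (ac_poly m)"
    unfolding rsquarefree_def
  proof (intro conjI allI)
    show "ac_poly m \<noteq> 0" using \<open>m \<noteq> 0\<close> by (simp add: ac_poly_eq_0_iff)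
    fix a
    show "Polynomial.order a (ac_poly m) = 0 \<or> Polynomial.order a (ac_poly m) = 1"
    proof (rule ccontr)
      assume "\<not> ?thesis"
      then have "2 \<le> Polynomial.order a (ac_poly m)" by auto
      then have "[:-a, 1:] ^ 2 dvd ac_poly m"
        by (rule power_le_dvd[OF order_1])
      then obtain R where R: "ac_poly m = [:-a, 1:] ^ 2 * R" by blast
      then have "poly (ac_poly m) a = 0" "poly (pderiv (ac_poly m)) a = 0"
        by (simp_all add: R power2_eq_square pderiv_mult del: mult_pCons_left mult_pCons_right)
      then show False using simple by blast
    qed
  qed
  then show ?thesis using m unfolding separable_over_base_def by blast
qed

lemma separable_minimal_polynomial:
  fixes x :: "'f::field alg_closure"
  assumes "separable_over_base x"
  obtains m :: "'f poly" where "Factorial_Ring.irreducible m" "poly (ac_poly m) x = 0"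
    "rsquarefree (ac_poly m)" "\<And>P. poly (ac_poly P) x = 0 \<Longrightarrow> m dvd P"
proof -
  obtain P :: "'f poly" where P: "Factorial_Ring.irreducible P" "rsquarefree (ac_poly P)" "poly (ac_poly P) x = 0"
    using assms unfolding separable_over_base_def by blast
  obtain m :: "'f poly" where m: "Factorial_Ring.irreducible m" "poly (ac_poly m) x = 0"
    and min: "\<And>P. poly (ac_poly P) x = 0 \<Longrightarrow> m dvd P"
    using minimal_polynomial[of x] by blast
  have "P dvd m"
    using min[OF P(3)] P(1) m(1) by (metis irreducibleD' Factorial_Ring.irreducible_not_unit)
  then show ?thesis using that[OF P(1,3,2)] min by (meson dvd_trans)
qed

lemma card_roots_rsquarefree:
  fixes P :: "'a::alg_closed_field poly"
  assumes "rsquarefree P"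
  shows "card {x. poly P x = 0} = Polynomial.degree P"
proof -
  have "P \<noteq> 0" using assms by (simp add: rsquarefree_def)
  then obtain A where A: "size A = Polynomial.degree P"
    "P = Polynomial.smult (Polynomial.lead_coeff P) (\<Prod>x\<in>#A. [:-x, 1:])"
    using alg_closed_imp_factorization[OF \<open>P \<noteq> 0\<close>] by blast
  have count: "Polynomial.order a P = count A a" for a
  proof -
    have "Polynomial.order a (\<Prod>x\<in>#A. [:-x, 1:]) = count A a"
    proof (induction A)
      case (add x A)
      have ne: "(\<Prod>x\<in>#A. [:-x, 1:]) \<noteq> 0" by auto
      have "Polynomial.order a [:-x, 1:] = (if a = x then 1 else 0)"
        using order_power_n_n[of x 1] by (auto simp: order_0I)
      then have "Polynomial.order a ([:-x, 1:] * (\<Prod>x\<in>#A. [:-x, 1:])) = (if a = x then 1 else 0) + count A a"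
        using add ne by (subst order_mult) (auto simp del: mult_pCons_left)
      then show ?case by simp
    qed simp
    moreover have "Polynomial.order a P = Polynomial.order a (\<Prod>x\<in>#A. [:-x, 1:])"
      using \<open>P \<noteq> 0\<close> by (subst A(2)) (rule order_smult, simp)
    ultimately show ?thesis by simp
  qed
  have "count A a \<le> 1" for a
    using assms count[of a] unfolding rsquarefree_def by (metis le_numeral_extra(4) zero_le_one)
  then have "count A a = count (mset_set (set_mset A)) a" for a
    by (cases "a \<in># A") (simp_all add: order_antisym not_in_iff)
  then have "A = mset_set (set_mset A)"
    by (rule multiset_eqI)
  moreover have "set_mset A = {x. poly P x = 0}"
    using count \<open>P \<noteq> 0\<close> by (auto simp: order_root)
  ultimately show ?thesis using A(1) by (metis size_mset_set)
qed

text \<open>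
  Used in two ways: the span of \<open>monoid_gen Y\<close> over the base field is the subalgebra generated by
  \<open>Y\<close>, and automorphisms restricted to \<open>monoid_gen Y\<close> are characters determined by their values
  on \<open>Y\<close>.
\<close>

definition monoid_gen :: "'a::monoid_mult set \<Rightarrow> 'a set" where
  "monoid_gen Y = prod_list ` lists Y"

lemma monoid_gen_1: "1 \<in> monoid_gen Y"
  unfolding monoid_gen_def by (rule image_eqI[of _ _ "[]"]) auto

lemma monoid_gen_step: "x \<in> Y \<Longrightarrow> m \<in> monoid_gen Y \<Longrightarrow> x * m \<in> monoid_gen Y"
  unfolding monoid_gen_def by (metis (no_types, lifting) Cons_in_lists_iff image_iff prod_list.Cons)

lemma monoid_gen_induct [consumes 1, case_names one step]:
  assumes "m \<in> monoid_gen Y" "P 1" "\<And>x m. x \<in> Y \<Longrightarrow> m \<in> monoid_gen Y \<Longrightarrow> P m \<Longrightarrow> P (x * m)"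
  shows "P m"
proof -
  obtain xs where "xs \<in> lists Y" "m = prod_list xs"
    using assms(1) unfolding monoid_gen_def by blast
  then show ?thesis
    by (induction xs arbitrary: m) (auto intro!: assms(2,3) simp: monoid_gen_def)
qed

lemma monoid_gen_mult:
  assumes "m \<in> monoid_gen Y" "n \<in> monoid_gen Y"
  shows "m * n \<in> monoid_gen Y"
  using assms(1)
  by (induction rule: monoid_gen_induct) (auto simp: mult.assoc assms(2) intro: monoid_gen_step)

lemma monoid_gen_superset: "x \<in> Y \<Longrightarrow> x \<in> monoid_gen Y"
  using monoid_gen_step[OF _ monoid_gen_1, of x Y] by simp

lemma span_mult_closed:
  assumes "u \<in> ac.span A" "v \<in> ac.span B" "\<And>a b. a \<in> A \<Longrightarrow> b \<in> B \<Longrightarrow> a * b \<in> ac.span C"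
  shows "u * v \<in> ac.span C"
  using assms(1)
proof (induction rule: ac.span_induct_alt)
  case base
  then show ?case by (simp add: ac.span_zero)
next
  case (step c a y)
  have "a * v \<in> ac.span C"
    using assms(2)
  proof (induction rule: ac.span_induct_alt)
    case base
    then show ?case by (simp add: ac.span_zero)
  next
    case (step c b y)
    then have "to_ac c * (a * b) + a * y \<in> ac.span C"
      using assms(3) \<open>a \<in> A\<close> by (intro ac.span_add ac.span_scale) auto
    then show ?case by (simp add: algebra_simps)
  qed
  then have "to_ac c * (a * v) + y * v \<in> ac.span C"
    using step by (intro ac.span_add ac.span_scale) auto
  then show ?case by (simp add: algebra_simps)
qed

text \<open>The minimal polynomial of \<open>x\<close> has a non-zero constant term, so it gives \<open>1 / x\<close> as a polynomial in \<open>x\<close>.\<close>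

lemma inverse_in_subalgebra:
  fixes x :: "'f::field alg_closure"
  assumes "x \<in> E" and add: "\<And>x y. x \<in> E \<Longrightarrow> y \<in> E \<Longrightarrow> x + y \<in> E"
    and mult: "\<And>x y. x \<in> E \<Longrightarrow> y \<in> E \<Longrightarrow> x * y \<in> E" and base: "\<And>c. to_ac c \<in> E"
  shows "inverse x \<in> E"
proof (cases "x = 0")
  case True
  then show ?thesis using assms(1) by simp
next
  case False
  obtain m :: "'f poly" where m: "Factorial_Ring.irreducible m" "poly (ac_poly m) x = 0"
    and min: "\<And>P. poly (ac_poly P) x = 0 \<Longrightarrow> m dvd P"
    using minimal_polynomial[of x] by blast
  obtain c Q where Q: "m = pCons c Q" by (cases m)
  have eq: "to_ac c + x * poly (ac_poly Q) x = 0"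
    using m(2) by (simp add: Q map_poly_pCons)
  have "c \<noteq> 0"
  proof
    assume "c = 0"
    then have "poly (ac_poly Q) x = 0" using eq False by simp
    then have "m dvd Q" by (rule min)
    moreover have "Q \<noteq> 0" using m(1) \<open>c = 0\<close> by (auto simp: Q)
    ultimately show False using dvd_imp_degree_le[of m Q] by (simp add: Q)
  qed
  have ev: "poly (ac_poly P) x \<in> E" for P
    by (induction P) (use base[of 0] assms in \<open>auto simp: map_poly_pCons\<close>)
  have "inverse x = to_ac (- inverse c) * poly (ac_poly Q) x"
  proof -
    have "x * poly (ac_poly Q) x = - to_ac c" using eq by (simp add: add_eq_0_iff2)
    then have "x * (to_ac (- inverse c) * poly (ac_poly Q) x) = 1"
      using \<open>c \<noteq> 0\<close> by (subst mult.left_commute) simp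
    then show ?thesis by (rule inverse_unique)
  qed
  then show ?thesis using mult[OF base ev] by (simp only:)
qed

lemma powers_in_span:
  fixes x :: "'f::field alg_closure"
  assumes P: "P \<noteq> 0" "poly (ac_poly P) x = 0" and "d = Polynomial.degree P"
  shows "x ^ i \<in> ac.span ((\<lambda>k. x ^ k) ` {..<d})"
proof -
  note d_def = assms(3)
  define W where "W = ac.span ((\<lambda>k. x ^ k) ` {..<d})"
  define a where "a = Polynomial.lead_coeff P"
  have "a \<noteq> 0" using P by (simp add: a_def)
  have "(\<Sum>i<d. to_ac (Polynomial.coeff P i) * x ^ i) + to_ac a * x ^ d = 0"
    using P(2) by (simp add: poly_ac_poly flip: d_def lessThan_Suc_atMost) (simp add: d_def a_def)
  then have "x ^ d = to_ac (- inverse a) * (\<Sum>i<d. to_ac (Polynomial.coeff P i) * x ^ i)"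
    using \<open>a \<noteq> 0\<close> by (simp add: field_simps add_eq_0_iff2)
  moreover have "(\<Sum>i<d. to_ac (Polynomial.coeff P i) * x ^ i) \<in> W"
    unfolding W_def by (intro ac.span_sum ac.span_scale ac.span_base) auto
  ultimately have d: "x ^ d \<in> W"
    unfolding W_def by (simp only: ac.span_scale)
  have "x ^ i \<in> W" for i
  proof (induction i)
    case 0
    show ?case
    proof (cases "d = 0")
      case False
      then show ?thesis unfolding W_def by (intro ac.span_base image_eqI[of _ _ 0]) auto
    qed (use d in simp)
  next
    case (Suc i)
    have "x * x ^ k \<in> W" if "k < d" for k
    proof (cases "Suc k = d")
      case True
      then show ?thesis using d by auto
    next
      case False
      then show ?thesis using that unfolding W_def by (intro ac.span_base image_eqI[of _ _ "Suc k"]) auto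
    qed
    then have "x * x ^ i \<in> W"
      using Suc unfolding W_def
      by (intro span_mult_closed[OF ac.span_base[of x "{x}"]]) auto
    then show ?case by simp
  qed
  then show ?thesis unfolding W_def .
qed

lemma finite_dimensional_algebra:
  assumes "finite Y"
  shows "\<exists>B. finite B \<and> ac.span (monoid_gen Y) \<subseteq> ac.span B"
  using assms
proof induction
  case empty
  have "monoid_gen {} \<subseteq> {1 :: 'a alg_closure}"
    by (auto simp: monoid_gen_def)
  then show ?case using ac.span_mono by blast
next
  case (insert x Y)
  then obtain B where B: "finite B" "ac.span (monoid_gen Y) \<subseteq> ac.span B" by blast
  obtain P :: "'a poly" where P: "P \<noteq> 0" "poly (ac_poly P) x = 0"
    by (rule alg_closure_algebraic)
  define d where "d = Polynomial.degree P"
  note d = powers_in_span[OF P d_def]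
  let ?C = "(\<lambda>(k, b). x ^ k * b) ` ({..<d} \<times> B)"
  have "\<exists>i. \<exists>n \<in> monoid_gen Y. m = x ^ i * n" if "m \<in> monoid_gen (insert x Y)" for m
    using that
  proof (induction rule: monoid_gen_induct)
    case one
    have "(1 :: 'a alg_closure) = x ^ 0 * 1" by simp
    then show ?case using monoid_gen_1 by blast
  next
    case (step y m)
    then obtain i n where n: "n \<in> monoid_gen Y" "m = x ^ i * n" by blast
    show ?case
    proof (cases "y = x")
      case True
      then have "y * m = x ^ Suc i * n" using n by (simp add: mult.assoc)
      then show ?thesis using n by blast
    next
      case False
      then have "y * n \<in> monoid_gen Y" using step.hyps(1) n by (auto intro: monoid_gen_step)
      moreover have "y * m = x ^ i * (y * n)" using n by (simp add: algebra_simps)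
      ultimately show ?thesis by blast
    qed
  qed
  moreover have "x ^ i * n \<in> ac.span ?C" if "n \<in> monoid_gen Y" for i n
  proof (rule span_mult_closed[OF d[of i]])
    show "n \<in> ac.span B" using B(2) ac.span_base[OF that] by blast
    fix a b assume "a \<in> (\<lambda>k. x ^ k) ` {..<d}" "b \<in> B"
    then have "a * b \<in> ?C" by auto
    then show "a * b \<in> ac.span ?C" by (rule ac.span_base)
  qed
  ultimately have "monoid_gen (insert x Y) \<subseteq> ac.span ?C" by blast
  then have "ac.span (monoid_gen (insert x Y)) \<subseteq> ac.span ?C"
    by (rule ac.span_minimal) (rule ac.subspace_span)
  moreover have "finite ?C" using B by simp
  ultimately show ?case by blast
qed

lemma independent_powers:
  fixes x :: "'f::field alg_closure"
  assumes "\<And>P :: 'f poly. P \<noteq> 0 \<Longrightarrow> Polynomial.degree P < d \<Longrightarrow> poly (ac_poly P) x \<noteq> 0"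
  shows "inj_on (\<lambda>i. x ^ i) {..<d}" "ac.independent ((\<lambda>i. x ^ i) ` {..<d})"
proof -
  have zero: "u i = 0" if "(\<Sum>i<d. to_ac (u i) * x ^ i) = 0" "i < d" for u i
  proof -
    define P where "P = (\<Sum>i<d. Polynomial.monom (u i) i)"
    have coeff: "Polynomial.coeff P k = (if k < d then u k else 0)" for k
     by (simp add: P_def coeff_sum)
    have "P = 0"
    proof (rule ccontr)
      assume "P \<noteq> 0"
      then have "Polynomial.degree P < d"
        using coeff by (metis leading_coeff_0_iff)
      moreover have "poly (ac_poly P) x = 0"
      proof -
        have "poly (ac_poly P) x = (\<Sum>i<d. to_ac (Polynomial.coeff P i) * x ^ i)"
          unfolding poly_ac_poly using \<open>Polynomial.degree P < d\<close>
          by (intro sum.mono_neutral_left) (auto simp: coeff_eq_0)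
        then show ?thesis using that(1) by (simp add: coeff)
      qed
      ultimately show False using assms \<open>P \<noteq> 0\<close> by blast
    qed
    then show ?thesis using coeff[of i] that(2) by simp
  qed
  show inj: "inj_on (\<lambda>i. x ^ i) {..<d}"
  proof (rule inj_onI)
    fix i j assume ij: "i \<in> {..<d}" "j \<in> {..<d}" "x ^ i = x ^ j"
    show "i = j"
    proof (rule ccontr)
      assume "i \<noteq> j"
      let ?u = "\<lambda>k. if k = i then 1 else if k = j then -1 else 0"
      have "(\<Sum>k<d. to_ac (?u k) * x ^ k) = (\<Sum>k\<in>{i, j}. to_ac (?u k) * x ^ k)"
        using ij by (intro sum.mono_neutral_right) auto
      also have "\<dots> = 0" using ij \<open>i \<noteq> j\<close> by simp
      finally show False using zero[of ?u i] ij by simp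
    qed
  qed
  show "ac.independent ((\<lambda>i. x ^ i) ` {..<d})"
  proof
    assume "ac.dependent ((\<lambda>i. x ^ i) ` {..<d})"
    moreover have "finite ((\<lambda>i. x ^ i) ` {..<d})" by simp
    ultimately obtain u i where u: "i < d" "u (x ^ i) \<noteq> 0"
      "(\<Sum>v\<in>(\<lambda>i. x ^ i) ` {..<d}. to_ac (u v) * v) = 0"
      using ac.dependent_finite[of "(\<lambda>i. x ^ i) ` {..<d}"] by auto
    then have "(\<Sum>i<d. to_ac (u (x ^ i)) * x ^ i) = 0"
      by (simp only: sum.reindex[OF inj] comp_def)
    then show False using zero[of "\<lambda>i. u (x ^ i)" i] u by simp
  qed
qed

lemma independent_spans:
  assumes "ac.independent A" "A \<subseteq> ac.span B" "finite B" "card B \<le> card A"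
  shows "ac.span B \<subseteq> ac.span A"
proof -
  have "b \<in> ac.span A" if "b \<in> B" for b
  proof (rule ccontr)
    assume b: "b \<notin> ac.span A"
    then have "ac.independent (insert b A)"
      using assms(1) by (simp add: ac.independent_insert)
    moreover have "insert b A \<subseteq> ac.span B" using assms(2) that by (simp add: ac.span_base)
    ultimately have "finite (insert b A)" "card (insert b A) \<le> card B"
      using ac.independent_span_bound[OF assms(3), of "insert b A"] by simp_all
    moreover have "b \<notin> A" using b ac.span_base[of b A] by (rule contrapos_nn)
    ultimately show False using assms(4) by simp
  qed
  then have "B \<subseteq> ac.span A" by (rule subsetI)
  then show ?thesis by (rule ac.span_minimal) (rule ac.subspace_span)
qed

lemma spanning_independent:
  assumes "ac.independent A" "A \<subseteq> ac.span B" "finite B" "card B \<le> card A"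
  shows "ac.independent B"
proof
  assume "ac.dependent B"
  then obtain b where b: "b \<in> B" "b \<in> ac.span (B - {b})"
    unfolding ac.dependent_def by (elim bexE)
  then have "ac.span B = ac.span (B - {b})"
    using ac.span_redundant[OF b(2)] by (simp add: insert_absorb)
  then have "card A \<le> card (B - {b})"
    using ac.independent_span_bound[of "B - {b}" A] assms(1-3) by simp
  then have "card B \<le> card B - 1" using b(1) assms(4) by simp
  moreover have "card B > 0" using b(1) assms(3) by (auto simp: card_gt_0_iff)
  ultimately show False by simp
qed

lemma span_monoid_gen_mult:
  "u \<in> ac.span (monoid_gen Y) \<Longrightarrow> v \<in> ac.span (monoid_gen Y) \<Longrightarrow> u * v \<in> ac.span (monoid_gen Y)"
  by (erule span_mult_closed, assumption) (auto intro: ac.span_base monoid_gen_mult)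

lemma to_ac_in_span_monoid_gen: "to_ac c \<in> ac.span (monoid_gen Y)"
  using ac.span_scale[OF ac.span_base[OF monoid_gen_1], of c Y] by simp

lemma Frobenius_span:
  fixes C :: "'f::field alg_closure set"
  assumes l: "Factorial_Ring.prime CHAR('f)" and x: "x \<in> ac.span C"
  shows "x ^ CHAR('f) \<in> ac.span ((\<lambda>y. y ^ CHAR('f)) ` C)"
  using x
proof (induction rule: ac.span_induct_alt)
  case base
  have "CHAR('f) > 0" using l by (rule prime_gt_0_nat)
  then show ?case by (simp add: ac.span_zero power_0_left)
next
  case (step c a y)
  have l': "Factorial_Ring.prime CHAR('f alg_closure)" using l by simp
  have "(to_ac c * a + y) ^ CHAR('f) = (to_ac c * a) ^ CHAR('f) + y ^ CHAR('f)"
    using freshmans_dream[OF l' refl, of "to_ac c * a" y] by simp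
  then have eq: "(to_ac c * a + y) ^ CHAR('f) = to_ac (c ^ CHAR('f)) * a ^ CHAR('f) + y ^ CHAR('f)"
    by (simp add: power_mult_distrib)
  have "a ^ CHAR('f) \<in> ac.span ((\<lambda>y. y ^ CHAR('f)) ` C)"
    using step(1) by (intro ac.span_base imageI)
  then show ?case using step(2) unfolding eq by (intro ac.span_add ac.span_scale)
qed

lemma Frobenius_inj:
  fixes x y :: "'f::field alg_closure"
  assumes l: "Factorial_Ring.prime CHAR('f)" and xy: "x ^ CHAR('f) = y ^ CHAR('f)"
  shows "x = y"
proof -
  have l': "Factorial_Ring.prime CHAR('f alg_closure)" using l by simp
  have "x ^ CHAR('f) = (x - y) ^ CHAR('f) + y ^ CHAR('f)"
    using freshmans_dream[OF l' refl, of "x - y" y] by simp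
  then show ?thesis using xy by simp
qed

lemma span_Frobenius_mult:
  fixes Y :: "'f::field alg_closure set" and n :: nat
  defines "S \<equiv> ac.span ((\<lambda>x. x ^ n) ` ac.span (monoid_gen Y))"
  assumes "a \<in> S" "b \<in> S"
  shows "a * b \<in> S"
  unfolding S_def
proof (rule span_mult_closed)
  let ?E = "ac.span (monoid_gen Y)"
  show "a \<in> ac.span ((\<lambda>x. x ^ n) ` ?E)" "b \<in> ac.span ((\<lambda>x. x ^ n) ` ?E)"
    using assms by auto
  fix a b assume "a \<in> (\<lambda>x. x ^ n) ` ?E" "b \<in> (\<lambda>x. x ^ n) ` ?E"
  then obtain a' b' where ab: "a' \<in> ?E" "b' \<in> ?E" "a = a' ^ n" "b = b' ^ n" by blast
  have "a * b = (a' * b') ^ n" using ab by (simp add: power_mult_distrib)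
  then have "a * b \<in> (\<lambda>x. x ^ n) ` ?E" using ab span_monoid_gen_mult by blast
  then show "a * b \<in> ac.span ((\<lambda>x. x ^ n) ` ?E)" by (rule ac.span_base)
qed

lemma separable_if_pderiv_nonzero:
  fixes z :: "'f::field alg_closure"
  assumes "Factorial_Ring.irreducible m" "poly (ac_poly m) z = 0"
    and min: "\<And>P. poly (ac_poly P) z = 0 \<Longrightarrow> m dvd P" and "pderiv m \<noteq> 0"
  shows "separable_over_base z"
proof (rule separable_over_baseI[OF assms(2)])
  show "poly (ac_poly (pderiv m)) z \<noteq> 0"
    using min[of "pderiv m"] dvd_imp_degree_le[of m "pderiv m"] degree_pderiv_less[of m] assms(4) by auto
qed

lemma degree_minimal_polynomial_pos:
  assumes "Factorial_Ring.irreducible m" "poly (ac_poly m) z = 0"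
  shows "Polynomial.degree m > 0"
proof (rule ccontr)
  assume "\<not> ?thesis"
  then obtain c where "m = [:c:]" by (metis degree_eq_zeroE gr0I)
  then show False using assms by (auto simp: map_poly_pCons)
qed

lemma separable_char_0:
  fixes z :: "'f::field alg_closure"
  assumes "CHAR('f) = 0"
  shows "separable_over_base z"
proof -
  obtain m :: "'f poly" where m: "Factorial_Ring.irreducible m" "poly (ac_poly m) z = 0"
    and min: "\<And>P. poly (ac_poly P) z = 0 \<Longrightarrow> m dvd P"
    using minimal_polynomial[of z] by blast
  define d where "d = Polynomial.degree m - 1"
  have d: "Polynomial.degree m = Suc d" using degree_minimal_polynomial_pos[OF m] by (simp add: d_def)
  have "(of_nat (Suc d) :: 'f) \<noteq> 0" using assms by (subst of_nat_eq_0_iff_char_dvd) auto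
  then have "Polynomial.coeff (pderiv m) d \<noteq> 0"
    using d m(1) by (metis coeff_pderiv leading_coeff_0_iff mult_eq_0_iff nat.distinct(1) degree_0)
  then have "pderiv m \<noteq> 0" by auto
  then show ?thesis using separable_if_pderiv_nonzero[OF m] min by blast
qed

text \<open>
  Frobenius maps a basis of the finite-dimensional algebra \<open>E\<close> to a spanning set of the same size,
  hence to a basis. An inseparable \<open>z\<close> of degree \<open>d\<close> would contradict this: its powers below \<open>d\<close>
  are independent, but a minimal polynomial in \<open>z ^ l\<close> is a dependency of their \<open>l\<close>-th powers.
\<close>

lemma separable_if_spanned_by_Frobenius:
  fixes Y :: "'f::field alg_closure set"
  defines "l \<equiv> CHAR('f)" and "E \<equiv> ac.span (monoid_gen Y)"
  assumes l: "Factorial_Ring.prime l" and "finite Y"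
    and gen: "\<And>y. y \<in> Y \<Longrightarrow> y \<in> ac.span ((\<lambda>x. x ^ l) ` E)" and z: "z \<in> E"
  shows "separable_over_base z"
proof -
  obtain m :: "'f poly" where m: "Factorial_Ring.irreducible m" "poly (ac_poly m) z = 0"
    and min: "\<And>P. poly (ac_poly P) z = 0 \<Longrightarrow> m dvd P"
    using minimal_polynomial[of z] by blast
  define d where "d = Polynomial.degree m"
  have "d > 0" using degree_minimal_polynomial_pos[OF m] by (simp add: d_def)
  have "l > 1" using l by (rule prime_gt_1_nat)
  have "pderiv m \<noteq> 0"
  proof
    assume pd: "pderiv m = 0"
    have coeff0: "Polynomial.coeff m i = 0" if "\<not> l dvd i" for i
    proof -
      have "i \<noteq> 0" using that by (metis dvd_0_right)
      then obtain j where j: "i = Suc j" by (cases i) auto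
      have "of_nat i * Polynomial.coeff m i = 0"
        using arg_cong[OF pd, of "\<lambda>P. Polynomial.coeff P j"] j by (simp add: coeff_pderiv)
      moreover have "(of_nat i :: 'f) \<noteq> 0"
        using that unfolding l_def by (subst of_nat_eq_0_iff_char_dvd)
      ultimately show ?thesis by simp
    qed
    have "Polynomial.coeff m d \<noteq> 0" using m(1) by (auto simp: d_def)
    then have "l dvd d" using coeff0 by blast
    then obtain e where e: "d = l * e" by blast
    have "e > 0" "e < d" using \<open>d > 0\<close> \<open>l > 1\<close> e by auto
    let ?p = "\<lambda>i. z ^ i"
    let ?D = "?p ` {..<d}"
    have "poly (ac_poly P) z \<noteq> 0" if "P \<noteq> 0" "Polynomial.degree P < d" for P
      using min[of P] dvd_imp_degree_le[of m P] that by (auto simp: d_def)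
    note D = independent_powers[of d z, OF this]
    have pE: "z ^ i \<in> E" for i
      by (induction i) (use z to_ac_in_span_monoid_gen[of 1 Y] in \<open>auto simp: E_def intro: span_monoid_gen_mult\<close>)
    then have "?D \<subseteq> E" by auto
    obtain C where C: "?D \<subseteq> C" "C \<subseteq> E" "ac.independent C" "E \<subseteq> ac.span C"
      by (rule ac.maximal_independent_subset_extend[OF \<open>?D \<subseteq> E\<close> D(2)])
    obtain B where B: "finite B" "E \<subseteq> ac.span B"
      using finite_dimensional_algebra[OF \<open>finite Y\<close>] by (auto simp: E_def)
    have "finite C"
      using ac.independent_span_bound[OF B(1) C(3)] C(2) B(2) by simp
    let ?Fr = "\<lambda>x :: 'f alg_closure. x ^ l"
    have inj: "inj_on ?Fr A" for A
      using Frobenius_inj l unfolding l_def by (auto intro: inj_onI)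
    have FrE: "?Fr ` E \<subseteq> ac.span (?Fr ` C)"
      using Frobenius_span[of _ C] l C(4) unfolding l_def by auto
    have "monoid_gen Y \<subseteq> ac.span (?Fr ` E)"
    proof
      fix n assume "n \<in> monoid_gen Y"
      then show "n \<in> ac.span (?Fr ` E)"
      proof (induction rule: monoid_gen_induct)
        case one
        have "(1 :: 'f alg_closure) \<in> ?Fr ` E"
          using to_ac_in_span_monoid_gen[of 1 Y] by (intro image_eqI[of _ _ 1]) (auto simp: E_def)
        then show ?case by (rule ac.span_base)
      next
        case (step y n)
        show ?case
          using gen[OF step(1)] step(3) unfolding E_def by (rule span_Frobenius_mult)
      qed
    qed
    then have "E \<subseteq> ac.span (?Fr ` E)"
      unfolding E_def by (rule ac.span_minimal) (rule ac.subspace_span)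
    also have "\<dots> \<subseteq> ac.span (?Fr ` C)"
      using FrE by (rule ac.span_minimal) (rule ac.subspace_span)
    finally have "C \<subseteq> ac.span (?Fr ` C)" using C(2) by simp
    then have "ac.independent (?Fr ` C)"
      using \<open>finite C\<close> by (intro spanning_independent[OF C(3)]) (auto simp: card_image_le)
    then have ind: "ac.independent (?Fr ` ?D)"
      by (rule ac.independent_mono) (use C(1) in auto)
    have inj': "inj_on (\<lambda>i. ?Fr (z ^ i)) {..<d}"
      using comp_inj_on[OF D(1) inj] by (simp add: comp_def)
    have "(\<Sum>i\<le>e. to_ac (Polynomial.coeff m (l * i)) * ?Fr (z ^ i)) = poly (ac_poly m) z"
    proof -
      have "poly (ac_poly m) z = (\<Sum>i\<le>d. to_ac (Polynomial.coeff m i) * z ^ i)"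
        by (simp add: poly_ac_poly d_def)
      also have "\<dots> = (\<Sum>i\<in>(\<lambda>i. l * i) ` {..e}. to_ac (Polynomial.coeff m i) * z ^ i)"
      proof (rule sum.mono_neutral_right)
        show "\<forall>i\<in>{..d} - (\<lambda>i. l * i) ` {..e}. to_ac (Polynomial.coeff m i) * z ^ i = 0"
        proof
          fix i assume i: "i \<in> {..d} - (\<lambda>i. l * i) ` {..e}"
          have "\<not> l dvd i" using i e \<open>l > 1\<close> by (auto elim!: dvdE)
          then show "to_ac (Polynomial.coeff m i) * z ^ i = 0" using coeff0 by simp
        qed
      qed (use e in auto)
      also have "\<dots> = (\<Sum>i\<le>e. to_ac (Polynomial.coeff m (l * i)) * ?Fr (z ^ i))"
        using \<open>l > 1\<close> by (subst sum.reindex) (auto simp: inj_on_def mult.commute simp flip: power_mult)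
      finally show ?thesis by simp
    qed
    then have sum0: "(\<Sum>i\<le>e. to_ac (Polynomial.coeff m (l * i)) * ?Fr (z ^ i)) = 0" using m(2) by simp
    define u where "u = (\<lambda>v. Polynomial.coeff m (l * the_inv_into {..<d} (\<lambda>i. ?Fr (z ^ i)) v))"
    have u: "u (?Fr (z ^ i)) = Polynomial.coeff m (l * i)" if "i < d" for i
      unfolding u_def using the_inv_into_f_f[OF inj', of i] that by simp
    define S where "S = (\<lambda>i. ?Fr (z ^ i)) ` {..e}"
    have "(\<Sum>v\<in>S. to_ac (u v) * v) = (\<Sum>i\<le>e. to_ac (u (?Fr (z ^ i))) * ?Fr (z ^ i))"
      unfolding S_def using \<open>e < d\<close> by (subst sum.reindex) (auto intro: inj_on_subset[OF inj'])
    also have "\<dots> = 0" using sum0 u \<open>e < d\<close> by simp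
    finally have "(\<Sum>v\<in>S. to_ac (u v) * v) = 0" .
    moreover have "ac.independent S"
      using ind by (rule ac.independent_mono) (use \<open>e < d\<close> in \<open>auto simp: S_def\<close>)
    moreover have "finite S" by (simp add: S_def)
    moreover have "?Fr (z ^ e) \<in> S" by (auto simp: S_def)
    ultimately have "u (?Fr (z ^ e)) = 0"
      by (auto simp: ac.dependent_finite)
    then show False using u[OF \<open>e < d\<close>] \<open>Polynomial.coeff m d \<noteq> 0\<close> e by simp
  qed
  then show ?thesis using separable_if_pderiv_nonzero[OF m] min by blast
qed

text \<open>
  Frobenius is injective on the \<open>d\<close> roots of the minimal polynomial of \<open>x\<close>, so \<open>x ^ l\<close> has degree
  \<open>d\<close> as well and its powers span the same space as those of \<open>x\<close>.
\<close>

lemma separable_in_span_Frobenius: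
  fixes x :: "'f::field alg_closure"
  defines "l \<equiv> CHAR('f)"
  assumes l: "Factorial_Ring.prime l" and x: "separable_over_base x"
  shows "x \<in> ac.span (range (\<lambda>i. (x ^ i) ^ l))"
proof -
  obtain m :: "'f poly" where m: "Factorial_Ring.irreducible m" "poly (ac_poly m) x = 0"
    "rsquarefree (ac_poly m)" and min: "\<And>P. poly (ac_poly P) x = 0 \<Longrightarrow> m dvd P"
    using separable_minimal_polynomial[OF x] by blast
  define d where "d = Polynomial.degree m"
  have "d > 0" using degree_minimal_polynomial_pos[OF m(1,2)] by (simp add: d_def)
  have "l > 0" using l by (rule prime_gt_0_nat)
  let ?R = "{y. poly (ac_poly m) y = 0}"
  have card: "card ?R = d"
    using card_roots_rsquarefree[OF m(3)] by (simp add: d_def degree_ac_poly)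
  have "poly (ac_poly P) (x ^ l) \<noteq> 0" if P: "P \<noteq> 0" "Polynomial.degree P < d" for P
  proof
    assume 0: "poly (ac_poly P) (x ^ l) = 0"
    have ev: "poly (ac_poly (pcompose P (Polynomial.monom 1 l))) y = poly (ac_poly P) (y ^ l)" for y
    proof -
      have "ac_poly (pcompose P Q) = pcompose (ac_poly P) (ac_poly Q)" for P Q :: "'f poly"
        by (induction P) (simp_all add: pcompose_pCons map_poly_pCons ac_poly_add ac_poly_mult)
      then show ?thesis by (simp add: poly_pcompose map_poly_monom poly_monom)
    qed
    have "m dvd pcompose P (Polynomial.monom 1 l)"
      using min 0 ev[of x] by simp
    then obtain Q where "pcompose P (Polynomial.monom 1 l) = m * Q" by blast
    then have "poly (ac_poly P) (y ^ l) = 0" if "poly (ac_poly m) y = 0" for y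
      using ev[of y] that by (simp add: ac_poly_mult)
    then have "(\<lambda>y. y ^ l) ` ?R \<subseteq> {y. poly (ac_poly P) y = 0}" by auto
    moreover have "finite {y. poly (ac_poly P) y = 0}"
      using P by (intro poly_roots_finite) (simp add: ac_poly_eq_0_iff)
    moreover have "card {y. poly (ac_poly P) y = 0} \<le> Polynomial.degree P"
      using P by (metis card_poly_roots_bound ac_poly_eq_0_iff degree_ac_poly)
    moreover have "card ((\<lambda>y. y ^ l) ` ?R) = d"
      using Frobenius_inj l card unfolding l_def by (subst card_image) (auto intro: inj_onI)
    ultimately show False using P(2) card_mono[of "{y. poly (ac_poly P) y = 0}" "(\<lambda>y. y ^ l) ` ?R"] by linarith
  qed
  note ind = independent_powers[of d "x ^ l", OF this]
  let ?B = "(\<lambda>i. x ^ i) ` {..<d}"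
  let ?A = "(\<lambda>i. (x ^ l) ^ i) ` {..<d}"
  have "m \<noteq> 0" using m(1) by auto
  note pw = powers_in_span[OF this m(2) d_def]
  have "ac.span ?B \<subseteq> ac.span ?A"
  proof (rule independent_spans[OF ind(2)])
    show "?A \<subseteq> ac.span ?B" using pw[of "l * i" for i] by (auto simp: power_mult)
    show "card ?B \<le> card ?A" using card_image[OF ind(1)] card_image_le[of "{..<d}" "\<lambda>i. x ^ i"] by simp
    show "finite ?B" by (rule finite_imageI) (rule finite_lessThan)
  qed
  moreover have "ac.span ?A \<subseteq> ac.span (range (\<lambda>i. (x ^ i) ^ l))"
  proof (rule ac.span_mono, rule image_subsetI)
    fix i :: nat
    have "(x ^ l) ^ i = (x ^ i) ^ l" by (metis power_mult mult.commute)
    then show "(x ^ l) ^ i \<in> range (\<lambda>i. (x ^ i) ^ l)" by simp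
  qed
  ultimately show ?thesis using pw[of 1] by auto
qed

section \<open>Closure properties of the separable closure\<close>

lemma CHAR_zero_or_prime: "CHAR('f::field) = 0 \<or> Factorial_Ring.prime CHAR('f)"
  using prime_CHAR_semidom[where ?'a = 'f] by auto

lemma power_in_span_monoid_gen:
  assumes "z \<in> ac.span (monoid_gen Y)"
  shows "z ^ i \<in> ac.span (monoid_gen Y)"
  using assms to_ac_in_span_monoid_gen[of 1 Y] by (induction i) (auto intro: span_monoid_gen_mult)

lemma separable_in_span_Frobenius_algebra:
  fixes Y :: "'f::field alg_closure set"
  assumes "Factorial_Ring.prime CHAR('f)" "separable_over_base y" "y \<in> ac.span (monoid_gen Y)"
  shows "y \<in> ac.span ((\<lambda>x. x ^ CHAR('f)) ` ac.span (monoid_gen Y))"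
proof -
  have "range (\<lambda>i. (y ^ i) ^ CHAR('f)) \<subseteq> (\<lambda>x. x ^ CHAR('f)) ` ac.span (monoid_gen Y)"
    using power_in_span_monoid_gen[OF assms(3)] by auto
  then show ?thesis
    using separable_in_span_Frobenius[OF assms(1,2)] ac.span_mono by blast
qed

lemma separable_algebra:
  fixes Y :: "'f::field alg_closure set"
  assumes "finite Y" "\<And>y. y \<in> Y \<Longrightarrow> separable_over_base y" "z \<in> ac.span (monoid_gen Y)"
  shows "separable_over_base z"
proof (cases "CHAR('f) = 0")
  case True
  then show ?thesis by (rule separable_char_0)
next
  case False
  then have l: "Factorial_Ring.prime CHAR('f)" using CHAR_zero_or_prime by auto
  show ?thesis
  proof (rule separable_if_spanned_by_Frobenius[OF l assms(1) _ assms(3)])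
    fix y assume "y \<in> Y"
    then show "y \<in> ac.span ((\<lambda>x. x ^ CHAR('f)) ` ac.span (monoid_gen Y))"
      by (intro separable_in_span_Frobenius_algebra[OF l assms(2)] ac.span_base monoid_gen_superset)
  qed
qed

lemma separable_closure_add:
  assumes "x \<in> separable_closure" "y \<in> separable_closure"
  shows "x + y \<in> separable_closure"
proof -
  have "x + y \<in> ac.span (monoid_gen {x, y})"
    by (intro ac.span_add ac.span_base monoid_gen_superset) auto
  then show ?thesis
    using assms separable_algebra[of "{x, y}" "x + y"] by (auto simp: separable_closure_def)
qed

lemma separable_closure_mult:
  assumes "x \<in> separable_closure" "y \<in> separable_closure"
  shows "x * y \<in> separable_closure"
proof -
  have "x * y \<in> ac.span (monoid_gen {x, y})"
    by (intro span_monoid_gen_mult ac.span_base monoid_gen_superset) auto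
  then show ?thesis
    using assms separable_algebra[of "{x, y}" "x * y"] by (auto simp: separable_closure_def)
qed

lemma separable_closure_inverse:
  assumes "x \<in> separable_closure"
  shows "inverse x \<in> separable_closure"
  using assms inverse_in_subalgebra[of x separable_closure]
    separable_closure_add separable_closure_mult to_ac_in_separable_closure by blast

lemma separable_closure_uminus:
  fixes x :: "'f::field alg_closure"
  assumes "x \<in> separable_closure"
  shows "- x \<in> separable_closure"
  using separable_closure_mult[OF to_ac_in_separable_closure[of "-1"] assms] by simp

text \<open>
  In characteristic \<open>l\<close> not dividing \<open>n\<close>, say \<open>n * u = 1 + l * v\<close>, a root \<open>\<omega>\<close> of \<open>w\<close> is
  \<open>w ^ u\<close> divided by an \<open>l\<close>-th power.
\<close>

lemma separable_closure_root:
  fixes w :: "'f::field alg_closure"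
  assumes w: "w \<in> separable_closure" and n: "(of_nat n :: 'f) \<noteq> 0" and om: "\<omega> ^ n = w"
  shows "\<omega> \<in> separable_closure"
proof (cases "CHAR('f) = 0 \<or> \<omega> = 0")
  case True
  then show ?thesis
    using separable_char_0[of \<omega>] to_ac_in_separable_closure[of "0 :: 'f"]
    by (auto simp: separable_closure_def)
next
  case False
  define l where "l = CHAR('f)"
  define E where "E = ac.span (monoid_gen {\<omega>})"
  have l: "Factorial_Ring.prime l" using False CHAR_zero_or_prime by (auto simp: l_def)
  have "\<not> l dvd n" using n unfolding l_def by (subst (asm) of_nat_eq_0_iff_char_dvd)
  then have "coprime n l" using l by (metis coprime_commute prime_imp_coprime)
  then obtain u where "[n * u = Suc 0] (mod l)" using cong_solve_coprime_nat by blast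
  then have "n * u mod l = 1" using prime_gt_1_nat[OF l] by (simp add: cong_def)
  then have nu: "n * u = 1 + l * (n * u div l)" by (metis add.commute mult_div_mod_eq)
  define v where "v = n * u div l"
  have "\<omega> \<in> E" unfolding E_def by (intro ac.span_base monoid_gen_superset) simp
  then have "inverse \<omega> \<in> E"
    unfolding E_def by (rule inverse_in_subalgebra)
      (auto intro: ac.span_add span_monoid_gen_mult to_ac_in_span_monoid_gen)
  then have iv: "inverse \<omega> ^ v \<in> E" unfolding E_def by (rule power_in_span_monoid_gen)
  let ?S = "ac.span ((\<lambda>x. x ^ l) ` E)"
  have "w \<in> E" using \<open>\<omega> \<in> E\<close> unfolding om[symmetric] E_def by (rule power_in_span_monoid_gen)
  then have wS: "w \<in> ?S"
    using w l unfolding l_def E_def separable_closure_def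
    by (intro separable_in_span_Frobenius_algebra) auto
  have "w ^ i \<in> ?S" for i
  proof (induction i)
    case 0
    have "1 \<in> (\<lambda>x. x ^ l) ` E"
      using to_ac_in_span_monoid_gen[of 1 "{\<omega>}"] by (intro image_eqI[of _ _ 1]) (auto simp: E_def)
    then show ?case by (simp add: ac.span_base)
  next
    case (Suc i)
    then show ?case using wS unfolding E_def by (simp add: span_Frobenius_mult)
  qed
  moreover have "(inverse \<omega> ^ v) ^ l \<in> ?S" using iv by (intro ac.span_base) auto
  ultimately have "w ^ u * (inverse \<omega> ^ v) ^ l \<in> ?S"
    unfolding E_def by (rule span_Frobenius_mult)
  moreover have "w ^ u * (inverse \<omega> ^ v) ^ l = \<omega>"
  proof -
    have "w ^ u = \<omega> ^ (1 + l * v)" unfolding om[symmetric] v_def by (metis nu power_mult)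
    also have "\<dots> = \<omega> * (\<omega> ^ v) ^ l" by (metis power_add power_mult power_one_right mult.commute)
    finally show ?thesis using False by (simp add: power_inverse)
  qed
  ultimately have "\<omega> \<in> ?S" by simp
  then have "separable_over_base \<omega>"
    using l \<open>\<omega> \<in> E\<close> unfolding l_def E_def
    by (intro separable_if_spanned_by_Frobenius[where Y = "{\<omega>}"]) auto
  then show ?thesis by (simp add: separable_closure_def)
qed

text \<open>
  Here \<open>\<omega>\<close> is its own \<open>l\<close>-th power minus \<open>w\<close>, and \<open>w\<close>, being separable, is in the span of the
  \<open>l\<close>-th powers.
\<close>

lemma separable_closure_Artin_Schreier_root:
  fixes w :: "'f::field alg_closure"
  assumes w: "w \<in> separable_closure" and l: "Factorial_Ring.prime CHAR('f)"
    and om: "\<omega> ^ CHAR('f) - \<omega> = w"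
  shows "\<omega> \<in> separable_closure"
proof -
  define E where "E = ac.span (monoid_gen {\<omega>})"
  have E: "\<omega> \<in> E" unfolding E_def by (intro ac.span_base monoid_gen_superset) simp
  then have "w \<in> E"
    unfolding om[symmetric] E_def by (intro ac.span_diff power_in_span_monoid_gen)
  then have wS: "w \<in> ac.span ((\<lambda>x. x ^ CHAR('f)) ` E)"
    using w l unfolding E_def separable_closure_def
    by (intro separable_in_span_Frobenius_algebra) auto
  have "\<omega> ^ CHAR('f) - w \<in> ac.span ((\<lambda>x. x ^ CHAR('f)) ` E)"
    using wS E by (intro ac.span_diff[OF ac.span_base]) auto
  then have "\<omega> \<in> ac.span ((\<lambda>x. x ^ CHAR('f)) ` E)" by (simp flip: om)
  then have "separable_over_base \<omega>"
    using E l unfolding E_def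
    by (intro separable_if_spanned_by_Frobenius[where Y = "{\<omega>}"]) auto
  then show ?thesis by (simp add: separable_closure_def)
qed

section \<open>The relator and norms of characters\<close>

text \<open>
  The integer-valued \<open>x\<close> stands for a character of \<open>H\<close> modulo \<open>p\<close>, and the sum is its norm for the
  cyclic group of order \<open>p\<close> that \<open>\<sigma>\<close> generates modulo \<open>H\<close>.
\<close>

definition (in group) is_norm_mod :: "nat \<Rightarrow> 'a set \<Rightarrow> 'a \<Rightarrow> ('a \<Rightarrow> int) \<Rightarrow> bool" where
  "is_norm_mod p H \<sigma> x \<longleftrightarrow> (\<exists>\<psi> :: 'a \<Rightarrow> int.
     (\<forall>g \<in> H. \<forall>h \<in> H. [\<psi> (g \<otimes> h) = \<psi> g + \<psi> h] (mod p)) \<and>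
     (\<forall>h \<in> H. [(\<Sum>j<p. \<psi> (\<sigma> [^] j \<otimes> h \<otimes> inv (\<sigma> [^] j))) = x h] (mod p)))"

lemma (in group) conj_pow_shift:
  assumes "x \<in> carrier G" "y \<in> carrier G"
  shows "x [^] (j::nat) \<otimes> (x \<otimes> y \<otimes> inv x) \<otimes> inv (x [^] j) = x [^] Suc j \<otimes> y \<otimes> inv (x [^] Suc j)"
  using assms by (simp add: m_assoc inv_mult_group)

lemma (in group) commutator_closed:
  "x \<in> carrier G \<Longrightarrow> y \<in> carrier G \<Longrightarrow> commutator G x y \<in> carrier G"
  by (simp add: commutator_def)

lemma (in group) iterated_commutator_closed:
  "x \<in> carrier G \<Longrightarrow> y \<in> carrier G \<Longrightarrow> iterated_commutator G n x y \<in> carrier G"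
  by (induction n) (auto intro: commutator_closed)

lemma (in group) ordered_product_closed:
  "set xs \<subseteq> carrier G \<Longrightarrow> ordered_product G xs \<in> carrier G"
  by (induction xs) (auto simp: ordered_product_def)

lemma iterated_difference:
  fixes m :: "nat \<Rightarrow> nat \<Rightarrow> int"
  assumes "\<And>n j. [m (Suc n) j = m n (Suc j) - m n j] (mod p)"
  shows "[m n j = (\<Sum>i\<le>n. (-1) ^ (n - i) * int (n choose i) * m 0 (j + i))] (mod p)"
proof (induction n arbitrary: j)
  case (Suc n)
  define s where "s = (\<lambda>n j. \<Sum>i\<le>n. (-1) ^ (n - i) * int (n choose i) * m 0 (j + i))"
  have "s (Suc n) j = s n (Suc j) - s n j"
  proof -
    have a: "s n (Suc j) = (\<Sum>i\<in>{1..Suc n}. (-1) ^ (Suc n - i) * int (n choose (i - 1)) * m 0 (j + i))"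
      unfolding s_def by (rule sum.reindex_bij_witness[of _ "\<lambda>i. i - 1" Suc]) auto
    have b: "- s n j = (\<Sum>i\<le>Suc n. (-1) ^ (Suc n - i) * int (n choose i) * m 0 (j + i))"
      unfolding s_def by (simp add: sum_negf[symmetric] Suc_diff_le)
    have c: "{..Suc n} = insert 0 {1..Suc n}" by auto
    have "s n (Suc j) - s n j = (\<Sum>i\<le>Suc n. (-1) ^ (Suc n - i) * int (Suc n choose i) * m 0 (j + i))"
    proof -
      have "s n (Suc j) - s n j = s n (Suc j) + (- s n j)" by simp
      also have "\<dots> = (-1) ^ Suc n * int (n choose 0) * m 0 j +
         (\<Sum>i\<in>{1..Suc n}. (-1) ^ (Suc n - i) * int (n choose (i - 1)) * m 0 (j + i)
            + (-1) ^ (Suc n - i) * int (n choose i) * m 0 (j + i))"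
        unfolding a b c by (subst sum.insert) (auto simp: sum.distrib)
      also have "(\<Sum>i\<in>{1..Suc n}. (-1) ^ (Suc n - i) * int (n choose (i - 1)) * m 0 (j + i)
            + (-1) ^ (Suc n - i) * int (n choose i) * m 0 (j + i)) =
          (\<Sum>i\<in>{1..Suc n}. (-1) ^ (Suc n - i) * int (Suc n choose i) * m 0 (j + i))"
      proof (rule sum.cong[OF refl])
        fix i assume "i \<in> {1..Suc n}"
        then obtain k where "i = Suc k" by (cases i) auto
        then show "(-1) ^ (Suc n - i) * int (n choose (i - 1)) * m 0 (j + i)
            + (-1) ^ (Suc n - i) * int (n choose i) * m 0 (j + i)
            = (-1) ^ (Suc n - i) * int (Suc n choose i) * m 0 (j + i)"
          by (simp add: algebra_simps)
      qed
      finally show ?thesis unfolding c by (subst sum.insert) auto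
    qed
    then show ?thesis by (simp add: s_def)
  qed
  moreover have "[m n (Suc j) - m n j = s n (Suc j) - s n j] (mod p)"
    using Suc unfolding s_def by (intro cong_diff)
  ultimately have "[m (Suc n) j = s (Suc n) j] (mod p)"
    using assms[of n j] cong_trans by metis
  then show ?case by (simp add: s_def)
qed simp

lemma binomial_pred_prime_cong:
  assumes "Factorial_Ring.prime p" "i < p"
  shows "[int ((p - 1) choose i) = (-1) ^ i] (mod int p)"
  using assms(2)
proof (induction i)
  case (Suc i)
  have "int ((p - 1) choose Suc i) = int (p choose Suc i) - int ((p - 1) choose i)"
    using Suc.prems by (cases p) auto
  moreover have "int p dvd int (p choose Suc i)"
    using assms(1) Suc.prems by (simp add: dvd_choose_prime)
  then have "[int (p choose Suc i) = 0] (mod int p)" by (simp add: cong_0_iff)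
  then have "[int (p choose Suc i) - int ((p - 1) choose i) = 0 - (-1) ^ i] (mod int p)"
    using Suc by (intro cong_diff) auto
  ultimately have "[int ((p - 1) choose Suc i) = 0 - (-1) ^ i] (mod int p)" by simp
  then show ?case by simp
qed simp

text \<open>
  A homomorphism \<open>\<psi>\<close> modulo \<open>p\<close> on \<open>H\<close>, composed with conjugation by
  \<open>x [^] j\<close>, kills every factor of the relator except the iterated commutator, hence also that
  one. On \<open>iterated_commutator G n x y\<close> these values are the \<open>n\<close>-th differences of the sequence
  \<open>\<psi> (x [^] j \<otimes> y \<otimes> inv (x [^] j))\<close>; they vanish from \<open>n = f\<close> on, and modulo \<open>p\<close> the
  \<open>(p - 1)\<close>-st difference is the sum over a period.
\<close>

lemma (in group) norm_vanishes_by_relator: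
  fixes x2 :: "'a \<Rightarrow> int" and p q f :: nat
  assumes p: "Factorial_Ring.prime p" "odd p" and f: "f \<le> p - 1" and q: "p\<^sup>2 dvd q"
    and H: "H \<lhd> G" and x: "x \<in> carrier G" "x [^] p \<in> H" and y: "y \<in> H"
    and J: "\<And>i j. (i, j) \<in> set J \<Longrightarrow> s i \<in> H \<and> s j \<in> H" and K: "\<And>k. k \<in> set K \<Longrightarrow> s k \<in> H"
    and rel: "x [^] q \<otimes> iterated_commutator G f x y
              \<otimes> ordered_product G (map (\<lambda>(i, j). commutator G (s i) (s j)) J)
              \<otimes> ordered_product G (map (\<lambda>k. commutator G (x [^] p) (s k)) K) = \<one>"
    and norm: "is_norm_mod p H x x2"
  shows "[x2 y = 0] (mod p)"
proof -
  obtain \<psi> :: "'a \<Rightarrow> int" where \<psi>: "\<And>g h. g \<in> H \<Longrightarrow> h \<in> H \<Longrightarrow> [\<psi> (g \<otimes> h) = \<psi> g + \<psi> h] (mod p)"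
    and sum_\<psi>: "\<And>h. h \<in> H \<Longrightarrow> [(\<Sum>j<p. \<psi> (x [^] j \<otimes> h \<otimes> inv (x [^] j))) = x2 h] (mod p)"
    using norm unfolding is_norm_mod_def by auto
  interpret H: normal H G by (rule H)
  have Hc: "h \<in> carrier G" if "h \<in> H" for h using that H.subset by blast
  define m where "m = (\<lambda>j h. \<psi> (x [^] (j::nat) \<otimes> h \<otimes> inv (x [^] j)))"
  have conj: "g \<otimes> h \<otimes> inv g \<in> H" if "g \<in> carrier G" "h \<in> H" for g h
    using H.inv_op_closed2 that by simp
  have m_mult: "[m j (g \<otimes> h) = m j g + m j h] (mod p)" if "g \<in> H" "h \<in> H" for j g h
  proof -
    have "x [^] j \<otimes> (g \<otimes> h) \<otimes> inv (x [^] j)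
        = (x [^] j \<otimes> g \<otimes> inv (x [^] j)) \<otimes> (x [^] j \<otimes> h \<otimes> inv (x [^] j))"
      using x Hc that by (simp add: m_assoc inv_solve_left)
    then show ?thesis using \<psi> conj x that unfolding m_def by simp
  qed
  have m_one: "[m j \<one> = 0] (mod p)" for j
    using m_mult[of \<one> \<one> j] by (simp add: cong_iff_dvd_diff)
  have m_inv: "[m j (inv h) = - m j h] (mod p)" if "h \<in> H" for j h
  proof -
    have "[m j (h \<otimes> inv h) = m j h + m j (inv h)] (mod p)" using that by (intro m_mult) auto
    then have "[m j h + m j (inv h) = 0] (mod p)"
      using m_one[of j] that Hc by (metis r_inv cong_sym cong_trans)
    then show ?thesis by (simp add: cong_iff_dvd_diff add.commute)
  qed
  have m_comm: "[m j (commutator G g h) = 0] (mod p)" "commutator G g h \<in> H" if "g \<in> H" "h \<in> H" for j g h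
  proof -
    have "[m j (g \<otimes> h \<otimes> inv g \<otimes> inv h) = (m j g + m j h) + (- m j g) + (- m j h)] (mod p)"
      using that by (intro cong_trans[OF m_mult] cong_add m_inv m_mult) auto
    then show "[m j (commutator G g h) = 0] (mod p)" by (simp add: commutator_def)
    show "commutator G g h \<in> H" using that by (simp add: commutator_def)
  qed
  have m_prod: "ordered_product G ws \<in> H \<and> [m j (ordered_product G ws) = 0] (mod p)"
    if "\<And>w. w \<in> set ws \<Longrightarrow> w \<in> H \<and> [m j w = 0] (mod p)" for ws j
    using that
  proof (induction ws)
    case Nil
    then show ?case by (simp add: ordered_product_def m_one)
  next
    case (Cons w ws)
    then have "w \<in> H" "ordered_product G ws \<in> H" "[m j w = 0] (mod p)"
       "[m j (ordered_product G ws) = 0] (mod p)" by auto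
    moreover from this have "[m j (w \<otimes> ordered_product G ws) = 0 + 0] (mod p)"
      by (intro cong_trans[OF m_mult] cong_add)
    ultimately show ?case by (simp add: ordered_product_def)
  qed
  define c where "c = (\<lambda>n. iterated_commutator G n x y)"
  have c: "c n \<in> H" for n
  proof (induction n)
    case (Suc n)
    then show ?case using conj[OF x(1) Suc] by (simp add: c_def commutator_def)
  qed (use y in \<open>simp add: c_def\<close>)
  have step: "[m j (c (Suc n)) = m (Suc j) (c n) - m j (c n)] (mod p)" for n j
  proof -
    have "[m j (x \<otimes> c n \<otimes> inv x \<otimes> inv (c n)) = m j (x \<otimes> c n \<otimes> inv x) + - m j (c n)] (mod p)"
      using c conj x by (intro cong_trans[OF m_mult[of "x \<otimes> c n \<otimes> inv x" "inv (c n)" j]] cong_add m_inv) auto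
    moreover have "m j (x \<otimes> c n \<otimes> inv x) = m (Suc j) (c n)"
      unfolding m_def using conj_pow_shift[OF x(1) Hc[OF c[of n]], of j] by simp
    ultimately show ?thesis by (simp add: c_def commutator_def)
  qed
  have powH: "h [^] (n::nat) \<in> H" if "h \<in> H" for h n
    using that by (induction n) auto
  have m_pow: "[m j (h [^] (n::nat)) = int n * m j h] (mod p)" if "h \<in> H" for j h n
  proof (induction n)
    case 0
    then show ?case using m_one by simp
  next
    case (Suc n)
    have "[m j (h [^] n \<otimes> h) = int n * m j h + m j h] (mod p)"
      using Suc that powH by (intro cong_trans[OF m_mult] cong_add) auto
    then show ?case by (simp add: algebra_simps)
  qed
  have vanish: "[m j (c f) = 0] (mod p)" for j
  proof -
    \<comment> \<open>\<open>x [^] q\<close> is a power of \<open>x [^] p\<close>, which lies in \<open>H\<close>, and its exponent is still divisible by \<open>p\<close>.\<close>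
    obtain r where r: "q = p * (p * r)" using q by (metis dvdE power2_eq_square mult.assoc)
    have xq: "x [^] q = (x [^] p) [^] (p * r)" using x by (simp add: r nat_pow_pow)
    have xqH: "x [^] q \<in> H"
      unfolding xq by (rule powH[OF x(2)])
    have "[m j (x [^] q) = int (p * r) * m j (x [^] p)] (mod p)"
      unfolding xq by (rule m_pow[OF x(2)])
    also have "[int (p * r) * m j (x [^] p) = 0] (mod p)" by (simp add: cong_0_iff)
    finally have 1: "[m j (x [^] q) = 0] (mod p)" .
    define a where "a = ordered_product G (map (\<lambda>(i, j). commutator G (s i) (s j)) J)"
    define b where "b = ordered_product G (map (\<lambda>k. commutator G (x [^] p) (s k)) K)"
    have "a \<in> H \<and> [m j a = 0] (mod p)"
      unfolding a_def by (rule m_prod) (use J m_comm in auto)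
    then have a: "a \<in> H" "[m j a = 0] (mod p)" by auto
    have "b \<in> H \<and> [m j b = 0] (mod p)"
      unfolding b_def by (rule m_prod) (use K x(2) m_comm in auto)
    then have b: "b \<in> H" "[m j b = 0] (mod p)" by auto
    have "[m j (x [^] q \<otimes> c f \<otimes> a \<otimes> b) = ((m j (x [^] q) + m j (c f)) + m j a) + m j b] (mod p)"
      using xqH a(1) b(1) c by (intro cong_trans[OF m_mult] cong_add m_mult cong_refl) auto
    also have "[((m j (x [^] q) + m j (c f)) + m j a) + m j b = ((0 + m j (c f)) + 0) + 0] (mod p)"
      using 1 a b by (intro cong_add cong_refl)
    finally have "[m j (x [^] q \<otimes> c f \<otimes> a \<otimes> b) = m j (c f)] (mod p)" by simp
    then show ?thesis
      using rel m_one[of j] unfolding a_def b_def c_def by (metis cong_sym cong_trans)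
  qed
  have "[m j (c (f + k)) = 0] (mod p)" for k j
  proof (induction k arbitrary: j)
    case (Suc k)
    have "[m (Suc j) (c (f + k)) - m j (c (f + k)) = 0 - 0] (mod p)"
      using Suc by (intro cong_diff)
    then show ?case using step[of j "f + k"] cong_trans by fastforce
  qed (use vanish in simp)
  from this[of 0 "p - 1 - f"] have last: "[m 0 (c (p - 1)) = 0] (mod p)"
    using f by (simp only: le_add_diff_inverse)
  have "[m 0 (c (p - 1)) = (\<Sum>i\<le>p - 1. (-1) ^ (p - 1 - i) * int ((p - 1) choose i) * m (0 + i) (c 0))] (mod p)"
    by (rule iterated_difference[of "\<lambda>n j. m j (c n)"]) (rule step)
  also have "[(\<Sum>i\<le>p - 1. (-1) ^ (p - 1 - i) * int ((p - 1) choose i) * m (0 + i) (c 0)) =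
     (\<Sum>i\<le>p - 1. m i (c 0))] (mod p)"
  proof (rule cong_sum)
    fix i assume i: "i \<in> {..p - 1}"
    then have "i < p" using p(1) prime_gt_0_nat[of p] by auto
    have "[(-1) ^ (p - 1 - i) * int ((p - 1) choose i) * m (0 + i) (c 0)
       = (-1) ^ (p - 1 - i) * (-1) ^ i * m (0 + i) (c 0)] (mod p)"
      by (intro cong_mult cong_refl binomial_pred_prime_cong p \<open>i < p\<close>)
    moreover have "(-1) ^ (p - 1 - i) * (-1) ^ i = (1 :: int)"
    proof -
      have "p - 1 - i + i = p - 1" using i by auto
      then have "(-1) ^ (p - 1 - i) * (-1) ^ i = (-1 :: int) ^ (p - 1)" by (metis power_add)
      also have "\<dots> = 1" using p(2) by simp
      finally show ?thesis .
    qed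
    ultimately show "[(-1) ^ (p - 1 - i) * int ((p - 1) choose i) * m (0 + i) (c 0) = m i (c 0)] (mod p)"
      by simp
  qed
  also have "{..p - 1} = {..<p}" using p(1) prime_gt_0_nat[of p] by auto
  finally have "[(\<Sum>i<p. m i (c 0)) = 0] (mod p)" using last by (metis cong_sym cong_trans)
  then have "[(\<Sum>j<p. \<psi> (x [^] j \<otimes> y \<otimes> inv (x [^] j))) = 0] (mod p)" by (simp add: m_def c_def)
  then show ?thesis by (rule cong_trans[OF cong_sym[OF sum_\<psi>[OF y]]])
qed

section \<open>Independence of characters for a group acting on a field\<close>

text \<open>
  Dedekind's argument. The relation for \<open>y * x\<close> minus \<open>\<theta> k y\<close> times the relation for \<open>x\<close> no longer
  involves \<open>\<theta> k\<close>, and \<open>y\<close> can be chosen such that a given other coefficient is only multiplied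
  by a non-zero number.
\<close>

lemma independence_of_characters:
  fixes \<theta> :: "'i \<Rightarrow> 'k::field \<Rightarrow> 'k" and M :: "'k set"
  assumes "finite S" and M: "1 \<in> M" "\<And>x y. x \<in> M \<Longrightarrow> y \<in> M \<Longrightarrow> x * y \<in> M"
    and mult: "\<And>i x y. i \<in> S \<Longrightarrow> x \<in> M \<Longrightarrow> y \<in> M \<Longrightarrow> \<theta> i (x * y) = \<theta> i x * \<theta> i y"
    and one: "\<And>i. i \<in> S \<Longrightarrow> \<theta> i 1 = 1"
    and distinct: "\<And>i j. i \<in> S \<Longrightarrow> j \<in> S \<Longrightarrow> i \<noteq> j \<Longrightarrow> \<exists>x \<in> M. \<theta> i x \<noteq> \<theta> j x"
    and zero: "\<And>x. x \<in> M \<Longrightarrow> (\<Sum>i\<in>S. a i * \<theta> i x) = 0"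
    and "i \<in> S"
  shows "a i = 0"
  using assms(1) mult one distinct zero \<open>i \<in> S\<close>
proof (induction S arbitrary: a i)
  case (insert k S)
  have S: "a i = 0" if i: "i \<in> S" for i
  proof -
    have "i \<noteq> k" using i insert.hyps by auto
    then obtain y where y: "y \<in> M" "\<theta> i y \<noteq> \<theta> k y"
      using insert.prems(3)[of i k] i by auto
    have "a i * (\<theta> i y - \<theta> k y) = 0"
    proof (rule insert.IH[of "\<lambda>i. a i * (\<theta> i y - \<theta> k y)" i])
      fix x assume x: "x \<in> M"
      have "(\<Sum>i\<in>insert k S. a i * \<theta> i (y * x)) = 0" "(\<Sum>i\<in>insert k S. a i * \<theta> i x) = 0"
        using insert.prems(4) M(2) x y(1) by auto
      then have eq: "a k * \<theta> k (y * x) + (\<Sum>i\<in>S. a i * \<theta> i (y * x)) = 0"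
        "a k * \<theta> k x + (\<Sum>i\<in>S. a i * \<theta> i x) = 0"
        using insert.hyps by auto
      have "(\<Sum>i\<in>S. a i * (\<theta> i y - \<theta> k y) * \<theta> i x)
          = (\<Sum>i\<in>S. a i * \<theta> i (y * x)) - \<theta> k y * (\<Sum>i\<in>S. a i * \<theta> i x)"
        unfolding sum_distrib_left sum_subtractf[symmetric]
        by (intro sum.cong) (use insert.prems(1) x y(1) in \<open>auto simp: algebra_simps\<close>)
      also have "\<dots> = - (a k * \<theta> k (y * x)) + \<theta> k y * (a k * \<theta> k x)"
        using eq by (simp add: add_eq_0_iff algebra_simps)
      also have "\<dots> = 0"
        using insert.prems(1)[of k y x] x y(1) by simp
      finally show "(\<Sum>i\<in>S. a i * (\<theta> i y - \<theta> k y) * \<theta> i x) = 0" .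
    qed (use insert.prems i in auto)
    then show ?thesis using y by simp
  qed
  have "(\<Sum>i\<in>insert k S. a i * \<theta> i 1) = 0" using insert.prems(4) M(1) by blast
  then have "a k = 0" using S insert.hyps insert.prems(2)[of k] by simp
  then show ?case using S insert.prems(5) by auto
qed simp

text \<open>
  The field is a subset of a field type, so that it can be a separable closure inside an algebraic
  closure; outside of this subset the action is arbitrary.
\<close>

locale field_action = group G for G (structure) +
  fixes act :: "'a \<Rightarrow> 'k::field \<Rightarrow> 'k" and \<Omega> :: "'k set"
  assumes add_in: "x \<in> \<Omega> \<Longrightarrow> y \<in> \<Omega> \<Longrightarrow> x + y \<in> \<Omega>"
    and mult_in: "x \<in> \<Omega> \<Longrightarrow> y \<in> \<Omega> \<Longrightarrow> x * y \<in> \<Omega>"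
    and uminus_in: "x \<in> \<Omega> \<Longrightarrow> - x \<in> \<Omega>"
    and inverse_in: "x \<in> \<Omega> \<Longrightarrow> inverse x \<in> \<Omega>"
    and one_in: "1 \<in> \<Omega>"
    and act_in: "g \<in> carrier G \<Longrightarrow> x \<in> \<Omega> \<Longrightarrow> act g x \<in> \<Omega>"
    and act_add: "g \<in> carrier G \<Longrightarrow> x \<in> \<Omega> \<Longrightarrow> y \<in> \<Omega> \<Longrightarrow> act g (x + y) = act g x + act g y"
    and act_mult: "g \<in> carrier G \<Longrightarrow> x \<in> \<Omega> \<Longrightarrow> y \<in> \<Omega> \<Longrightarrow> act g (x * y) = act g x * act g y"
    and act_act: "g \<in> carrier G \<Longrightarrow> h \<in> carrier G \<Longrightarrow> x \<in> \<Omega> \<Longrightarrow> act (g \<otimes> h) x = act g (act h x)"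
    and act_id: "x \<in> \<Omega> \<Longrightarrow> act \<one> x = x"
    and finite_orbit: "x \<in> \<Omega> \<Longrightarrow> finite {act g x | g. g \<in> carrier G}"
begin

lemma zero_in: "0 \<in> \<Omega>"
  using add_in[OF one_in uminus_in[OF one_in]] by simp

lemma diff_in: "x \<in> \<Omega> \<Longrightarrow> y \<in> \<Omega> \<Longrightarrow> x - y \<in> \<Omega>"
  using add_in[of x "- y"] uminus_in by simp

lemma divide_in: "x \<in> \<Omega> \<Longrightarrow> y \<in> \<Omega> \<Longrightarrow> x / y \<in> \<Omega>"
  using mult_in[of x "inverse y"] inverse_in by (simp add: field_simps)

lemma power_in: "x \<in> \<Omega> \<Longrightarrow> x ^ n \<in> \<Omega>"
  by (induction n) (auto intro: one_in mult_in)

lemma sum_in: "(\<And>i. i \<in> S \<Longrightarrow> F i \<in> \<Omega>) \<Longrightarrow> sum F S \<in> \<Omega>"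
  by (induction S rule: infinite_finite_induct) (auto intro: zero_in add_in)

lemma prod_in: "(\<And>i. i \<in> S \<Longrightarrow> F i \<in> \<Omega>) \<Longrightarrow> prod F S \<in> \<Omega>"
  by (induction S rule: infinite_finite_induct) (auto intro: one_in mult_in)

lemma of_nat_in: "of_nat n \<in> \<Omega>"
  by (induction n) (auto intro: zero_in one_in add_in)

lemma of_int_in: "of_int n \<in> \<Omega>"
  by (cases n) (auto intro: of_nat_in uminus_in simp del: of_nat_Suc)

lemma power_int_in: "x \<in> \<Omega> \<Longrightarrow> x powi n \<in> \<Omega>"
  by (auto simp: power_int_def intro: power_in inverse_in)

lemma act_inv:
  "g \<in> carrier G \<Longrightarrow> x \<in> \<Omega> \<Longrightarrow> act g (act (inv g) x) = x"
  "g \<in> carrier G \<Longrightarrow> x \<in> \<Omega> \<Longrightarrow> act (inv g) (act g x) = x"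
  using act_act[of g "inv g" x] act_act[of "inv g" g x] act_id by simp_all

lemma act_zero:
  assumes "g \<in> carrier G"
  shows "act g 0 = 0"
proof -
  have "act g 0 + act g 0 = act g 0 + 0"
    using act_add[OF assms zero_in zero_in] by simp
  then show ?thesis by (rule add_left_imp_eq)
qed

lemma act_eq_zero: "g \<in> carrier G \<Longrightarrow> x \<in> \<Omega> \<Longrightarrow> act g x = 0 \<longleftrightarrow> x = 0"
  using act_inv(2)[of g x] act_zero by (metis inv_closed)

lemma act_one: "g \<in> carrier G \<Longrightarrow> act g 1 = 1"
  using act_mult[of g 1 1] one_in act_eq_zero[of g 1] by simp

lemma act_uminus: "g \<in> carrier G \<Longrightarrow> x \<in> \<Omega> \<Longrightarrow> act g (- x) = - act g x"
  using act_add[of g x "- x"] uminus_in act_zero by (simp add: add_eq_0_iff)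

lemma act_diff: "g \<in> carrier G \<Longrightarrow> x \<in> \<Omega> \<Longrightarrow> y \<in> \<Omega> \<Longrightarrow> act g (x - y) = act g x - act g y"
  using act_add[of g x "- y"] uminus_in act_uminus by simp

lemma act_inverse:
  assumes "g \<in> carrier G" "x \<in> \<Omega>"
  shows "act g (inverse x) = inverse (act g x)"
proof (cases "x = 0")
  case False
  then have "act g x * act g (inverse x) = 1"
    using act_mult[of g x "inverse x"] inverse_in assms act_one by simp
  then show ?thesis by (metis inverse_unique)
qed (use assms act_zero in simp)

lemma act_divide:
  "g \<in> carrier G \<Longrightarrow> x \<in> \<Omega> \<Longrightarrow> y \<in> \<Omega> \<Longrightarrow> act g (x / y) = act g x / act g y"
  using act_mult[of g x "inverse y"] inverse_in act_inverse by (simp add: divide_inverse)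

lemma act_power: "g \<in> carrier G \<Longrightarrow> x \<in> \<Omega> \<Longrightarrow> act g (x ^ n) = act g x ^ n"
  by (induction n) (auto simp: act_one act_mult power_in)

lemma act_power_int: "g \<in> carrier G \<Longrightarrow> x \<in> \<Omega> \<Longrightarrow> act g (x powi n) = act g x powi n"
  by (simp add: power_int_def act_power act_inverse inverse_in power_in)

lemma act_sum:
  "g \<in> carrier G \<Longrightarrow> (\<And>i. i \<in> S \<Longrightarrow> F i \<in> \<Omega>) \<Longrightarrow> act g (sum F S) = (\<Sum>i\<in>S. act g (F i))"
  by (induction S rule: infinite_finite_induct) (auto simp: act_zero act_add sum_in)

lemma act_prod:
  "g \<in> carrier G \<Longrightarrow> (\<And>i. i \<in> S \<Longrightarrow> F i \<in> \<Omega>) \<Longrightarrow> act g (prod F S) = (\<Prod>i\<in>S. act g (F i))"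
  by (induction S rule: infinite_finite_induct) (auto simp: act_one act_mult prod_in)

lemma act_of_nat: "g \<in> carrier G \<Longrightarrow> act g (of_nat n) = of_nat n"
  by (induction n) (auto simp: act_zero act_one act_add one_in of_nat_in)

lemma act_of_int: "g \<in> carrier G \<Longrightarrow> act g (of_int n) = of_int n"
  by (cases n) (auto simp: act_of_nat act_uminus of_nat_in simp del: of_nat_Suc)

lemma act_pow_fixed:
  assumes "g \<in> carrier G" "x \<in> \<Omega>" "act g x = x"
  shows "act (g [^] (n::nat)) x = x"
  by (induction n) (use assms in \<open>auto simp: act_id act_act\<close>)

text \<open>
  Restrictions to a finite set \<open>B\<close> take the place of the finite quotients of a Galois group: there
  are only finitely many of them, and they determine the action on \<open>monoid_gen B\<close>.
\<close>

definition agree :: "'k set \<Rightarrow> 'a \<Rightarrow> 'a \<Rightarrow> bool" where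
  "agree B g h \<longleftrightarrow> (\<forall>b \<in> B. act g b = act h b)"

lemma agree_monoid_gen:
  assumes "B \<subseteq> \<Omega>" "g \<in> carrier G" "h \<in> carrier G" "agree B g h" "c \<in> monoid_gen B"
  shows "act g c = act h c"
proof -
  have "c \<in> \<Omega> \<and> act g c = act h c"
    using assms(5)
  proof (induction rule: monoid_gen_induct)
    case (step x m)
    then have "x \<in> \<Omega>" "act g x = act h x" using assms by (auto simp: agree_def)
    then show ?case using step assms(2,3) by (simp add: mult_in act_mult)
  qed (use assms one_in act_one in simp)
  then show ?thesis ..
qed

lemma monoid_gen_subset: "B \<subseteq> \<Omega> \<Longrightarrow> monoid_gen B \<subseteq> \<Omega>"
proof
  fix c assume "B \<subseteq> \<Omega>" "c \<in> monoid_gen B"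
  from this(2,1) show "c \<in> \<Omega>"
    by (induction rule: monoid_gen_induct) (auto intro: one_in mult_in)
qed

lemma transversal_exists:
  assumes "finite B" "B \<subseteq> \<Omega>" "H \<subseteq> carrier G"
  obtains R where "finite R" "R \<subseteq> H" "\<And>h. h \<in> H \<Longrightarrow> \<exists>r \<in> R. agree B h r"
    "\<And>r s. r \<in> R \<Longrightarrow> s \<in> R \<Longrightarrow> agree B r s \<Longrightarrow> r = s"
proof -
  define \<rho> where "\<rho> = (\<lambda>h. restrict (act h) B)"
  have "\<rho> ` H \<subseteq> (\<Pi>\<^sub>E b\<in>B. {act g b | g. g \<in> carrier G})"
    using assms(3) by (auto simp: \<rho>_def)
  then have fin: "finite (\<rho> ` H)"
    by (rule finite_subset) (use assms finite_orbit in \<open>auto intro!: finite_PiE\<close>)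
  have agree: "agree B g h \<longleftrightarrow> \<rho> g = \<rho> h" for g h
    unfolding agree_def \<rho>_def by (metis restrict_apply' restrict_ext)
  define R where "R = inv_into H \<rho> ` (\<rho> ` H)"
  show ?thesis
  proof
    show "finite R" using fin by (simp add: R_def)
    show "R \<subseteq> H" by (auto simp: R_def intro: inv_into_into)
    show "\<exists>r \<in> R. agree B h r" if "h \<in> H" for h
      using that unfolding agree R_def by (intro bexI[of _ "inv_into H \<rho> (\<rho> h)"]) (auto simp: f_inv_into_f)
    show "r = s" if "r \<in> R" "s \<in> R" "agree B r s" for r s
      using that unfolding agree R_def by (auto simp: f_inv_into_f)
  qed
qed

text \<open>Left multiplication by \<open>h\<close> permutes the classes that the transversal represents.\<close>

lemma sum_transversal_translate:
  assumes H: "subgroup H G" and R: "finite R" "R \<subseteq> H" "\<And>h. h \<in> H \<Longrightarrow> \<exists>r \<in> R. agree B h r"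
    "\<And>r s. r \<in> R \<Longrightarrow> s \<in> R \<Longrightarrow> agree B r s \<Longrightarrow> r = s"
    and B: "B \<subseteq> \<Omega>"
    and F: "\<And>g g'. g \<in> H \<Longrightarrow> g' \<in> H \<Longrightarrow> agree B g g' \<Longrightarrow> F g = F g'" and h: "h \<in> H"
  shows "(\<Sum>r\<in>R. F (h \<otimes> r)) = (\<Sum>r\<in>R. F r)"
proof -
  interpret H: subgroup H G by (rule H)
  define rep where "rep = (\<lambda>g. SOME r. r \<in> R \<and> agree B g r)"
  have rep: "rep g \<in> R" "agree B g (rep g)" if "g \<in> H" for g
    using someI_ex[of "\<lambda>r. r \<in> R \<and> agree B g r"] R(3)[OF that] unfolding rep_def by auto
  have trans: "agree B (k \<otimes> g) (k \<otimes> g')" if "agree B g g'" "k \<in> H" "g \<in> H" "g' \<in> H" for k g g'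
    using that B unfolding agree_def by (auto simp: act_act subset_iff)
  have inverse: "rep (k' \<otimes> rep (k \<otimes> r)) = r" if "r \<in> R" "k \<in> H" "k' \<in> H" "k' \<otimes> k = \<one>" for r k k'
  proof -
    have r: "r \<in> H" using that(1) R(2) by (rule subsetD[rotated])
    have kr: "k \<otimes> r \<in> H" by (rule H.m_closed[OF that(2) r])
    have repH: "rep (k \<otimes> r) \<in> H" using rep(1)[OF kr] R(2) by (rule subsetD[rotated])
    have kkr: "k' \<otimes> rep (k \<otimes> r) \<in> H" by (rule H.m_closed[OF that(3) repH])
    have "agree B (k' \<otimes> (k \<otimes> r)) (k' \<otimes> rep (k \<otimes> r))"
      by (rule trans[OF rep(2)[OF kr] that(3) kr repH])
    moreover have "k' \<otimes> (k \<otimes> r) = r"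
      using that r m_assoc[of k' k r] by simp
    ultimately have "agree B r (rep (k' \<otimes> rep (k \<otimes> r)))"
      using rep(2)[OF kkr] by (simp add: agree_def)
    from R(4)[OF that(1) rep(1)[OF kkr] this] show ?thesis by (rule sym)
  qed
  show ?thesis
  proof (rule sum.reindex_bij_witness[of _ "\<lambda>r. rep (inv h \<otimes> r)" "\<lambda>r. rep (h \<otimes> r)"])
    fix r assume r: "r \<in> R"
    then have rH: "r \<in> H" using R(2) by auto
    have ih: "inv h \<in> H" using h by simp
    show "rep (inv h \<otimes> rep (h \<otimes> r)) = r" using inverse[OF r h ih] h by simp
    show "rep (h \<otimes> rep (inv h \<otimes> r)) = r" using inverse[OF r ih h] h by simp
    have hr: "h \<otimes> r \<in> H" "inv h \<otimes> r \<in> H" using rH h ih by simp_all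
    show "rep (h \<otimes> r) \<in> R" "rep (inv h \<otimes> r) \<in> R" using rep(1) hr by simp_all
    then have "rep (h \<otimes> r) \<in> H" using R(2) by auto
    then show "F (rep (h \<otimes> r)) = F (h \<otimes> r)" using F[OF hr(1) _ rep(2)[OF hr(1)]] by simp
  qed
qed

lemma nonzero_sum_over_transversal:
  assumes R: "finite R" "R \<subseteq> carrier G" "R \<noteq> {}"
    "\<And>r s. r \<in> R \<Longrightarrow> s \<in> R \<Longrightarrow> agree B r s \<Longrightarrow> r = s" and B: "B \<subseteq> \<Omega>"
    and a: "\<And>r. r \<in> R \<Longrightarrow> a r \<noteq> 0"
  obtains c where "c \<in> monoid_gen B" "(\<Sum>r\<in>R. a r * act r c) \<noteq> 0"
proof (rule ccontr)
  assume none: "\<not> thesis"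
  note obt = that
  have zero: "(\<Sum>r\<in>R. a r * act r c) = 0" if "c \<in> monoid_gen B" for c
    using none obt[OF that] by auto
  obtain r where r: "r \<in> R" using R(3) by auto
  have sub: "monoid_gen B \<subseteq> \<Omega>" using B by (rule monoid_gen_subset)
  have "a r = 0"
  proof (rule independence_of_characters[where S = R and M = "monoid_gen B" and \<theta> = act])
    show "\<exists>x\<in>monoid_gen B. act i x \<noteq> act j x" if "i \<in> R" "j \<in> R" "i \<noteq> j" for i j
      using R(4) that unfolding agree_def by (metis monoid_gen_superset)
  qed (use R r zero sub in \<open>auto intro: monoid_gen_1 monoid_gen_mult act_mult act_one\<close>)
  then show False using a r by blast
qed

end

section \<open>Additive maps modulo \<open>p\<close> and roots of unity\<close>

lemma (in group) additive_mod_one: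
  fixes x :: "'a \<Rightarrow> int"
  assumes "\<And>g h. g \<in> carrier G \<Longrightarrow> h \<in> carrier G \<Longrightarrow> [x (g \<otimes> h) = x g + x h] (mod p)"
  shows "[x \<one> = 0] (mod p)"
  using assms[of \<one> \<one>] by (simp add: cong_iff_dvd_diff)

lemma (in group) additive_mod_inv:
  fixes x :: "'a \<Rightarrow> int"
  assumes add: "\<And>g h. g \<in> carrier G \<Longrightarrow> h \<in> carrier G \<Longrightarrow> [x (g \<otimes> h) = x g + x h] (mod p)"
    and g: "g \<in> carrier G"
  shows "[x (inv g) = - x g] (mod p)"
proof -
  have "[x g + x (inv g) = 0] (mod p)"
    using add[of g "inv g"] additive_mod_one[of x, OF add] g by (metis cong_sym cong_trans inv_closed r_inv)
  then show ?thesis by (simp add: cong_iff_dvd_diff add.commute)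
qed

lemma (in group) additive_mod_pow:
  fixes x :: "'a \<Rightarrow> int"
  assumes add: "\<And>g h. g \<in> carrier G \<Longrightarrow> h \<in> carrier G \<Longrightarrow> [x (g \<otimes> h) = x g + x h] (mod p)"
    and g: "g \<in> carrier G"
  shows "[x (g [^] (n::nat)) = int n * x g] (mod p)"
proof (induction n)
  case 0
  then show ?case using additive_mod_one[of x, OF add] by simp
next
  case (Suc n)
  have "[x (g [^] n \<otimes> g) = int n * x g + x g] (mod p)"
    using Suc g by (intro cong_trans[OF add] cong_add) auto
  then show ?case by (simp add: algebra_simps)
qed

lemma (in group) kernel_mod_normal:
  fixes x :: "'a \<Rightarrow> int"
  assumes add: "\<And>g h. g \<in> carrier G \<Longrightarrow> h \<in> carrier G \<Longrightarrow> [x (g \<otimes> h) = x g + x h] (mod p)"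
  shows "{g \<in> carrier G. [x g = 0] (mod p)} \<lhd> G"
proof -
  note inverse = additive_mod_inv[of x, OF add]
  have mult: "[x (g \<otimes> h) = a + b] (mod p)"
    if "g \<in> carrier G" "h \<in> carrier G" "[x g = a] (mod p)" "[x h = b] (mod p)" for g h a b
    using cong_trans[OF add cong_add] that by blast
  let ?H = "{g \<in> carrier G. [x g = 0] (mod p)}"
  have "subgroup ?H G"
  proof (rule subgroupI)
    show "?H \<noteq> {}" using additive_mod_one[of x, OF add] by auto
    fix a b assume "a \<in> ?H" "b \<in> ?H"
    then show "a \<otimes> b \<in> ?H" using mult[of a b 0 0] by simp
  next
    fix a assume a: "a \<in> ?H"
    then have "[- x a = - 0] (mod p)" by (simp add: cong_iff_dvd_diff)
    then show "inv a \<in> ?H" using inverse[of a] a by (auto intro: cong_trans)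
  qed auto
  moreover have "g \<otimes> h \<otimes> inv g \<in> ?H" if "g \<in> carrier G" "h \<in> ?H" for g h
  proof -
    have "[x (g \<otimes> h) = x g + 0] (mod p)" using that by (intro mult) auto
    then have "[x (g \<otimes> h \<otimes> inv g) = (x g + 0) + - x g] (mod p)"
      using that inverse[of g] by (intro mult) auto
    then show ?thesis using that by simp
  qed
  ultimately show ?thesis by (simp add: normal_inv_iff)
qed

lemma power_int_eq_iff_cong:
  fixes \<zeta> :: "'k::field"
  assumes p: "Factorial_Ring.prime p" and z: "\<zeta> ^ p = 1" "\<zeta> \<noteq> 1"
  shows "\<zeta> powi x = \<zeta> powi y \<longleftrightarrow> [x = y] (mod int p)"
proof -
  have "\<zeta> \<noteq> 0" using z(1) prime_gt_0_nat[OF p] by (auto simp: power_0_left)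
  have mult: "\<zeta> powi (int p * k) = 1" for k
    by (simp add: power_int_mult z)
  have "\<zeta> powi d = 1 \<longleftrightarrow> int p dvd d" for d
  proof
    assume d: "\<zeta> powi d = 1"
    show "int p dvd d"
    proof (rule ccontr)
      assume "\<not> int p dvd d"
      then have "coprime (int p) d" using p by (simp add: prime_imp_coprime)
      then obtain u v where uv: "u * int p + v * d = 1"
        using bezout_int[of "int p" d] by (auto simp: coprime_iff_gcd_eq_1)
      have "\<zeta> = \<zeta> powi (int p * u + d * v)" using uv by (simp add: mult.commute)
      also have "\<dots> = 1" using \<open>\<zeta> \<noteq> 0\<close> mult d by (simp add: power_int_add power_int_mult[of \<zeta> d])
      finally show False using z by simp
    qed
  qed (use mult in auto)
  then have "\<zeta> powi (x - y) = 1 \<longleftrightarrow> [x = y] (mod int p)" by (simp add: cong_iff_dvd_diff)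
  moreover have "\<zeta> powi (x - y) = \<zeta> powi x / \<zeta> powi y" "\<zeta> powi y \<noteq> 0"
    using \<open>\<zeta> \<noteq> 0\<close> by (simp_all add: power_int_diff)
  ultimately show ?thesis by simp
qed

lemma root_of_unity_power_int:
  fixes \<zeta> :: "'k::field"
  assumes p: "Factorial_Ring.prime p" and z: "\<zeta> ^ p = 1" "\<zeta> \<noteq> 1" and x: "x ^ p = 1"
  shows "\<exists>k. x = \<zeta> powi k"
proof -
  define P :: "'k poly" where "P = Polynomial.monom 1 p - 1"
  have ev: "poly P y = y ^ p - 1" for y by (simp add: P_def poly_monom)
  have "p > 0" using p by (rule prime_gt_0_nat)
  have "P \<noteq> 0" using ev[of 0] \<open>p > 0\<close> by (auto simp: power_0_left)
  have "Polynomial.degree P \<le> p"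
    unfolding P_def by (intro degree_diff_le) (auto simp: degree_monom_le)
  then have card: "card {y. poly P y = 0} \<le> p"
    using card_poly_roots_bound[OF \<open>P \<noteq> 0\<close>] by simp
  let ?S = "(\<lambda>k. \<zeta> powi int k) ` {..<p}"
  have "inj_on (\<lambda>k. \<zeta> powi int k) {..<p}"
    using power_int_eq_iff_cong[OF p z]
    by (intro inj_onI) (auto simp: cong_int_iff cong_def simp del: power_int_of_nat)
  then have "card ?S = p" by (simp add: card_image del: power_int_of_nat)
  moreover have "?S \<subseteq> {y. poly P y = 0}"
    using z by (auto simp: ev power_mult[symmetric] mult.commute[of _ p]) (simp add: power_mult)
  ultimately have "?S = {y. poly P y = 0}"
    using card poly_roots_finite[OF \<open>P \<noteq> 0\<close>] by (intro card_seteq) (simp_all del: power_int_of_nat)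
  moreover have "x \<in> {y. poly P y = 0}" using x by (simp add: ev)
  ultimately show ?thesis by (auto simp del: power_int_of_nat)
qed

lemma of_nat_power_CHAR:
  assumes p: "Factorial_Ring.prime p" and c: "CHAR('k::field) = p"
  shows "(of_nat k :: 'k) ^ p = of_nat k"
proof (induction k)
  case 0
  then show ?case using prime_gt_0_nat[OF p] by (simp add: power_0_left)
next
  case (Suc k)
  have "(1 + of_nat k :: 'k) ^ p = 1 ^ p + of_nat k ^ p"
    using freshmans_dream[where ?'a = 'k] p c by blast
  then show ?case using Suc by simp
qed

lemma of_int_power_CHAR:
  assumes p: "Factorial_Ring.prime p" and c: "CHAR('k::field) = p"
  shows "(of_int k :: 'k) ^ p = of_int k"
proof -
  have "[int (nat (k mod int p)) = k] (mod int p)"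
    using prime_gt_0_nat[OF p] by (simp add: cong_def)
  then have "(of_int (int (nat (k mod int p))) :: 'k) = of_int k"
    by (simp only: of_int_eq_iff_cong_CHAR c)
  then show ?thesis using of_nat_power_CHAR[OF p c, of "nat (k mod int p)"] by (simp only: of_int_of_nat_eq)
qed

lemma prime_field_element:
  fixes x :: "'k::field"
  assumes p: "Factorial_Ring.prime p" and c: "CHAR('k) = p" and x: "x ^ p = x"
  shows "\<exists>k. x = of_int k"
proof -
  define P :: "'k poly" where "P = Polynomial.monom 1 p - [:0, 1:]"
  have ev: "poly P y = y ^ p - y" for y by (simp add: P_def poly_monom)
  have "p > 1" using p by (rule prime_gt_1_nat)
  have "Polynomial.coeff P p = 1" using \<open>p > 1\<close> by (simp add: P_def coeff_pCons split: nat.split)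
  then have "P \<noteq> 0" by auto
  have "Polynomial.degree P \<le> p"
    unfolding P_def using \<open>p > 1\<close> by (intro degree_diff_le) (auto simp: degree_monom_le)
  then have card: "card {y. poly P y = 0} \<le> p"
    using card_poly_roots_bound[OF \<open>P \<noteq> 0\<close>] by simp
  let ?S = "(\<lambda>k. of_nat k :: 'k) ` {..<p}"
  have "inj_on (\<lambda>k. of_nat k :: 'k) {..<p}"
    by (intro inj_onI) (auto simp: of_nat_eq_iff_cong_CHAR c cong_def)
  then have "card ?S = p" by (simp add: card_image)
  moreover have "?S \<subseteq> {y. poly P y = 0}"
    using of_nat_power_CHAR[OF p c] by (auto simp: ev)
  ultimately have "?S = {y. poly P y = 0}"
    using card poly_roots_finite[OF \<open>P \<noteq> 0\<close>] by (intro card_seteq) (simp_all del: power_int_of_nat)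
  moreover have "x \<in> {y. poly P y = 0}" using x by (simp add: ev)
  ultimately obtain k where "x = of_nat k" by blast
  then have "x = of_int (int k)" by simp
  then show ?thesis ..
qed

section \<open>Hilbert 90\<close>

context field_action
begin

lemma trivial_on_fixer:
  assumes H: "subgroup H G" and B: "B \<subseteq> \<Omega>"
    and triv: "\<And>h. h \<in> H \<Longrightarrow> (\<And>b. b \<in> B \<Longrightarrow> act h b = b) \<Longrightarrow> P h"
    and gh: "g \<in> H" "h \<in> H" "agree B g h"
  shows "P (inv g \<otimes> h)"
proof (rule triv)
  interpret H: subgroup H G by (rule H)
  show "inv g \<otimes> h \<in> H" using gh by simp
  fix b assume b: "b \<in> B"
  then have "act (inv g \<otimes> h) b = act (inv g) (act g b)"
    using gh B by (auto simp: agree_def act_act)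
  then show "act (inv g \<otimes> h) b = b" using gh B b act_inv(2)[of g b] by auto
qed

text \<open>
  The generator is a Lagrange resolvent \<open>\<Sum>r\<in>R. act r c / f r\<close>, where \<open>R\<close> represents the restrictions
  of \<open>H\<close> to \<open>B\<close>. It is well defined because \<open>f\<close> is trivial on the fixer of \<open>B\<close>, and some \<open>c\<close> makes it
  non-zero.
\<close>

lemma Hilbert90_multiplicative:
  assumes H: "subgroup H G" and B: "finite B" "B \<subseteq> \<Omega>"
    and f: "\<And>h. h \<in> H \<Longrightarrow> f h \<in> \<Omega> \<and> f h \<noteq> 0" and fixed: "\<And>g h. g \<in> H \<Longrightarrow> h \<in> H \<Longrightarrow> act g (f h) = f h"
    and mult: "\<And>g h. g \<in> H \<Longrightarrow> h \<in> H \<Longrightarrow> f (g \<otimes> h) = f g * f h"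
    and triv: "\<And>h. h \<in> H \<Longrightarrow> (\<And>b. b \<in> B \<Longrightarrow> act h b = b) \<Longrightarrow> f h = 1"
  obtains \<eta> where "\<eta> \<in> \<Omega>" "\<eta> \<noteq> 0" "\<And>h. h \<in> H \<Longrightarrow> act h \<eta> = f h * \<eta>"
proof -
  interpret H: subgroup H G by (rule H)
  obtain R where R: "finite R" "R \<subseteq> H" "\<And>h. h \<in> H \<Longrightarrow> \<exists>r \<in> R. agree B h r"
    "\<And>r s. r \<in> R \<Longrightarrow> s \<in> R \<Longrightarrow> agree B r s \<Longrightarrow> r = s"
    using transversal_exists[OF B H.subset] by blast
  have f_class: "f g = f h" if "g \<in> H" "h \<in> H" "agree B g h" for g h
  proof -
    have "f (inv g \<otimes> h) = 1"
      by (rule trivial_on_fixer[OF H B(2) _ that]) (rule triv)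
    moreover have "f h = f (g \<otimes> (inv g \<otimes> h))" using that by (simp add: m_assoc[symmetric])
    ultimately show ?thesis using mult[of g "inv g \<otimes> h"] that by simp
  qed
  have "R \<noteq> {}" using R(3)[of \<one>] by auto
  obtain c where c: "c \<in> monoid_gen B" "(\<Sum>r\<in>R. inverse (f r) * act r c) \<noteq> 0"
  proof (rule nonzero_sum_over_transversal[OF R(1) _ \<open>R \<noteq> {}\<close> R(4) B(2)])
    show "R \<subseteq> carrier G" using R(2) H.subset by simp
    show "inverse (f r) \<noteq> 0" if "r \<in> R" for r using f R(2) that by auto
  qed
  have c\<Omega>: "c \<in> \<Omega>" using c(1) monoid_gen_subset[OF B(2)] by auto
  define F where "F = (\<lambda>h. inverse (f h) * act h c)"
  have F: "F h \<in> \<Omega>" if "h \<in> H" for h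
    unfolding F_def using that f[OF that] c\<Omega> by (intro mult_in inverse_in act_in) auto
  show ?thesis
  proof (rule that[of "\<Sum>r\<in>R. F r"])
    show "(\<Sum>r\<in>R. F r) \<in> \<Omega>" using F R(2) by (intro sum_in) auto
    show "(\<Sum>r\<in>R. F r) \<noteq> 0" using c(2) by (simp add: F_def)
    fix h assume h: "h \<in> H"
    have "act h (\<Sum>r\<in>R. F r) = (\<Sum>r\<in>R. act h (F r))"
      using F R(2) h by (intro act_sum) auto
    also have "\<dots> = (\<Sum>r\<in>R. f h * F (h \<otimes> r))"
    proof (rule sum.cong[OF refl])
      fix r assume "r \<in> R"
      then have r: "r \<in> H" using R(2) by auto
      have "act h (F r) = inverse (f r) * act h (act r c)"
        unfolding F_def using f[OF r] fixed[OF h r] h r c\<Omega>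
        by (simp add: act_mult act_inverse inverse_in act_in)
      also have "\<dots> = f h * F (h \<otimes> r)"
        unfolding F_def using f[OF h] f[OF r] mult[OF h r] h r c\<Omega> by (simp add: act_act)
      finally show "act h (F r) = f h * F (h \<otimes> r)" .
    qed
    also have "\<dots> = f h * (\<Sum>r\<in>R. F (h \<otimes> r))" by (simp add: sum_distrib_left)
    also have "(\<Sum>r\<in>R. F (h \<otimes> r)) = (\<Sum>r\<in>R. F r)"
    proof (rule sum_transversal_translate[OF H R B(2) _ h])
      fix g g' assume "g \<in> H" "g' \<in> H" "agree B g g'"
      then show "F g = F g'"
        using f_class agree_monoid_gen[OF B(2) _ _ _ c(1)] by (simp add: F_def)
    qed
    finally show "act h (\<Sum>r\<in>R. F r) = f h * (\<Sum>r\<in>R. F r)" .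
  qed
qed

text \<open>Here a non-zero trace \<open>t\<close> is needed to normalize the weighted sum of the conjugates of \<open>c\<close>.\<close>

lemma Hilbert90_additive:
  assumes H: "subgroup H G" and B: "finite B" "B \<subseteq> \<Omega>"
    and f: "\<And>h. h \<in> H \<Longrightarrow> f h \<in> \<Omega>" and fixed: "\<And>g h. g \<in> H \<Longrightarrow> h \<in> H \<Longrightarrow> act g (f h) = f h"
    and add: "\<And>g h. g \<in> H \<Longrightarrow> h \<in> H \<Longrightarrow> f (g \<otimes> h) = f g + f h"
    and triv: "\<And>h. h \<in> H \<Longrightarrow> (\<And>b. b \<in> B \<Longrightarrow> act h b = b) \<Longrightarrow> f h = 0"
  obtains \<eta> where "\<eta> \<in> \<Omega>" "\<And>h. h \<in> H \<Longrightarrow> act h \<eta> = \<eta> + f h"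
proof -
  interpret H: subgroup H G by (rule H)
  obtain R where R: "finite R" "R \<subseteq> H" "\<And>h. h \<in> H \<Longrightarrow> \<exists>r \<in> R. agree B h r"
    "\<And>r s. r \<in> R \<Longrightarrow> s \<in> R \<Longrightarrow> agree B r s \<Longrightarrow> r = s"
    using transversal_exists[OF B H.subset] by blast
  have f_class: "f g = f h" if "g \<in> H" "h \<in> H" "agree B g h" for g h
  proof -
    have "f (inv g \<otimes> h) = 0"
      by (rule trivial_on_fixer[OF H B(2) _ that]) (rule triv)
    moreover have "f h = f (g \<otimes> (inv g \<otimes> h))" using that by (simp add: m_assoc[symmetric])
    ultimately show ?thesis using add[of g "inv g \<otimes> h"] that by simp
  qed
  have "R \<noteq> {}" using R(3)[of \<one>] by auto
  obtain c where c: "c \<in> monoid_gen B" "(\<Sum>r\<in>R. 1 * act r c) \<noteq> 0"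
  proof (rule nonzero_sum_over_transversal[where a = "\<lambda>_. 1", OF R(1) _ \<open>R \<noteq> {}\<close> R(4) B(2)])
    show "R \<subseteq> carrier G" using R(2) H.subset by simp
  qed auto
  have c\<Omega>: "c \<in> \<Omega>" using c(1) monoid_gen_subset[OF B(2)] by auto
  define t where "t = (\<Sum>r\<in>R. act r c)"
  have t: "t \<in> \<Omega>" "t \<noteq> 0"
    unfolding t_def using c(2) R(2) c\<Omega> by (auto intro!: sum_in act_in)
  have R\<Omega>: "act r c \<in> \<Omega>" if "r \<in> R" for r using that R(2) c\<Omega> by (auto intro!: act_in)
  have c_class: "act g c = act g' c" if "g \<in> H" "g' \<in> H" "agree B g g'" for g g'
    using that agree_monoid_gen[OF B(2) _ _ _ c(1)] by simp
  have act_t: "act h t = t" if h: "h \<in> H" for h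
  proof -
    have "act h t = (\<Sum>r\<in>R. act (h \<otimes> r) c)"
      unfolding t_def using h R(2) c\<Omega> R\<Omega> by (subst act_sum) (auto intro!: sum.cong act_act[symmetric])
    also have "\<dots> = t"
      unfolding t_def by (rule sum_transversal_translate[OF H R B(2) _ h]) (blast intro: c_class)+
    finally show ?thesis .
  qed
  define s where "s = (\<Sum>r\<in>R. f r * act r c)"
  have s: "s \<in> \<Omega>" unfolding s_def using f R(2) R\<Omega> by (intro sum_in mult_in) auto
  have act_s: "act h s = s - f h * t" if h: "h \<in> H" for h
  proof -
    have "act h s = (\<Sum>r\<in>R. f r * act (h \<otimes> r) c)"
      unfolding s_def
    proof (subst act_sum)
      show "f r * act r c \<in> \<Omega>" if "r \<in> R" for r using f R(2) R\<Omega> that by (intro mult_in) auto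
      have "act h (f r * act r c) = f r * act (h \<otimes> r) c" if "r \<in> R" for r
      proof -
        have "r \<in> H" using that R(2) by auto
        then show ?thesis using h fixed f c\<Omega> R\<Omega>[OF that] by (simp add: act_mult act_act)
      qed
      then show "(\<Sum>r\<in>R. act h (f r * act r c)) = (\<Sum>r\<in>R. f r * act (h \<otimes> r) c)" by simp
    qed (use h in simp)
    also have "\<dots> = (\<Sum>r\<in>R. f (h \<otimes> r) * act (h \<otimes> r) c - f h * act (h \<otimes> r) c)"
      using add h R(2) by (intro sum.cong) (auto simp: algebra_simps)
    also have "\<dots> = (\<Sum>r\<in>R. f r * act r c - f h * act r c)"
    proof (rule sum_transversal_translate[OF H R B(2) _ h])
      fix g g' assume "g \<in> H" "g' \<in> H" "agree B g g'"
      then show "f g * act g c - f h * act g c = f g' * act g' c - f h * act g' c"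
        using c_class f_class by metis
    qed
    finally show ?thesis by (simp add: s_def t_def sum_subtractf sum_distrib_left)
  qed
  show ?thesis
  proof (rule that[of "- (s / t)"])
    show "- (s / t) \<in> \<Omega>" using s t by (intro uminus_in divide_in)
    fix h assume h: "h \<in> H"
    then have "act h (- (s / t)) = - ((s - f h * t) / t)"
      using s t act_t act_s by (simp add: act_uminus act_divide divide_in)
    also have "\<dots> = - (s / t) + f h" using t(2) by (simp add: field_simps)
    finally show "act h (- (s / t)) = - (s / t) + f h" .
  qed
qed

end

section \<open>The second character is a norm\<close>

context field_action
begin

lemma act_conj:
  assumes "g \<in> carrier G" "h \<in> carrier G" "x \<in> \<Omega>"
  shows "act h (act (inv g) x) = act (inv g) (act (g \<otimes> h \<otimes> inv g) x)"
proof -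
  have "h \<otimes> inv g = inv g \<otimes> (g \<otimes> h \<otimes> inv g)" using assms by (simp add: m_assoc[symmetric])
  then show ?thesis using assms by (simp add: act_act[symmetric])
qed

lemma act_pow_Suc:
  assumes "g \<in> carrier G" "x \<in> \<Omega>"
  shows "act (g [^] Suc n) x = act (g [^] n) (act g x)" "act (g [^] Suc n) x = act g (act (g [^] n) x)"
  using assms act_act[of "g [^] n" g x] act_act[of g "g [^] n" x] nat_pow_Suc2[of g n] by simp_all

text \<open>
  The cocycle \<open>x3\<close> of the Heisenberg group is a character on \<open>H\<close>, and conjugation by \<open>\<sigma>\<close> adds
  \<open>x2\<close> to it. So for its Kummer generator \<open>\<eta>\<close> and that of \<open>x2\<close>, \<open>\<beta>\<close>, the element
  \<open>act (inv \<sigma>) \<eta> / (\<eta> * \<beta>)\<close> is fixed by \<open>H\<close>, and its norm telescopes to \<open>1 / \<beta> ^ p\<close>; this is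
  how the vanishing of a cup product makes \<open>\<beta> ^ p\<close> a norm. The character that is sought belongs to
  a \<open>p\<close>-th root \<open>\<omega>\<close> of the inverse of that element.
\<close>

lemma is_norm_mod_Kummer:
  fixes p :: nat and x1 x2 x3 :: "'a \<Rightarrow> int"
  defines "H \<equiv> {g \<in> carrier G. [x1 g = 0] (mod p)}"
  assumes p: "Factorial_Ring.prime p"
    and x1: "\<And>g h. g \<in> carrier G \<Longrightarrow> h \<in> carrier G \<Longrightarrow> [x1 (g \<otimes> h) = x1 g + x1 h] (mod p)"
    and x2: "\<And>g h. g \<in> carrier G \<Longrightarrow> h \<in> carrier G \<Longrightarrow> [x2 (g \<otimes> h) = x2 g + x2 h] (mod p)"
    and x3: "\<And>g h. g \<in> carrier G \<Longrightarrow> h \<in> carrier G \<Longrightarrow> [x3 (g \<otimes> h) = x3 g + x3 h + x1 g * x2 h] (mod p)"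
    and B: "finite B" "B \<subseteq> \<Omega>"
    and triv: "\<And>g. g \<in> carrier G \<Longrightarrow> (\<And>b. b \<in> B \<Longrightarrow> act g b = b) \<Longrightarrow> [x2 g = 0] (mod p) \<and> [x3 g = 0] (mod p)"
    and \<sigma>: "\<sigma> \<in> carrier G" "[x1 \<sigma> = 1] (mod p)" "[x2 \<sigma> = 0] (mod p)" "[x3 (\<sigma> [^] p) = 0] (mod p)"
    and \<zeta>: "\<zeta> \<in> \<Omega>" "\<zeta> ^ p = 1" "\<zeta> \<noteq> 1" "\<And>g. g \<in> carrier G \<Longrightarrow> act g \<zeta> = \<zeta>"
    and root: "\<And>w. w \<in> \<Omega> \<Longrightarrow> \<exists>\<omega> \<in> \<Omega>. \<omega> ^ p = w"
  shows "is_norm_mod p H \<sigma> x2"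
proof -
  have HN: "H \<lhd> G" unfolding H_def by (rule kernel_mod_normal) (rule x1)
  have Hc: "h \<in> carrier G" "[x1 h = 0] (mod p)" if "h \<in> H" for h
    using that unfolding H_def by simp_all
  interpret H: normal H G by (rule HN)
  have conjH: "g \<otimes> h \<otimes> inv g \<in> H" if "g \<in> carrier G" "h \<in> H" for g h
    using H.inv_op_closed2 that by simp
  have x3H: "[x3 (g \<otimes> h) = x3 g + x3 h] (mod p)" if "g \<in> H" "h \<in> H" for g h
  proof -
    have "[x1 g * x2 h = 0 * x2 h] (mod p)" using Hc that by (intro cong_mult cong_refl)
    then have "[x3 g + x3 h + x1 g * x2 h = x3 g + x3 h + 0] (mod p)" by (intro cong_add cong_refl) simp
    then show ?thesis using cong_trans[OF x3[OF Hc(1)[OF that(1)] Hc(1)[OF that(2)]]] by simp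
  qed
  have x3_one: "[x3 \<one> = 0] (mod p)" using x3H[of \<one> \<one>] by (simp add: cong_iff_dvd_diff)
  have x3_conj: "[x3 (\<sigma> \<otimes> h \<otimes> inv \<sigma>) = x3 h + x2 h] (mod p)" if h: "h \<in> H" for h
  proof -
    let ?c = "\<sigma> \<otimes> h \<otimes> inv \<sigma>"
    have eq: "?c \<otimes> \<sigma> = \<sigma> \<otimes> h" using \<sigma>(1) Hc(1)[OF h] by (simp add: m_assoc)
    have "?c \<in> carrier G" using \<sigma>(1) Hc(1)[OF h] by simp
    from x3[OF this \<sigma>(1)] have 1: "[x3 (\<sigma> \<otimes> h) = x3 ?c + x3 \<sigma> + x1 ?c * x2 \<sigma>] (mod p)"
      by (simp only: eq)
    have 2: "[x3 (\<sigma> \<otimes> h) = x3 \<sigma> + x3 h + x1 \<sigma> * x2 h] (mod p)"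
      by (rule x3[OF \<sigma>(1) Hc(1)[OF h]])
    have 3: "[x3 ?c + x3 \<sigma> + x1 ?c * x2 \<sigma> = x3 ?c + x3 \<sigma> + x1 ?c * 0] (mod p)"
      by (rule cong_add[OF cong_refl cong_mult[OF cong_refl \<sigma>(3)]])
    have 4: "[x3 \<sigma> + x3 h + x1 \<sigma> * x2 h = x3 \<sigma> + x3 h + 1 * x2 h] (mod p)"
      by (rule cong_add[OF cong_refl cong_mult[OF \<sigma>(2) cong_refl]])
    have "[x3 ?c + x3 \<sigma> + x1 ?c * 0 = x3 \<sigma> + x3 h + 1 * x2 h] (mod p)"
      by (rule cong_trans[OF cong_sym[OF cong_trans[OF 1 3]] cong_trans[OF 2 4]])
    then show ?thesis by (simp add: cong_iff_dvd_diff algebra_simps)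
  qed
  have "\<zeta> \<noteq> 0" using \<zeta>(2) prime_gt_0_nat[OF p] by (auto simp: power_0_left)
  define e where "e = (\<lambda>k. \<zeta> powi k)"
  have e_eq: "e k = e l \<longleftrightarrow> [k = l] (mod p)" for k l
    unfolding e_def by (rule power_int_eq_iff_cong[OF p \<zeta>(2,3)])
  have e_add: "e (k + l) = e k * e l" for k l
    using \<open>\<zeta> \<noteq> 0\<close> by (simp add: e_def power_int_add)
  have e0: "e 0 = 1" by (simp add: e_def)
  have e1: "e k = 1 \<longleftrightarrow> [k = 0] (mod p)" for k using e_eq[of k 0] by (simp add: e0)
  have e_in: "e k \<in> \<Omega>" "e k \<noteq> 0" for k using \<zeta>(1) \<open>\<zeta> \<noteq> 0\<close> by (auto simp: e_def intro: power_int_in)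
  have act_e: "act g (e k) = e k" if "g \<in> carrier G" for g k
    using \<zeta>(1,4) that by (simp add: e_def act_power_int)
  have e_sum: "(\<Prod>j\<in>S. e (F j)) = e (\<Sum>j\<in>S. F j)" for F and S :: "nat set"
    by (induction S rule: infinite_finite_induct) (simp_all add: e0 e_add)
  obtain \<beta> where \<beta>: "\<beta> \<in> \<Omega>" "\<beta> \<noteq> 0" "\<And>g. g \<in> carrier G \<Longrightarrow> act g \<beta> = e (x2 g) * \<beta>"
  proof (rule Hilbert90_multiplicative[OF subgroup_self B, of "\<lambda>g. e (x2 g)"])
    fix g h assume gh: "g \<in> carrier G" "h \<in> carrier G"
    then show "e (x2 (g \<otimes> h)) = e (x2 g) * e (x2 h)" using x2 by (simp add: e_eq flip: e_add)
  qed (use e_in act_e triv e1 in auto)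
  obtain \<eta> where \<eta>: "\<eta> \<in> \<Omega>" "\<eta> \<noteq> 0" "\<And>h. h \<in> H \<Longrightarrow> act h \<eta> = e (x3 h) * \<eta>"
  proof (rule Hilbert90_multiplicative[OF H.is_subgroup B, of "\<lambda>h. e (x3 h)"])
    fix g h assume gh: "g \<in> H" "h \<in> H"
    then show "e (x3 (g \<otimes> h)) = e (x3 g) * e (x3 h)" using x3H by (simp add: e_eq flip: e_add)
  qed (use e_in act_e triv e1 Hc in auto)
  define \<tau> where "\<tau> = inv \<sigma>"
  have \<tau>: "\<tau> \<in> carrier G" using \<sigma>(1) by (simp add: \<tau>_def)
  have \<tau>pow: "\<tau> [^] (j::nat) = inv (\<sigma> [^] j)" for j using \<sigma>(1) by (simp add: \<tau>_def nat_pow_inv)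
  have \<tau>\<beta>: "act \<tau> \<beta> = \<beta>"
  proof -
    have "[- x2 \<sigma> = - 0] (mod p)" using \<sigma>(3) by (simp add: cong_iff_dvd_diff)
    then have "[x2 \<tau> = 0] (mod p)"
      using additive_mod_inv[of x2, OF x2 \<sigma>(1)] unfolding \<tau>_def by (auto intro: cong_trans)
    then show ?thesis using \<beta>(3)[OF \<tau>] by (simp flip: e1)
  qed
  have \<tau>p: "\<tau> [^] p \<in> H" "act (\<tau> [^] p) \<eta> = \<eta>"
  proof -
    have "[x1 (\<sigma> [^] p) = int p * x1 \<sigma>] (mod p)"
      by (rule additive_mod_pow[of x1, OF x1 \<sigma>(1)])
    moreover have "[int p * x1 \<sigma> = 0] (mod p)" by (simp add: cong_0_iff)
    ultimately have \<sigma>p: "\<sigma> [^] p \<in> H" using \<sigma>(1) unfolding H_def by (auto intro: cong_trans)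
    then show in_H: "\<tau> [^] p \<in> H" by (simp add: \<tau>pow)
    have "\<sigma> [^] p \<otimes> \<tau> [^] p = \<one>" using \<sigma>(1) by (simp add: \<tau>pow)
    with x3H[OF \<sigma>p in_H] have 1: "[x3 \<one> = x3 (\<sigma> [^] p) + x3 (\<tau> [^] p)] (mod p)" by (simp only:)
    have 2: "[x3 (\<sigma> [^] p) + x3 (\<tau> [^] p) = 0 + x3 (\<tau> [^] p)] (mod p)"
      by (rule cong_add[OF \<sigma>(4) cong_refl])
    have "[0 + x3 (\<tau> [^] p) = 0] (mod p)"
      by (rule cong_trans[OF cong_sym[OF cong_trans[OF 1 2]] x3_one])
    then have "[x3 (\<tau> [^] p) = 0] (mod p)" by simp
    then show "act (\<tau> [^] p) \<eta> = \<eta>" using \<eta>(3)[OF in_H] by (simp flip: e1)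
  qed
  define z where "z = act \<tau> \<eta> / (\<eta> * \<beta>)"
  have \<tau>\<eta>: "act \<tau> \<eta> \<in> \<Omega>" "act \<tau> \<eta> \<noteq> 0" using \<tau> \<eta> act_in act_eq_zero by auto
  have z: "z \<in> \<Omega>" "z \<noteq> 0"
    using \<tau>\<eta> \<eta> \<beta> by (auto simp: z_def intro!: divide_in mult_in)
  have prod_z: "(\<Prod>j<n. act (\<tau> [^] j) z) = act (\<tau> [^] n) \<eta> / (\<eta> * \<beta> ^ n)" for n :: nat
  proof (induction n)
    case 0
    then show ?case using \<eta>(1,2) by (simp add: act_id)
  next
    case (Suc n)
    have c: "\<tau> [^] n \<in> carrier G" using \<tau> by simp
    have "act (\<tau> [^] n) z = act (\<tau> [^] Suc n) \<eta> / (act (\<tau> [^] n) \<eta> * \<beta>)"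
      using c \<tau> \<tau>\<eta> \<eta> \<beta>(1) act_pow_Suc(1)[OF \<tau> \<eta>(1), of n] act_pow_fixed[OF \<tau> \<beta>(1) \<tau>\<beta>, of n]
      by (simp add: z_def act_divide act_mult mult_in)
    moreover have "act (\<tau> [^] n) \<eta> \<noteq> 0" using c \<eta> act_eq_zero by simp
    ultimately show ?case using Suc \<eta>(2) \<beta>(2) by (simp add: field_simps)
  qed
  define w where "w = inverse z"
  have w: "w \<in> \<Omega>" "w \<noteq> 0" using z by (auto simp: w_def inverse_in)
  have prod_w: "(\<Prod>j<p. act (\<tau> [^] j) w) = \<beta> ^ p"
  proof -
    have "(\<Prod>j<p. act (\<tau> [^] j) w) = inverse (\<Prod>j<p. act (\<tau> [^] j) z)"
      using z \<tau> by (simp add: w_def act_inverse flip: prod_inversef)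
    then show ?thesis using \<tau>p(2) \<eta>(2) by (simp add: prod_z field_simps)
  qed
  have act_w: "act h w = w" if h: "h \<in> H" for h
  proof -
    have "act h (act \<tau> \<eta>) = act \<tau> (e (x3 (\<sigma> \<otimes> h \<otimes> inv \<sigma>)) * \<eta>)"
      using act_conj[OF \<sigma>(1) Hc(1)[OF h] \<eta>(1)] \<eta>(3)[OF conjH[OF \<sigma>(1) h]] by (simp add: \<tau>_def)
    also have "\<dots> = e (x3 h + x2 h) * act \<tau> \<eta>"
      using x3_conj[OF h] \<tau> \<eta>(1) e_in act_e e_eq by (simp add: act_mult)
    finally have "act h z = z"
      using Hc(1)[OF h] \<tau>\<eta>(1) \<eta> \<beta> h e_in
      by (simp add: z_def act_divide act_mult mult_in e_add)
    then show ?thesis using z(1) Hc(1)[OF h] by (simp add: w_def act_inverse)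
  qed
  obtain \<omega> where \<omega>: "\<omega> \<in> \<Omega>" "\<omega> ^ p = w" using root[OF w(1)] by blast
  have "\<omega> \<noteq> 0" using \<omega>(2) w(2) prime_gt_0_nat[OF p] by (auto simp: power_0_left)
  have "\<exists>k. act h \<omega> = e k * \<omega>" if h: "h \<in> H" for h
  proof -
    have "(act h \<omega> / \<omega>) ^ p = 1"
      using act_power[of h \<omega> p] \<omega> act_w[OF h] Hc(1)[OF h] w(2) by (simp add: power_divide)
    then obtain k where "act h \<omega> / \<omega> = \<zeta> powi k"
      using root_of_unity_power_int[OF p \<zeta>(2,3)] by blast
    then show ?thesis using \<open>\<omega> \<noteq> 0\<close> by (auto simp: e_def field_simps)
  qed
  then obtain \<psi> where \<psi>: "\<And>h. h \<in> H \<Longrightarrow> act h \<omega> = e (\<psi> h) * \<omega>" by metis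
  show ?thesis
    unfolding is_norm_mod_def
  proof (intro exI[of _ \<psi>] conjI ballI)
    fix g h assume gh: "g \<in> H" "h \<in> H"
    have "e (\<psi> (g \<otimes> h)) * \<omega> = act g (act h \<omega>)"
      using \<psi>[of "g \<otimes> h"] gh Hc(1) \<omega>(1) by (simp add: act_act)
    also have "\<dots> = e (\<psi> g + \<psi> h) * \<omega>"
      using \<psi> gh Hc(1) \<omega>(1) e_in act_e by (simp add: act_mult e_add)
    finally show "[\<psi> (g \<otimes> h) = \<psi> g + \<psi> h] (mod p)"
      using \<open>\<omega> \<noteq> 0\<close> by (simp add: e_eq)
  next
    fix h assume h: "h \<in> H"
    define N where "N = (\<Prod>j<p. act (\<tau> [^] j) \<omega>)"
    have T\<omega>: "act (\<tau> [^] j) \<omega> \<in> \<Omega>" for j :: nat using \<tau> \<omega>(1) by (simp add: act_in)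
    have N: "N \<in> \<Omega>" unfolding N_def using T\<omega> by (intro prod_in)
    have "N ^ p = (\<Prod>j<p. act (\<tau> [^] j) w)"
      unfolding N_def prod_power_distrib using \<tau> \<omega> by (simp add: act_power[symmetric])
    then have Np: "N ^ p = \<beta> ^ p" by (simp add: prod_w)
    then have "(N / \<beta>) ^ p = 1" using \<beta>(2) by (simp add: power_divide)
    then obtain k where "N / \<beta> = e k"
      unfolding e_def using root_of_unity_power_int[OF p \<zeta>(2,3)] by blast
    then have Nk: "N = e k * \<beta>" using \<beta>(2) by (simp add: field_simps)
    then have "N \<noteq> 0" using e_in \<beta>(2) by simp
    have "act h N = e (x2 h) * N"
      unfolding Nk using \<beta> e_in act_e Hc(1)[OF h] by (simp add: act_mult)
    moreover have "act h N = e (\<Sum>j<p. \<psi> (\<sigma> [^] j \<otimes> h \<otimes> inv (\<sigma> [^] j))) * N"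
    proof -
      have "act h (act (\<tau> [^] j) \<omega>) = e (\<psi> (\<sigma> [^] j \<otimes> h \<otimes> inv (\<sigma> [^] j))) * act (\<tau> [^] j) \<omega>" for j :: nat
      proof -
        have c: "\<sigma> [^] j \<in> carrier G" "\<tau> [^] j \<in> carrier G" using \<sigma>(1) \<tau> by auto
        have "act h (act (\<tau> [^] j) \<omega>) = act (\<tau> [^] j) (act (\<sigma> [^] j \<otimes> h \<otimes> inv (\<sigma> [^] j)) \<omega>)"
          unfolding \<tau>pow by (rule act_conj[OF c(1) Hc(1)[OF h] \<omega>(1)])
        then show ?thesis using \<psi>[OF conjH[OF c(1) h]] c(2) \<omega>(1) e_in act_e by (simp add: act_mult)
      qed
      then show ?thesis
        unfolding N_def using T\<omega> Hc(1)[OF h] by (simp add: act_prod prod.distrib e_sum)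
    qed
    ultimately show "[(\<Sum>j<p. \<psi> (\<sigma> [^] j \<otimes> h \<otimes> inv (\<sigma> [^] j))) = x2 h] (mod p)"
      using \<open>N \<noteq> 0\<close> by (simp flip: e_eq)
  qed
qed

end

context field_action
begin

text \<open>
  In characteristic \<open>p\<close> the trace from the fixed field of \<open>H\<close> is onto: the powers of \<open>\<tau>\<close> are
  distinct on it, because \<open>act (\<tau> [^] i) \<alpha> = \<alpha> - i\<close> for an Artin-Schreier generator \<open>\<alpha>\<close> of
  \<open>x1\<close>, so their sum does not vanish. Hence \<open>\<beta> ^ p - \<beta>\<close>, whose Artin-Schreier
  character is \<open>x2\<close>, is the trace of some \<open>w\<close>, and the character of \<open>w\<close> has norm \<open>x2\<close>.
\<close>

lemma is_norm_mod_Artin_Schreier: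
  fixes p :: nat and x1 x2 :: "'a \<Rightarrow> int"
  defines "H \<equiv> {g \<in> carrier G. [x1 g = 0] (mod p)}"
  assumes p: "Factorial_Ring.prime p" and CHAR: "CHAR('k) = p"
    and x1: "\<And>g h. g \<in> carrier G \<Longrightarrow> h \<in> carrier G \<Longrightarrow> [x1 (g \<otimes> h) = x1 g + x1 h] (mod p)"
    and x2: "\<And>g h. g \<in> carrier G \<Longrightarrow> h \<in> carrier G \<Longrightarrow> [x2 (g \<otimes> h) = x2 g + x2 h] (mod p)"
    and B: "finite B" "B \<subseteq> \<Omega>"
    and triv: "\<And>g. g \<in> carrier G \<Longrightarrow> (\<And>b. b \<in> B \<Longrightarrow> act g b = b) \<Longrightarrow> [x1 g = 0] (mod p) \<and> [x2 g = 0] (mod p)"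
    and \<sigma>: "\<sigma> \<in> carrier G" "[x1 \<sigma> = 1] (mod p)"
    and root: "\<And>w. w \<in> \<Omega> \<Longrightarrow> \<exists>\<omega> \<in> \<Omega>. \<omega> ^ p - \<omega> = w"
  shows "is_norm_mod p H \<sigma> x2"
proof -
  have HN: "H \<lhd> G" unfolding H_def by (rule kernel_mod_normal) (rule x1)
  have Hc: "h \<in> carrier G" "[x1 h = 0] (mod p)" if "h \<in> H" for h
    using that unfolding H_def by simp_all
  interpret H: normal H G by (rule HN)
  have conjH: "g \<otimes> h \<otimes> inv g \<in> H" if "g \<in> carrier G" "h \<in> H" for g h
    using H.inv_op_closed2 that by simp
  define e where "e = (of_int :: int \<Rightarrow> 'k)"
  have e_eq: "e k = e l \<longleftrightarrow> [k = l] (mod p)" for k l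
    unfolding e_def by (simp add: of_int_eq_iff_cong_CHAR CHAR)
  have e_add: "e (k + l) = e k + e l" for k l by (simp add: e_def)
  have e0: "e k = 0 \<longleftrightarrow> [k = 0] (mod p)" for k using e_eq[of k 0] by (simp add: e_def)
  have e_in: "e k \<in> \<Omega>" for k by (simp add: e_def of_int_in)
  have act_e: "act g (e k) = e k" if "g \<in> carrier G" for g k using that by (simp add: e_def act_of_int)
  have frob: "(x - y) ^ p = x ^ p - y ^ p" for x y :: 'k
  proof -
    have "(x - y + y) ^ p = (x - y) ^ p + y ^ p"
      using freshmans_dream[where ?'a = 'k] p CHAR by blast
    then show ?thesis by simp
  qed
  have Artin_Schreier: "\<exists>\<beta> \<in> \<Omega>. \<forall>g \<in> carrier G. act g \<beta> = \<beta> + e (x g)"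
    if x: "\<And>g h. g \<in> carrier G \<Longrightarrow> h \<in> carrier G \<Longrightarrow> [x (g \<otimes> h) = x g + x h] (mod p)"
      "\<And>g. g \<in> carrier G \<Longrightarrow> (\<And>b. b \<in> B \<Longrightarrow> act g b = b) \<Longrightarrow> [x g = 0] (mod p)" for x :: "'a \<Rightarrow> int"
  proof -
    obtain \<beta> where "\<beta> \<in> \<Omega>" "\<And>g. g \<in> carrier G \<Longrightarrow> act g \<beta> = \<beta> + e (x g)"
    proof (rule Hilbert90_additive[OF subgroup_self B, of "\<lambda>g. e (x g)"])
      fix g h assume "g \<in> carrier G" "h \<in> carrier G"
      then show "e (x (g \<otimes> h)) = e (x g) + e (x h)" using x(1) by (simp add: e_eq flip: e_add)
    qed (use e_in act_e x(2) e0 in auto)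
    then show ?thesis by blast
  qed
  obtain \<alpha> where \<alpha>: "\<alpha> \<in> \<Omega>" "\<And>g. g \<in> carrier G \<Longrightarrow> act g \<alpha> = \<alpha> + e (x1 g)"
    using Artin_Schreier[of x1] x1 triv by blast
  obtain \<beta> where \<beta>: "\<beta> \<in> \<Omega>" "\<And>g. g \<in> carrier G \<Longrightarrow> act g \<beta> = \<beta> + e (x2 g)"
    using Artin_Schreier[of x2] x2 triv by blast
  define \<tau> where "\<tau> = inv \<sigma>"
  have \<tau>: "\<tau> \<in> carrier G" using \<sigma>(1) by (simp add: \<tau>_def)
  have \<tau>pow: "\<tau> [^] (j::nat) = inv (\<sigma> [^] j)" for j using \<sigma>(1) by (simp add: \<tau>_def nat_pow_inv)
  have x1_\<tau>: "[x1 (\<tau> [^] n) = - int n] (mod p)" for n :: nat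
  proof -
    have "[- x1 \<sigma> = - 1] (mod p)" using \<sigma>(2) by (simp add: cong_iff_dvd_diff dvd_diff_commute)
    then have "[x1 \<tau> = - 1] (mod p)"
      using additive_mod_inv[of x1, OF x1 \<sigma>(1)] unfolding \<tau>_def by (auto intro: cong_trans)
    from cong_trans[OF additive_mod_pow[of x1, OF x1 \<tau>] cong_mult[OF cong_refl this], of n]
    show ?thesis by simp
  qed
  have \<tau>p: "\<tau> [^] p \<in> H"
  proof -
    have "[- int p = 0] (mod p)" by (simp add: cong_0_iff)
    then show ?thesis using x1_\<tau>[of p] \<tau> unfolding H_def by (auto intro: cong_trans)
  qed
  define M where "M = {x \<in> \<Omega>. \<forall>h \<in> H. act h x = x}"
  have M\<Omega>: "x \<in> \<Omega>" if "x \<in> M" for x using that by (simp add: M_def)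
  have M_pow: "act (\<tau> [^] j) x \<in> M" if x: "x \<in> M" for x and j :: nat
  proof -
    have c: "\<sigma> [^] j \<in> carrier G" using \<sigma>(1) by simp
    have "act h (act (\<tau> [^] j) x) = act (\<tau> [^] j) x" if h: "h \<in> H" for h
      unfolding \<tau>pow using act_conj[OF c Hc(1)[OF h] M\<Omega>[OF x]] conjH[OF c h] x by (simp add: M_def)
    then show ?thesis using \<tau> M\<Omega>[OF x] by (simp add: M_def act_in)
  qed
  have \<alpha>M: "\<alpha> \<in> M"
    unfolding M_def using \<alpha> Hc by (auto simp flip: e0)
  obtain u where u: "u \<in> M" "(\<Sum>j<p. act (\<tau> [^] j) u) \<noteq> 0"
  proof (rule ccontr)
    assume none: "\<not> thesis"
    note obt = that
    have zero: "(\<Sum>j<p. 1 * act (\<tau> [^] j) x) = 0" if "x \<in> M" for x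
      using none obt[OF that] by auto
    have "(1 :: 'k) = 0"
    proof (rule independence_of_characters[where S = "{..<p}" and M = M and i = 0
          and \<theta> = "\<lambda>j. act (\<tau> [^] j)" and a = "\<lambda>_. 1"])
      show "1 \<in> M" using one_in act_one Hc by (simp add: M_def)
      show "x * y \<in> M" if "x \<in> M" "y \<in> M" for x y
        using that Hc by (simp add: M_def mult_in act_mult)
      show "\<exists>x\<in>M. act (\<tau> [^] i) x \<noteq> act (\<tau> [^] j) x" if ij: "i \<in> {..<p}" "j \<in> {..<p}" "i \<noteq> j" for i j
      proof (rule bexI[OF _ \<alpha>M])
        show "act (\<tau> [^] i) \<alpha> \<noteq> act (\<tau> [^] j) \<alpha>"
        proof
          assume "act (\<tau> [^] i) \<alpha> = act (\<tau> [^] j) \<alpha>"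
          then have "[x1 (\<tau> [^] i) = x1 (\<tau> [^] j)] (mod p)" using \<alpha>(2) \<tau> by (simp add: e_eq)
          then have "[- int i = - int j] (mod p)"
            by (rule cong_trans[OF cong_sym[OF x1_\<tau>] cong_trans[OF _ x1_\<tau>]])
          then have "[int i = int j] (mod p)" by (simp add: cong_iff_dvd_diff dvd_diff_commute)
          then show False using ij by (simp add: cong_int_iff cong_def)
        qed
      qed
      show "act (\<tau> [^] i) (x * y) = act (\<tau> [^] i) x * act (\<tau> [^] i) y"
        if "x \<in> M" "y \<in> M" for i :: nat and x y
        using \<tau> M\<Omega> that by (simp add: act_mult)
      show "act (\<tau> [^] i) 1 = 1" for i :: nat using \<tau> by (simp add: act_one)
    qed (use zero prime_gt_0_nat[OF p] in simp_all)
    then show False by simp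
  qed
  define t where "t = (\<Sum>j<p. act (\<tau> [^] j) u)"
  have u_pow: "act (\<tau> [^] j) u \<in> \<Omega>" for j :: nat using M\<Omega>[OF M_pow[OF u(1)]] .
  have t: "t \<in> \<Omega>" "t \<noteq> 0" using u(2) unfolding t_def by (simp_all add: sum_in u_pow)
  have act_t: "act h t = t" if h: "h \<in> H" for h
  proof -
    have "act h t = (\<Sum>j<p. act h (act (\<tau> [^] j) u))"
      unfolding t_def by (rule act_sum[OF Hc(1)[OF h] u_pow])
    also have "\<dots> = t" using M_pow[OF u(1)] h by (simp add: t_def M_def)
    finally show ?thesis .
  qed
  have \<tau>t: "act \<tau> t = t"
  proof -
    have "act \<tau> t = (\<Sum>j<p. act (\<tau> [^] Suc j) u)"
      unfolding t_def act_pow_Suc(2)[OF \<tau> M\<Omega>[OF u(1)]] by (rule act_sum[OF \<tau> u_pow])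
    also have "\<dots> = (\<Sum>j<p. act (\<tau> [^] j) u) + act (\<tau> [^] p) u - act (\<tau> [^] (0::nat)) u"
      using sum.lessThan_Suc_shift[of "\<lambda>j. act (\<tau> [^] j) u" p] by simp
    also have "\<dots> = t"
      using u(1) \<tau>p act_id[OF M\<Omega>[OF u(1)]] by (simp add: M_def t_def)
    finally show ?thesis .
  qed
  define b where "b = \<beta> ^ p - \<beta>"
  have b: "b \<in> \<Omega>" using \<beta>(1) by (simp add: b_def diff_in power_in)
  have act_b: "act g b = b" if g: "g \<in> carrier G" for g
  proof -
    have "act g b = (\<beta> + e (x2 g)) ^ p - (\<beta> + e (x2 g))"
      unfolding b_def using g \<beta> by (simp add: act_diff act_power power_in)
    also have "(\<beta> + e (x2 g)) ^ p = \<beta> ^ p + e (x2 g) ^ p"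
      using freshmans_dream[where ?'a = 'k] p CHAR by blast
    also have "e (x2 g) ^ p = e (x2 g)"
      unfolding e_def by (rule of_int_power_CHAR[OF p CHAR])
    finally show ?thesis by (simp add: b_def)
  qed
  define w where "w = u * b / t"
  have w: "w \<in> \<Omega>" using M\<Omega>[OF u(1)] b t by (simp add: w_def divide_in mult_in)
  have act_w: "act h w = w" if h: "h \<in> H" for h
  proof -
    have "act h u = u" using u(1) h by (simp add: M_def)
    then show ?thesis
      using Hc(1)[OF h] M\<Omega>[OF u(1)] b t(1) act_t[OF h] act_b[OF Hc(1)[OF h]]
      by (simp add: w_def act_divide act_mult mult_in)
  qed
  have trace_w: "(\<Sum>j<p. act (\<tau> [^] j) w) = b"
  proof -
    have "act (\<tau> [^] j) w = act (\<tau> [^] j) u * b / t" for j :: nat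
      using \<tau> M\<Omega>[OF u(1)] b t act_b[of "\<tau> [^] j"] act_pow_fixed[OF \<tau> t(1) \<tau>t, of j]
      by (simp add: w_def act_divide act_mult mult_in)
    then have "(\<Sum>j<p. act (\<tau> [^] j) w) = t * b / t"
      by (simp add: t_def flip: sum_divide_distrib sum_distrib_right)
    then show ?thesis using t(2) by simp
  qed
  obtain \<omega> where \<omega>: "\<omega> \<in> \<Omega>" "\<omega> ^ p - \<omega> = w" using root[OF w] by blast
  have "\<exists>k. act h \<omega> = \<omega> + e k" if h: "h \<in> H" for h
  proof -
    have "act h \<omega> ^ p - act h \<omega> = \<omega> ^ p - \<omega>"
      using act_w[OF h] \<omega>(1) Hc(1)[OF h]
      unfolding \<omega>(2)[symmetric] by (simp add: act_diff act_power power_in)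
    then have "(act h \<omega> - \<omega>) ^ p = act h \<omega> - \<omega>" by (simp add: frob algebra_simps)
    then obtain k where "act h \<omega> - \<omega> = of_int k" using prime_field_element[OF p CHAR] by blast
    then show ?thesis by (auto simp: e_def algebra_simps)
  qed
  then obtain \<psi> where \<psi>: "\<And>h. h \<in> H \<Longrightarrow> act h \<omega> = \<omega> + e (\<psi> h)" by metis
  show ?thesis
    unfolding is_norm_mod_def
  proof (intro exI[of _ \<psi>] conjI ballI)
    fix g h assume gh: "g \<in> H" "h \<in> H"
    have "\<omega> + e (\<psi> (g \<otimes> h)) = act g (act h \<omega>)"
      using \<psi>[of "g \<otimes> h"] gh Hc(1) \<omega>(1) by (simp add: act_act)
    also have "\<dots> = \<omega> + e (\<psi> g + \<psi> h)"
      using \<psi> gh Hc(1) \<omega>(1) e_in act_e by (simp add: act_add e_add)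
    finally show "[\<psi> (g \<otimes> h) = \<psi> g + \<psi> h] (mod p)" by (simp add: e_eq)
  next
    fix h assume h: "h \<in> H"
    define N where "N = (\<Sum>j<p. act (\<tau> [^] j) \<omega>)"
    have T\<omega>: "act (\<tau> [^] j) \<omega> \<in> \<Omega>" for j :: nat using \<tau> \<omega>(1) by (simp add: act_in)
    have "N ^ p - N = (\<Sum>j<p. act (\<tau> [^] j) w)"
    proof -
      have "N ^ p = (\<Sum>j<p. act (\<tau> [^] j) \<omega> ^ p)"
        unfolding N_def using freshmans_dream_sum[where ?'a = 'k] p CHAR by blast
      moreover have "act (\<tau> [^] j) w = act (\<tau> [^] j) \<omega> ^ p - act (\<tau> [^] j) \<omega>" for j :: nat
        using \<tau> \<omega>(1) by (simp add: act_diff act_power power_in flip: \<omega>(2))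
      ultimately show ?thesis by (simp add: N_def sum_subtractf)
    qed
    then have "(N - \<beta>) ^ p = N - \<beta>" by (simp add: trace_w b_def frob algebra_simps)
    then obtain k where "N - \<beta> = e k"
      unfolding e_def using prime_field_element[OF p CHAR] by blast
    then have Nk: "N = \<beta> + e k" by (simp add: algebra_simps)
    then have "act h N = N + e (x2 h)"
      using \<beta> e_in act_e Hc(1)[OF h] by (simp add: act_add)
    moreover have "act h N = N + e (\<Sum>j<p. \<psi> (\<sigma> [^] j \<otimes> h \<otimes> inv (\<sigma> [^] j)))"
    proof -
      have "act h (act (\<tau> [^] j) \<omega>) = act (\<tau> [^] j) \<omega> + e (\<psi> (\<sigma> [^] j \<otimes> h \<otimes> inv (\<sigma> [^] j)))" for j :: nat
      proof -
        have c: "\<sigma> [^] j \<in> carrier G" "\<tau> [^] j \<in> carrier G" using \<sigma>(1) \<tau> by auto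
        have "act h (act (\<tau> [^] j) \<omega>) = act (\<tau> [^] j) (act (\<sigma> [^] j \<otimes> h \<otimes> inv (\<sigma> [^] j)) \<omega>)"
          unfolding \<tau>pow by (rule act_conj[OF c(1) Hc(1)[OF h] \<omega>(1)])
        then show ?thesis using \<psi>[OF conjH[OF c(1) h]] c(2) \<omega>(1) e_in act_e by (simp add: act_add)
      qed
      then show ?thesis
        unfolding N_def using T\<omega> Hc(1)[OF h] by (simp add: act_sum sum.distrib e_def)
    qed
    ultimately show "[(\<Sum>j<p. \<psi> (\<sigma> [^] j \<otimes> h \<otimes> inv (\<sigma> [^] j))) = x2 h] (mod p)"
      by (simp flip: e_eq)
  qed
qed

end

section \<open>Homomorphisms from a pro-\<open>p\<close> presentation to a finite \<open>p\<close>-group\<close>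

definition word_value :: "('h, 'n) monoid_scheme \<Rightarrow> ('i \<Rightarrow> 'h) \<Rightarrow> ('i \<times> bool) list \<Rightarrow> 'h" where
  "word_value P v w =
     foldr (\<lambda>a y. (if snd a then v (fst a) else inv\<^bsub>P\<^esub> (v (fst a))) \<otimes>\<^bsub>P\<^esub> y) w \<one>\<^bsub>P\<^esub>"

lemma word_value_hom:
  assumes "group P" and v: "\<And>x. x \<in> A \<Longrightarrow> v x \<in> carrier P"
  shows "word_value P v \<in> hom (free_group A) P"
proof -
  interpret P: group P by fact
  define l where "l = (\<lambda>a. if snd a then v (fst a) else inv\<^bsub>P\<^esub> (v (fst a)))"
  have l: "l a \<in> carrier P" if "fst a \<in> A" for a using v that by (simp add: l_def)
  have word_Cons: "word_value P v (a # w) = l a \<otimes>\<^bsub>P\<^esub> word_value P v w" for a w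
    by (simp add: word_value_def l_def)
  have word_Nil: "word_value P v [] = \<one>\<^bsub>P\<^esub>" by (simp add: word_value_def)
  have closed: "word_value P v w \<in> carrier P" if "set w \<subseteq> A \<times> UNIV" for w
    using that by (induction w) (auto simp: word_Nil word_Cons intro!: P.m_closed l)
  have red: "word_value P v (red_Cons a w) = l a \<otimes>\<^bsub>P\<^esub> word_value P v w"
    if a: "fst a \<in> A" and w: "set w \<subseteq> A \<times> UNIV" for a w
  proof (cases w)
    case (Cons b u)
    show ?thesis
    proof (cases "fst a = fst b \<and> snd a \<noteq> snd b")
      case True
      then have "l a \<otimes>\<^bsub>P\<^esub> l b = \<one>\<^bsub>P\<^esub>" using v[OF a] by (auto simp: l_def)
      moreover have "fst b \<in> A" "word_value P v u \<in> carrier P" using w Cons closed by auto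
      ultimately have "l a \<otimes>\<^bsub>P\<^esub> (l b \<otimes>\<^bsub>P\<^esub> word_value P v u) = word_value P v u"
        using l a by (simp add: P.m_assoc[symmetric])
      then show ?thesis using True Cons word_Cons by simp
    next
      case False
      then show ?thesis using Cons word_Cons by auto
    qed
  qed (simp add: word_Nil word_Cons)
  have "word_value P v (foldr red_Cons u w) = word_value P v u \<otimes>\<^bsub>P\<^esub> word_value P v w"
    if "set u \<subseteq> A \<times> UNIV" "set w \<subseteq> A \<times> UNIV" for u w
    using that(1)
  proof (induction u)
    case Nil
    then show ?case using closed[OF that(2)] by (simp add: word_Nil)
  next
    case (Cons a u)
    then have a: "fst a \<in> A" "set u \<subseteq> A \<times> UNIV" by auto
    have "set (foldr red_Cons u w) \<subseteq> A \<times> UNIV"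
      using set_foldr_red_Cons[of u w] a that(2) by blast
    then show ?case
      using red[OF a(1)] Cons.IH[OF a(2)] a l closed that(2)
      by (simp add: word_Cons P.m_assoc)
  qed
  moreover have "set w \<subseteq> A \<times> UNIV" if "w \<in> carrier (free_group A)" for w
    using that by (auto simp: free_group_def)
  ultimately show ?thesis
    using closed by (intro homI) (simp_all add: free_group_def)
qed

lemma group_hom_word_value:
  assumes "group P" "\<And>x. x \<in> A \<Longrightarrow> v x \<in> carrier P"
  shows "group_hom (free_group A) P (word_value P v)"
  unfolding group_hom_def group_hom_axioms_def
  using assms(1) group_free_group word_value_hom[OF assms(1), of A v] assms(2) by blast

lemma word_value_generator: "group P \<Longrightarrow> v x \<in> carrier P \<Longrightarrow> word_value P v [(x, True)] = v x"
  by (simp add: word_value_def group.is_monoid)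

lemma kernel_in_free_pro_p_index:
  assumes P: "group P" "order P = p ^ k" and p: "Factorial_Ring.prime p"
    and v: "\<And>x. x \<in> A \<Longrightarrow> v x \<in> carrier P" "finite {x \<in> A. v x \<noteq> \<one>\<^bsub>P\<^esub>}"
  shows "kernel (free_group A) P (word_value P v) \<in> free_pro_p_index p A"
proof -
  interpret P: group P by fact
  interpret h: group_hom "free_group A" P "word_value P v"
    by (rule group_hom_word_value[OF P(1) v(1)])
  let ?N = "kernel (free_group A) P (word_value P v)"
  let ?Q = "free_group A Mod ?N" and ?k = "\<lambda>Y. the_elem (word_value P v ` Y)"
  interpret k: group_hom ?Q P ?k
    using normal.factorgroup_is_group[OF h.normal_kernel] P(1) h.FactGroup_hom
    unfolding group_hom_def group_hom_axioms_def by blast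
  have "card (rcosets\<^bsub>free_group A\<^esub> ?N) = card (?k ` carrier ?Q)"
    using card_image[OF h.FactGroup_inj_on] by (simp add: FactGroup_def)
  moreover have "card (?k ` carrier ?Q) dvd order P"
    using P.lagrange[OF k.img_is_subgroup] by (metis dvd_triv_right)
  ultimately have "\<exists>n. card (rcosets\<^bsub>free_group A\<^esub> ?N) = p ^ n"
    using divides_primepow_nat[OF p] P(2) by metis
  moreover have "{x \<in> A. [(x, True)] \<notin> ?N} \<subseteq> {x \<in> A. v x \<noteq> \<one>\<^bsub>P\<^esub>}"
  proof
    fix x assume "x \<in> {x \<in> A. [(x, True)] \<notin> ?N}"
    then show "x \<in> {x \<in> A. v x \<noteq> \<one>\<^bsub>P\<^esub>}"
      using word_value_generator[OF P(1), of v x] v(1)[of x] by (simp add: kernel_def free_group_def reduced_def)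
  qed
  then have "finite {x \<in> A. [(x, True)] \<notin> ?N}" using v(2) by (rule finite_subset)
  ultimately show ?thesis
    using h.normal_kernel by (simp add: free_pro_p_index_def)
qed

lemma topspace_free_pro_p_topology: "topspace (free_pro_p_topology p A) = carrier (free_pro_p_group p A)"
proof -
  have "carrier (free_pro_p_group p A)
      \<subseteq> (\<Pi>\<^sub>E N\<in>free_pro_p_index p A. carrier (free_group A Mod N))"
    by (auto simp: free_pro_p_group_def Let_def)
  then show ?thesis by (auto simp: free_pro_p_topology_def)
qed

lemma openin_component:
  assumes "N \<in> free_pro_p_index p A"
  shows "openin (free_pro_p_topology p A) {c \<in> carrier (free_pro_p_group p A). Q (c N)}"
proof -
  let ?T = "product_topology (\<lambda>N. discrete_topology (carrier (free_group A Mod N))) (free_pro_p_index p A)"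
  have "continuous_map (free_pro_p_topology p A) (discrete_topology (carrier (free_group A Mod N))) (\<lambda>c. c N)"
    unfolding free_pro_p_topology_def
    by (intro continuous_map_from_subtopology continuous_map_product_projection assms)
  then have "openin (free_pro_p_topology p A)
      {c \<in> topspace (free_pro_p_topology p A). c N \<in> {y \<in> carrier (free_group A Mod N). Q y}}"
    by (rule openin_continuous_map_preimage) simp
  moreover have "c N \<in> carrier (free_group A Mod N)" if "c \<in> carrier (free_pro_p_group p A)" for c
    using that assms by (auto simp: free_pro_p_group_def Let_def)
  then have "{c \<in> topspace (free_pro_p_topology p A). c N \<in> {y \<in> carrier (free_group A Mod N). Q y}}
      = {c \<in> carrier (free_pro_p_group p A). Q (c N)}"
    by (auto simp: topspace_free_pro_p_topology)
  ultimately show ?thesis by simp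
qed

text \<open>
  A finite quotient of the abstract free group is one of the components of the free pro-\<open>p\<close> group,
  which gives the universal property for finite \<open>p\<close>-groups.
\<close>

lemma free_pro_p_group_hom:
  assumes P: "group P" "order P = p ^ k" and p: "Factorial_Ring.prime p"
    and v: "\<And>x. x \<in> A \<Longrightarrow> v x \<in> carrier P" "finite {x \<in> A. v x \<noteq> \<one>\<^bsub>P\<^esub>}"
  obtains \<Phi> where "\<Phi> \<in> hom (free_pro_p_group p A) P"
    "\<And>x. x \<in> A \<Longrightarrow> \<Phi> (free_pro_p_gen p A x) = v x"
    "\<And>Q. openin (free_pro_p_topology p A) {c \<in> carrier (free_pro_p_group p A). Q (\<Phi> c)}"
proof -
  let ?F = "free_group A" and ?h = "word_value P v"
  let ?N = "kernel ?F P ?h"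
  interpret P: group P by fact
  interpret h: group_hom ?F P ?h
    by (rule group_hom_word_value[OF P(1) v(1)])
  have N: "?N \<in> free_pro_p_index p A" by (rule kernel_in_free_pro_p_index[OF P p v])
  define \<Phi> where "\<Phi> = (\<lambda>c. the_elem (?h ` c ?N))"
  show ?thesis
  proof (rule that[of \<Phi>])
    have "(\<lambda>Y. the_elem (?h ` Y)) \<in> hom (?F Mod ?N) P" by (rule h.FactGroup_hom)
    then show "\<Phi> \<in> hom (free_pro_p_group p A) P"
      using N by (auto simp: hom_def \<Phi>_def free_pro_p_group_def Let_def PiE_iff)
    fix x assume x: "x \<in> A"
    then have xF: "[(x, True)] \<in> carrier ?F" by (simp add: free_group_def reduced_def)
    have "?h ` (?N #>\<^bsub>?F\<^esub> [(x, True)]) = {?h [(x, True)]}"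
    proof -
      have "?h (n \<otimes>\<^bsub>?F\<^esub> [(x, True)]) = ?h [(x, True)]" if "n \<in> ?N" for n
        using that xF by (simp add: kernel_def)
      then have "?h ` (?N #>\<^bsub>?F\<^esub> [(x, True)]) = (\<Union>n\<in>?N. {?h [(x, True)]})"
        unfolding r_coset_def image_UN by simp
      moreover have "\<one>\<^bsub>?F\<^esub> \<in> ?N" by (simp add: kernel_def)
      ultimately show ?thesis by (simp only: UN_constant) (metis empty_iff)
    qed
    then show "\<Phi> (free_pro_p_gen p A x) = v x"
      using N word_value_generator[OF P(1), of v x] v(1)[OF x] by (simp add: \<Phi>_def free_pro_p_gen_def)
  next
    fix Q
    show "openin (free_pro_p_topology p A) {c \<in> carrier (free_pro_p_group p A). Q (\<Phi> c)}"
      unfolding \<Phi>_def by (rule openin_component[OF N])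
  qed
qed

text \<open>
  The kernel of the homomorphism on the free pro-\<open>p\<close> group is a closed normal subgroup that contains
  the relators, so it contains the closed normal closure by which the group is presented. The
  kernel on the quotient is open because its preimage is.
\<close>

lemma pro_p_presentation_hom:
  assumes pres: "pro_p_presentation p A R \<Gamma> T \<sigma>" and \<Gamma>: "group \<Gamma>" "topspace T = carrier \<Gamma>"
    and P: "group P" "order P = p ^ k" and p: "Factorial_Ring.prime p"
    and v: "\<And>x. x \<in> A \<Longrightarrow> v x \<in> carrier P" "finite {x \<in> A. v x \<noteq> \<one>\<^bsub>P\<^esub>}"
    and R: "R \<subseteq> carrier (free_pro_p_group p A)"
      "\<And>\<Phi> r. \<Phi> \<in> hom (free_pro_p_group p A) P \<Longrightarrow> (\<And>x. x \<in> A \<Longrightarrow> \<Phi> (free_pro_p_gen p A x) = v x)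
        \<Longrightarrow> r \<in> R \<Longrightarrow> \<Phi> r = \<one>\<^bsub>P\<^esub>"
  obtains \<rho> where "\<rho> \<in> hom \<Gamma> P" "\<And>x. x \<in> A \<Longrightarrow> \<rho> (\<sigma> x) = v x"
    "openin T {g \<in> carrier \<Gamma>. \<rho> g = \<one>\<^bsub>P\<^esub>}"
proof -
  let ?S = "free_pro_p_group p A" and ?TS = "free_pro_p_topology p A"
  obtain \<pi> where \<pi>: "\<pi> \<in> hom ?S \<Gamma>" "quotient_map ?TS T \<pi>"
    "kernel ?S \<Gamma> \<pi> = closed_normal_closure ?S ?TS R" "\<And>x. x \<in> A \<Longrightarrow> \<pi> (free_pro_p_gen p A x) = \<sigma> x"
    using pres unfolding pro_p_presentation_def by blast
  obtain \<Phi> where \<Phi>: "\<Phi> \<in> hom ?S P" "\<And>x. x \<in> A \<Longrightarrow> \<Phi> (free_pro_p_gen p A x) = v x"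
    "\<And>Q. openin ?TS {c \<in> carrier ?S. Q (\<Phi> c)}"
    using free_pro_p_group_hom[OF P p v] by blast
  interpret \<pi>: group_hom ?S \<Gamma> \<pi>
    using \<pi>(1) \<Gamma>(1) by (intro group_hom.intro group_hom_axioms.intro group_free_pro_p_group)
  interpret \<Phi>: group_hom ?S P \<Phi>
    using \<Phi>(1) P(1) by (intro group_hom.intro group_hom_axioms.intro group_free_pro_p_group)
  have onto: "\<pi> ` carrier ?S = carrier \<Gamma>"
    using \<pi>(2) \<Gamma>(2) by (simp add: quotient_map_def topspace_free_pro_p_topology)
  have "closedin ?TS (kernel ?S P \<Phi>)"
  proof -
    have "topspace ?TS - kernel ?S P \<Phi> = {c \<in> carrier ?S. \<Phi> c \<noteq> \<one>\<^bsub>P\<^esub>}"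
      by (auto simp: topspace_free_pro_p_topology kernel_def)
    then show ?thesis
      using \<Phi>(3)[of "\<lambda>y. y \<noteq> \<one>\<^bsub>P\<^esub>"] by (auto simp: closedin_def topspace_free_pro_p_topology kernel_def)
  qed
  moreover have "R \<subseteq> kernel ?S P \<Phi>"
    using R \<Phi>(1,2) by (auto simp: kernel_def)
  ultimately have "kernel ?S \<Gamma> \<pi> \<subseteq> kernel ?S P \<Phi>"
    unfolding \<pi>(3) closed_normal_closure_def using \<Phi>.normal_kernel by blast
  then have factor: "\<Phi> c = \<one>\<^bsub>P\<^esub>" if "c \<in> carrier ?S" "\<pi> c = \<one>\<^bsub>\<Gamma>\<^esub>" for c
    using that by (auto simp: kernel_def)
  have eq: "\<Phi> c = \<Phi> d" if "c \<in> carrier ?S" "d \<in> carrier ?S" "\<pi> c = \<pi> d" for c d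
  proof -
    have "\<Phi> (c \<otimes>\<^bsub>?S\<^esub> inv\<^bsub>?S\<^esub> d) = \<one>\<^bsub>P\<^esub>" using that by (intro factor) simp_all
    then have "\<Phi> c \<otimes>\<^bsub>P\<^esub> inv\<^bsub>P\<^esub> \<Phi> d = \<one>\<^bsub>P\<^esub>" using that by simp
    then show ?thesis using that by (simp add: \<Phi>.H.inv_solve_right')
  qed
  define \<rho> where "\<rho> = (\<lambda>g. \<Phi> (inv_into (carrier ?S) \<pi> g))"
  have \<rho>: "\<rho> (\<pi> c) = \<Phi> c" if "c \<in> carrier ?S" for c
    unfolding \<rho>_def using that by (intro eq) (auto intro: inv_into_into simp: f_inv_into_f)
  show ?thesis
  proof (rule that[of \<rho>])
    show "\<rho> \<in> hom \<Gamma> P"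
    proof (rule homI)
      fix g h assume "g \<in> carrier \<Gamma>" "h \<in> carrier \<Gamma>"
      then obtain c d where cd: "c \<in> carrier ?S" "d \<in> carrier ?S" "g = \<pi> c" "h = \<pi> d"
        using onto by blast
      then show "\<rho> (g \<otimes>\<^bsub>\<Gamma>\<^esub> h) = \<rho> g \<otimes>\<^bsub>P\<^esub> \<rho> h"
        using \<rho>[of "c \<otimes>\<^bsub>?S\<^esub> d"] \<rho> by simp
    next
      fix g assume "g \<in> carrier \<Gamma>"
      then obtain c where "c \<in> carrier ?S" "g = \<pi> c" using onto by blast
      then show "\<rho> g \<in> carrier P" using \<rho> by simp
    qed
    show "\<rho> (\<sigma> x) = v x" if "x \<in> A" for x
      using \<rho>[OF free_pro_p_gen_in_carrier[OF that]] \<pi>(4)[OF that] \<Phi>(2)[OF that] by simp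
    have "{c \<in> topspace ?TS. \<pi> c \<in> {g \<in> carrier \<Gamma>. \<rho> g = \<one>\<^bsub>P\<^esub>}} = {c \<in> carrier ?S. \<Phi> c = \<one>\<^bsub>P\<^esub>}"
      using \<rho> by (auto simp: topspace_free_pro_p_topology)
    then have "openin ?TS {c \<in> topspace ?TS. \<pi> c \<in> {g \<in> carrier \<Gamma>. \<rho> g = \<one>\<^bsub>P\<^esub>}}"
      using \<Phi>(3)[of "\<lambda>y. y = \<one>\<^bsub>P\<^esub>"] by simp
    moreover have "{g \<in> carrier \<Gamma>. \<rho> g = \<one>\<^bsub>P\<^esub>} \<subseteq> topspace T" using \<Gamma>(2) by auto
    ultimately show "openin T {g \<in> carrier \<Gamma>. \<rho> g = \<one>\<^bsub>P\<^esub>}"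
      using \<pi>(2) unfolding quotient_map_def by blast
  qed
qed

lemma (in group_hom) hom_commutator:
  "x \<in> carrier G \<Longrightarrow> y \<in> carrier G \<Longrightarrow> h (commutator G x y) = commutator H (h x) (h y)"
  by (simp add: commutator_def)

lemma (in group_hom) hom_iterated_commutator:
  "x \<in> carrier G \<Longrightarrow> y \<in> carrier G \<Longrightarrow>
    h (iterated_commutator G n x y) = iterated_commutator H n (h x) (h y)"
  by (induction n) (simp_all add: hom_commutator G.iterated_commutator_closed)

lemma (in group_hom) hom_ordered_product:
  "set xs \<subseteq> carrier G \<Longrightarrow> h (ordered_product G xs) = ordered_product H (map h xs)"
proof (induction xs)
  case (Cons x xs)
  then show ?case using G.ordered_product_closed[of xs] by (simp add: ordered_product_def)
qed (simp add: ordered_product_def)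

text \<open>The relator as a word in any group, so that it can be moved along homomorphisms.\<close>

definition relator ::
  "('g, 'm) monoid_scheme \<Rightarrow> nat \<Rightarrow> nat \<Rightarrow> nat \<Rightarrow> 'i \<Rightarrow> 'i \<Rightarrow> ('i \<times> 'i) list \<Rightarrow> 'i list \<Rightarrow> ('i \<Rightarrow> 'g) \<Rightarrow> 'g" where
  "relator G p q f i1 i2 J K s =
     s i1 [^]\<^bsub>G\<^esub> q \<otimes>\<^bsub>G\<^esub> iterated_commutator G f (s i1) (s i2)
       \<otimes>\<^bsub>G\<^esub> ordered_product G (map (\<lambda>(i, j). commutator G (s i) (s j)) J)
       \<otimes>\<^bsub>G\<^esub> ordered_product G (map (\<lambda>k. commutator G (s i1 [^]\<^bsub>G\<^esub> p) (s k)) K)"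

lemma (in group_hom) hom_relator:
  assumes s: "\<And>i. i \<in> A \<Longrightarrow> s i \<in> carrier G"
    and A: "i1 \<in> A" "i2 \<in> A" "set J \<subseteq> A \<times> A" "set K \<subseteq> A"
  shows "relator G p q f i1 i2 J K s \<in> carrier G"
    "h (relator G p q f i1 i2 J K s) = relator H p q f i1 i2 J K (\<lambda>i. h (s i))"
proof -
  have J: "set (map (\<lambda>(i, j). commutator G (s i) (s j)) J) \<subseteq> carrier G"
    using s A(3) by (auto intro!: G.commutator_closed)
  have K: "set (map (\<lambda>k. commutator G (s i1 [^]\<^bsub>G\<^esub> p) (s k)) K) \<subseteq> carrier G"
    using s A by (auto intro!: G.commutator_closed)
  have J': "map h (map (\<lambda>(i, j). commutator G (s i) (s j)) J) = map (\<lambda>(i, j). commutator H (h (s i)) (h (s j))) J"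
    using s A(3) by (auto simp: hom_commutator)
  have K': "map h (map (\<lambda>k. commutator G (s i1 [^]\<^bsub>G\<^esub> p) (s k)) K) = map (\<lambda>k. commutator H (h (s i1) [^]\<^bsub>H\<^esub> p) (h (s k))) K"
    using s A by (auto simp: hom_commutator hom_nat_pow)
  note closed = G.ordered_product_closed[OF J] G.ordered_product_closed[OF K]
    G.iterated_commutator_closed s[OF A(1)] s[OF A(2)]
  show "relator G p q f i1 i2 J K s \<in> carrier G" using closed by (simp add: relator_def)
  show "h (relator G p q f i1 i2 J K s) = relator H p q f i1 i2 J K (\<lambda>i. h (s i))"
    using closed
    by (simp only: relator_def hom_mult G.m_closed G.nat_pow_closed hom_nat_pow hom_iterated_commutator
      hom_ordered_product[OF J] hom_ordered_product[OF K] J' K')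
qed

section \<open>The Heisenberg group\<close>

text \<open>
  The unitriangular matrices of size \<open>3\<close> over the field with \<open>p\<close> elements; \<open>(a, b, c)\<close> lists the
  entries in the positions \<open>(1, 2)\<close>, \<open>(2, 3)\<close> and \<open>(1, 3)\<close>.
\<close>

definition heisenberg :: "nat \<Rightarrow> (int \<times> int \<times> int) monoid" where
  "heisenberg p =
     \<lparr>carrier = {0..<int p} \<times> {0..<int p} \<times> {0..<int p},
      monoid.mult = (\<lambda>(a, b, c) (a', b', c').
        ((a + a') mod int p, (b + b') mod int p, (c + c' + a * b') mod int p)),
      one = (0, 0, 0)\<rparr>"

lemma heisenberg_mult:
  "(a, b, c) \<otimes>\<^bsub>heisenberg p\<^esub> (a', b', c')
     = ((a + a') mod int p, (b + b') mod int p, (c + c' + a * b') mod int p)"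
  by (simp add: heisenberg_def)

lemma heisenberg_one: "\<one>\<^bsub>heisenberg p\<^esub> = (0, 0, 0)"
  by (simp add: heisenberg_def)

lemma heisenberg_carrier: "carrier (heisenberg p) = {0..<int p} \<times> {0..<int p} \<times> {0..<int p}"
  by (simp add: heisenberg_def)

lemma order_heisenberg: "order (heisenberg p) = p ^ 3"
  by (simp add: order_def heisenberg_carrier card_cartesian_product power3_eq_cube)

lemma group_heisenberg:
  assumes "p > 0"
  shows "group (heisenberg p)"
proof (rule groupI)
  fix x y assume "x \<in> carrier (heisenberg p)" "y \<in> carrier (heisenberg p)"
  then show "x \<otimes>\<^bsub>heisenberg p\<^esub> y \<in> carrier (heisenberg p)"
    using assms by (cases x; cases y) (auto simp: heisenberg_mult heisenberg_carrier)
next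
  show "\<one>\<^bsub>heisenberg p\<^esub> \<in> carrier (heisenberg p)"
    using assms by (simp add: heisenberg_one heisenberg_carrier)
next
  fix x y z :: "int \<times> int \<times> int"
  obtain a b c a' b' c' a'' b'' c'' where xyz: "x = (a, b, c)" "y = (a', b', c')" "z = (a'', b'', c'')"
    by (metis surj_pair)
  have "[((c + c' + a * b') mod int p) + c'' + ((a + a') mod int p) * b''
      = (c + c' + a * b') + c'' + (a + a') * b''] (mod int p)"
    by (intro cong_add cong_mult cong_refl) (simp_all add: cong_def)
  moreover have "[c + ((c' + c'' + a' * b'') mod int p) + a * ((b' + b'') mod int p)
      = c + (c' + c'' + a' * b'') + a * (b' + b'')] (mod int p)"
    by (intro cong_add cong_mult cong_refl) (simp_all add: cong_def)
  ultimately show "x \<otimes>\<^bsub>heisenberg p\<^esub> y \<otimes>\<^bsub>heisenberg p\<^esub> z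
      = x \<otimes>\<^bsub>heisenberg p\<^esub> (y \<otimes>\<^bsub>heisenberg p\<^esub> z)"
    by (simp add: xyz heisenberg_mult cong_def mod_simps algebra_simps)
next
  fix x assume x: "x \<in> carrier (heisenberg p)"
  then show "\<one>\<^bsub>heisenberg p\<^esub> \<otimes>\<^bsub>heisenberg p\<^esub> x = x"
    by (cases x) (auto simp: heisenberg_mult heisenberg_one heisenberg_carrier)
  obtain a b c where abc: "x = (a, b, c)" by (metis surj_pair)
  let ?y = "((- a) mod int p, (- b) mod int p, (a * b - c) mod int p)"
  have "[(a * b - c) mod int p + c + ((- a) mod int p) * b = (a * b - c) + c + (- a) * b] (mod int p)"
    by (intro cong_add cong_mult cong_refl) (simp_all add: cong_def)
  then have "?y \<otimes>\<^bsub>heisenberg p\<^esub> x = \<one>\<^bsub>heisenberg p\<^esub>"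
    by (simp add: abc heisenberg_mult heisenberg_one cong_def mod_simps)
  moreover have "?y \<in> carrier (heisenberg p)" using assms by (simp add: heisenberg_carrier)
  ultimately show "\<exists>y\<in>carrier (heisenberg p). y \<otimes>\<^bsub>heisenberg p\<^esub> x = \<one>\<^bsub>heisenberg p\<^esub>" by blast
qed

lemma (in group) commutator_eqI:
  assumes "x \<in> carrier G" "y \<in> carrier G" "z \<in> carrier G" "x \<otimes> y = z \<otimes> (y \<otimes> x)"
  shows "commutator G x y = z"
proof -
  have "commutator G x y = (x \<otimes> y) \<otimes> inv (y \<otimes> x)"
    using assms(1,2) by (simp add: commutator_def inv_mult_group m_assoc)
  then show ?thesis using assms by (simp add: m_assoc)
qed

lemma heisenberg_power: "p > 1 \<Longrightarrow> (1, 0, 0) [^]\<^bsub>heisenberg p\<^esub> (n::nat) = (int n mod int p, 0, 0)"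
proof (induction n)
  case 0
  then show ?case by (simp add: nat_pow_def heisenberg_one)
next
  case (Suc n)
  have "(1, 0, 0) [^]\<^bsub>heisenberg p\<^esub> Suc n = (1, 0, 0) [^]\<^bsub>heisenberg p\<^esub> n \<otimes>\<^bsub>heisenberg p\<^esub> (1, 0, 0)"
    by (simp add: nat_pow_def)
  then show ?case using Suc by (simp add: heisenberg_mult mod_simps algebra_simps)
qed

text \<open>
  The group has class \<open>2\<close>, which kills the iterated commutator as \<open>f \<ge> 2\<close>, and the first generator
  has order \<open>p\<close>, which kills its \<open>q\<close>-th power.
\<close>

lemma relator_heisenberg:
  assumes "p > 1" "2 \<le> f" "p dvd q" and s: "s i1 = (1, 0, 0)" "s i2 = (0, 1, 0)"
    "\<And>i. i \<in> I \<Longrightarrow> s i = (0, 0, 0)" and "set J \<subseteq> I \<times> I" "set K \<subseteq> I"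
  shows "relator (heisenberg p) p q f i1 i2 J K s = \<one>\<^bsub>heisenberg p\<^esub>"
proof -
  let ?P = "heisenberg p"
  interpret P: group ?P using assms(1) by (intro group_heisenberg) simp
  have c: "(1, 0, 0) \<in> carrier ?P" "(0, 1, 0) \<in> carrier ?P" "(0, 0, 1) \<in> carrier ?P"
    "(0, 0, 0) \<in> carrier ?P" using assms(1) by (simp_all add: heisenberg_carrier)
  have "commutator ?P (1, 0, 0) (0, 1, 0) = (0, 0, 1)"
    using c assms(1) by (intro P.commutator_eqI) (simp_all add: heisenberg_mult)
  moreover have "commutator ?P (1, 0, 0) (0, 0, 1) = \<one>\<^bsub>?P\<^esub>"
    using c assms(1) by (intro P.commutator_eqI) (simp_all add: heisenberg_mult heisenberg_one)
  moreover have triv: "commutator ?P x (0, 0, 0) = \<one>\<^bsub>?P\<^esub>" if "x \<in> carrier ?P" for x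
    using that c P.one_closed by (intro P.commutator_eqI) (simp_all add: heisenberg_one[symmetric, of p])
  ultimately have two: "iterated_commutator ?P 2 (1, 0, 0) (0, 1, 0) = \<one>\<^bsub>?P\<^esub>"
    by (simp add: numeral_2_eq_2)
  have "iterated_commutator ?P (2 + n) (1, 0, 0) (0, 1, 0) = \<one>\<^bsub>?P\<^esub>" for n
    by (induction n) (use two triv[OF c(1)] in \<open>simp_all add: heisenberg_one\<close>)
  from this[of "f - 2"] have f: "iterated_commutator ?P f (s i1) (s i2) = \<one>\<^bsub>?P\<^esub>"
    unfolding le_add_diff_inverse[OF assms(2)] s .
  have q: "s i1 [^]\<^bsub>?P\<^esub> q = \<one>\<^bsub>?P\<^esub>"
    using assms(1,3) s(1) by (auto simp: heisenberg_power heisenberg_one)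
  have prod1: "ordered_product ?P xs = \<one>\<^bsub>?P\<^esub>" if "\<And>x. x \<in> set xs \<Longrightarrow> x = \<one>\<^bsub>?P\<^esub>" for xs
    using that
  proof (induction xs)
    case (Cons x xs)
    then have "x = \<one>\<^bsub>?P\<^esub>" "ordered_product ?P xs = \<one>\<^bsub>?P\<^esub>" by simp_all
    then show ?case by (simp add: ordered_product_def)
  qed (simp add: ordered_product_def)
  have "ordered_product ?P (map (\<lambda>(i, j). commutator ?P (s i) (s j)) J) = \<one>\<^bsub>?P\<^esub>"
    using assms(7) s(3) triv[OF c(4)] by (intro prod1) auto
  moreover have "ordered_product ?P (map (\<lambda>k. commutator ?P (s i1 [^]\<^bsub>?P\<^esub> p) (s k)) K) = \<one>\<^bsub>?P\<^esub>"
  proof (rule prod1)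
    fix x assume "x \<in> set (map (\<lambda>k. commutator ?P (s i1 [^]\<^bsub>?P\<^esub> p) (s k)) K)"
    then obtain k where "k \<in> I" "x = commutator ?P (s i1 [^]\<^bsub>?P\<^esub> p) (s k)" using assms(8) by auto
    then show "x = \<one>\<^bsub>?P\<^esub>"
      using s(3)[of k] triv[OF P.nat_pow_closed[OF c(1), of p]] by (simp only: s(1))
  qed
  ultimately show ?thesis using f q by (simp add: relator_def)
qed

section \<open>The action on the separable closure\<close>

lemma nth_root_exists_alg_closed:
  fixes w :: "'k::alg_closed_field"
  assumes "n > 0"
  shows "\<exists>x. x ^ n = w"
proof -
  have "Polynomial.coeff (Polynomial.monom 1 n - [:w:]) n = 1"
    using assms by (simp add: coeff_pCons split: nat.split)
  then have "Polynomial.degree (Polynomial.monom 1 n - [:w:]) > 0"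
    using le_degree[of "Polynomial.monom 1 n - [:w:]" n] assms by simp
  then obtain x where "poly (Polynomial.monom 1 n - [:w:]) x = 0"
    using alg_closed_imp_poly_has_root by blast
  then show ?thesis by (auto simp: poly_monom)
qed

lemma Artin_Schreier_root_exists:
  fixes w :: "'k::alg_closed_field"
  assumes "n > 1"
  shows "\<exists>x. x ^ n - x = w"
proof -
  have "Polynomial.coeff (Polynomial.monom 1 n - [:w, 1:]) n = 1"
    using assms by (simp add: coeff_pCons split: nat.split)
  then have "Polynomial.degree (Polynomial.monom 1 n - [:w, 1:]) > 0"
    using le_degree[of "Polynomial.monom 1 n - [:w, 1:]" n] assms by simp
  then obtain x where "poly (Polynomial.monom 1 n - [:w, 1:]) x = 0"
    using alg_closed_imp_poly_has_root by blast
  then have "x ^ n - x = w" by (simp add: poly_monom algebra_simps)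
  then show ?thesis ..
qed

lemma root_of_unity_exists:
  assumes p: "Factorial_Ring.prime p" and "(of_nat p :: 'f::field) \<noteq> 0"
  obtains \<zeta> :: "'f::field alg_closure" where "\<zeta> \<in> separable_closure" "\<zeta> ^ p = 1" "\<zeta> \<noteq> 1"
proof -
  have "p > 1" using p by (rule prime_gt_1_nat)
  define P :: "'f alg_closure poly" where "P = (\<Sum>i<p. Polynomial.monom 1 i)"
  have "Polynomial.coeff P (p - 1) = 1" using \<open>p > 1\<close> by (simp add: P_def coeff_sum)
  then have "Polynomial.degree P > 0"
    using le_degree[of P "p - 1"] \<open>p > 1\<close> by simp
  then obtain \<zeta> where "poly P \<zeta> = 0" using alg_closed_imp_poly_has_root by blast
  then have z: "(\<Sum>i<p. \<zeta> ^ i) = 0" by (simp add: P_def poly_sum poly_monom)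
  have "(of_nat p :: 'f alg_closure) \<noteq> 0"
    using assms(2) by (metis to_ac_of_nat to_ac_eq_0_iff)
  then have "\<zeta> \<noteq> 1" using z by auto
  moreover have "\<zeta> ^ p = 1"
    using power_diff_1_eq[of \<zeta> p] z by simp
  moreover have "\<zeta> \<in> separable_closure"
    using separable_closure_root[OF _ assms(2) \<open>\<zeta> ^ p = 1\<close>] to_ac_in_separable_closure[of 1] by simp
  ultimately show ?thesis using that by blast
qed

text \<open>
  A topological isomorphism \<open>\<phi>\<close> to the absolute Galois group lets \<open>G\<close> act on the separable closure.
\<close>

locale Galois_identification = group G for G (structure) +
  fixes T :: "'a topology" and \<phi> :: "'a \<Rightarrow> 'f::field alg_closure \<Rightarrow> 'f alg_closure"
  assumes iso: "\<phi> \<in> iso G (absolute_Galois_group :: ('f alg_closure \<Rightarrow> 'f alg_closure) monoid)"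
    and homeo: "homeomorphic_map T Krull_topology \<phi>"
    and topspace: "topspace T = carrier G"
begin

abbreviation \<Omega> :: "'f alg_closure set" where "\<Omega> \<equiv> separable_closure"

lemma \<phi>_carrier:
  assumes "g \<in> carrier G"
  shows "\<phi> g \<in> carrier absolute_Galois_group"
  using iso assms by (auto simp: iso_def hom_def)

lemma \<phi>_onto: "\<gamma> \<in> carrier absolute_Galois_group \<Longrightarrow> \<exists>g \<in> carrier G. \<gamma> = \<phi> g"
  using iso by (auto simp: iso_def bij_betw_def)

lemma \<phi>_inj: "g \<in> carrier G \<Longrightarrow> h \<in> carrier G \<Longrightarrow> \<phi> g = \<phi> h \<Longrightarrow> g = h"
  using iso by (auto simp: iso_def bij_betw_def inj_on_def)

lemma \<phi>_hom:
  "g \<in> carrier G \<Longrightarrow> h \<in> carrier G \<Longrightarrow> \<phi> (g \<otimes> h) = \<phi> g \<otimes>\<^bsub>absolute_Galois_group\<^esub> \<phi> h"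
  using iso by (auto simp: iso_def hom_def)

lemma \<phi>_Bij: "g \<in> carrier G \<Longrightarrow> \<phi> g \<in> Bij \<Omega>"
  using \<phi>_carrier by (auto simp: absolute_Galois_group_def)

lemma \<phi>_in: "g \<in> carrier G \<Longrightarrow> x \<in> \<Omega> \<Longrightarrow> \<phi> g x \<in> \<Omega>"
  using \<phi>_Bij[of g] by (auto simp: Bij_def bij_betw_def)

lemma \<phi>_add: "g \<in> carrier G \<Longrightarrow> x \<in> \<Omega> \<Longrightarrow> y \<in> \<Omega> \<Longrightarrow> \<phi> g (x + y) = \<phi> g x + \<phi> g y"
  using \<phi>_carrier by (auto simp: absolute_Galois_group_def)

lemma \<phi>_mult: "g \<in> carrier G \<Longrightarrow> x \<in> \<Omega> \<Longrightarrow> y \<in> \<Omega> \<Longrightarrow> \<phi> g (x * y) = \<phi> g x * \<phi> g y"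
  using \<phi>_carrier by (auto simp: absolute_Galois_group_def)

lemma \<phi>_base: "g \<in> carrier G \<Longrightarrow> \<phi> g (to_ac a) = to_ac a"
  using \<phi>_carrier by (auto simp: absolute_Galois_group_def)

lemma \<phi>_act: "g \<in> carrier G \<Longrightarrow> h \<in> carrier G \<Longrightarrow> x \<in> \<Omega> \<Longrightarrow> \<phi> (g \<otimes> h) x = \<phi> g (\<phi> h x)"
  using \<phi>_Bij by (simp add: \<phi>_hom absolute_Galois_group_def BijGroup_def compose_eq)

lemma \<phi>_id: "x \<in> \<Omega> \<Longrightarrow> \<phi> \<one> x = x"
proof -
  assume x: "x \<in> \<Omega>"
  have "\<phi> \<one> (\<phi> \<one> x) = \<phi> \<one> x" using \<phi>_act[of \<one> \<one> x] x by simp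
  moreover have "inj_on (\<phi> \<one>) \<Omega>" using \<phi>_Bij[of \<one>] by (simp add: Bij_def bij_betw_def)
  ultimately show ?thesis using x \<phi>_in[of \<one> x] by (simp add: inj_on_def)
qed

lemma \<phi>_poly:
  assumes "g \<in> carrier G" "x \<in> \<Omega>"
  shows "poly (ac_poly P) x \<in> \<Omega>" "\<phi> g (poly (ac_poly P) x) = poly (ac_poly P) (\<phi> g x)"
proof (induction P)
  case 0
  case 1
  show ?case using to_ac_in_separable_closure[of "0 :: 'f"] by simp
  case 2
  show ?case using \<phi>_base[OF assms(1), of 0] by simp
next
  case (pCons a P)
  note c = to_ac_in_separable_closure[of a] separable_closure_mult[OF assms(2) pCons(2)]
  case 1
  show ?case using c by (simp add: map_poly_pCons separable_closure_add)
  case 2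
  show ?case
    using c assms pCons by (simp add: map_poly_pCons \<phi>_add \<phi>_mult \<phi>_base)
qed

lemma \<phi>_orbit:
  assumes "x \<in> \<Omega>"
  shows "finite {\<phi> g x | g. g \<in> carrier G}"
proof -
  obtain P :: "'f poly" where P: "P \<noteq> 0" "poly (ac_poly P) x = 0" by (rule alg_closure_algebraic)
  have "poly (ac_poly P) (\<phi> g x) = 0" if "g \<in> carrier G" for g
    using \<phi>_poly(2)[OF that assms, of P] \<phi>_base[OF that, of 0] P(2) by simp
  then have "{\<phi> g x | g. g \<in> carrier G} \<subseteq> {y. poly (ac_poly P) y = 0}" by auto
  moreover have "finite {y. poly (ac_poly P) y = 0}"
    using P(1) by (intro poly_roots_finite) (simp add: ac_poly_eq_0_iff)
  ultimately show ?thesis by (rule finite_subset)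
qed

sublocale field_action G \<phi> \<Omega>
proof
  show "1 \<in> \<Omega>" using to_ac_in_separable_closure[of "1 :: 'f"] by simp
qed (auto intro: separable_closure_add separable_closure_mult separable_closure_uminus
    separable_closure_inverse \<phi>_in \<phi>_add \<phi>_mult \<phi>_act \<phi>_id \<phi>_orbit)

text \<open>
  A basic Krull neighbourhood of \<open>1\<close> is the fixer of a finite subextension, and fixing a finite
  spanning set of this is enough.
\<close>

lemma fixer_in_open:
  assumes "openin T N" "\<one> \<in> N"
  obtains B where "finite B" "B \<subseteq> \<Omega>" "\<And>g. g \<in> carrier G \<Longrightarrow> (\<And>b. b \<in> B \<Longrightarrow> \<phi> g b = b) \<Longrightarrow> g \<in> N"
proof -
  have N: "N \<subseteq> carrier G" using openin_subset[OF assms(1)] topspace by simp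
  have "openin Krull_topology (\<phi> ` N)"
    using homeomorphic_map_openness_eq[OF homeo] assms(1) by blast
  then have gen: "generate_topology_on {\<gamma> <#\<^bsub>absolute_Galois_group\<^esub> fixing_subgroup E | \<gamma> E.
          \<gamma> \<in> carrier absolute_Galois_group \<and> finite_subextension E} (\<phi> ` N)"
    by (simp add: Krull_topology_def openin_topology_generated_by_iff)
  have fixer: "\<phi> \<one> \<in> U \<longrightarrow> (\<exists>B. finite B \<and> B \<subseteq> \<Omega> \<and>
      (\<forall>g \<in> carrier G. (\<forall>b \<in> B. \<phi> g b = b) \<longrightarrow> \<phi> g \<in> U))"
    if "generate_topology_on {\<gamma> <#\<^bsub>absolute_Galois_group\<^esub> fixing_subgroup E | \<gamma> E.
          \<gamma> \<in> carrier absolute_Galois_group \<and> finite_subextension E} U" for U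
    using that
  proof induction
    case (Int U V)
    show ?case
    proof
      assume "\<phi> \<one> \<in> U \<inter> V"
      then obtain B C where "finite B" "B \<subseteq> \<Omega>" "\<forall>g \<in> carrier G. (\<forall>b \<in> B. \<phi> g b = b) \<longrightarrow> \<phi> g \<in> U"
        "finite C" "C \<subseteq> \<Omega>" "\<forall>g \<in> carrier G. (\<forall>b \<in> C. \<phi> g b = b) \<longrightarrow> \<phi> g \<in> V"
        using Int by auto
      then show "\<exists>B. finite B \<and> B \<subseteq> \<Omega> \<and> (\<forall>g \<in> carrier G. (\<forall>b \<in> B. \<phi> g b = b) \<longrightarrow> \<phi> g \<in> U \<inter> V)"
        by (intro exI[of _ "B \<union> C"]) auto
    qed
  next
    case (UN K)
    show ?case
    proof
      assume "\<phi> \<one> \<in> \<Union> K"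
      then obtain U where U: "U \<in> K" "\<phi> \<one> \<in> U" by blast
      have "\<exists>B. finite B \<and> B \<subseteq> \<Omega> \<and> (\<forall>g \<in> carrier G. (\<forall>b \<in> B. \<phi> g b = b) \<longrightarrow> \<phi> g \<in> U)"
        using UN(2)[OF U(1)] U(2) by (rule mp)
      then obtain B where "finite B" "B \<subseteq> \<Omega>" "\<forall>g \<in> carrier G. (\<forall>b \<in> B. \<phi> g b = b) \<longrightarrow> \<phi> g \<in> U"
        by blast
      then show "\<exists>B. finite B \<and> B \<subseteq> \<Omega> \<and> (\<forall>g \<in> carrier G. (\<forall>b \<in> B. \<phi> g b = b) \<longrightarrow> \<phi> g \<in> \<Union> K)"
        using \<open>U \<in> K\<close> by (intro exI[of _ B]) auto
    qed
  next
    case (Basis U)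
    then obtain \<gamma> E where U: "U = \<gamma> <#\<^bsub>absolute_Galois_group\<^esub> fixing_subgroup E"
      "\<gamma> \<in> carrier absolute_Galois_group" "finite_subextension E" by blast
    show ?case
    proof
      assume "\<phi> \<one> \<in> U"
      obtain c where c: "c \<in> carrier G" "\<gamma> = \<phi> c" using \<phi>_onto[OF U(2)] by blast
      obtain \<delta> where \<delta>: "\<delta> \<in> fixing_subgroup E" "\<phi> \<one> = \<gamma> \<otimes>\<^bsub>absolute_Galois_group\<^esub> \<delta>"
        using \<open>\<phi> \<one> \<in> U\<close> unfolding U(1) l_coset_def by auto
      obtain a where a: "a \<in> carrier G" "\<delta> = \<phi> a"
        using \<phi>_onto[of \<delta>] \<delta>(1) by (auto simp: fixing_subgroup_def)
      have "c \<otimes> a = \<one>" using \<phi>_inj[of "c \<otimes> a" \<one>] \<delta>(2) a c by (simp add: \<phi>_hom)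
      obtain B where B: "finite B" "B \<subseteq> E" "\<forall>x \<in> E. \<exists>u. x = (\<Sum>b \<in> B. to_ac (u b) * b)"
        and E: "E \<subseteq> \<Omega>"
        using U(3) unfolding finite_subextension_def by blast
      show "\<exists>B. finite B \<and> B \<subseteq> \<Omega> \<and> (\<forall>g \<in> carrier G. (\<forall>b \<in> B. \<phi> g b = b) \<longrightarrow> \<phi> g \<in> U)"
      proof (intro exI[of _ B] conjI ballI impI)
        show "finite B" "B \<subseteq> \<Omega>" using B E by auto
        fix g assume g: "g \<in> carrier G" "\<forall>b \<in> B. \<phi> g b = b"
        have fixE: "\<phi> g x = x" if x: "x \<in> E" for x
        proof -
          obtain u where u: "x = (\<Sum>b \<in> B. to_ac (u b) * b)" using B(3) x by blast
          have "\<phi> g x = (\<Sum>b \<in> B. \<phi> g (to_ac (u b) * b))"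
            unfolding u using g(1) B(2) E to_ac_in_separable_closure
            by (intro act_sum separable_closure_mult) auto
          also have "\<dots> = x"
            unfolding u using g B(2) E to_ac_in_separable_closure
            by (intro sum.cong refl) (subst \<phi>_mult, auto simp: \<phi>_base)
          finally show ?thesis .
        qed
        have "\<phi> (a \<otimes> g) \<in> fixing_subgroup E"
        proof -
          have "\<phi> (a \<otimes> g) x = x" if "x \<in> E" for x
            using \<delta>(1) a g(1) fixE[OF that] that E
            by (auto simp: \<phi>_act fixing_subgroup_def subset_iff)
          then show ?thesis using \<phi>_carrier a g(1) by (simp add: fixing_subgroup_def)
        qed
        moreover have "\<phi> g = \<gamma> \<otimes>\<^bsub>absolute_Galois_group\<^esub> \<phi> (a \<otimes> g)"
        proof -
          have "c \<otimes> (a \<otimes> g) = g" using \<open>c \<otimes> a = \<one>\<close> a c g(1) by (simp add: m_assoc[symmetric])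
          then show ?thesis using \<phi>_hom[of c "a \<otimes> g"] a c g(1) by simp
        qed
        ultimately show "\<phi> g \<in> U" unfolding U(1) l_coset_def by blast
      qed
    qed
  qed simp
  have "\<exists>B. finite B \<and> B \<subseteq> \<Omega> \<and> (\<forall>g \<in> carrier G. (\<forall>b \<in> B. \<phi> g b = b) \<longrightarrow> \<phi> g \<in> \<phi> ` N)"
    using fixer[OF gen] imageI[OF assms(2), of \<phi>] by (rule mp)
  then obtain B where "finite B" "B \<subseteq> \<Omega>"
    "\<forall>g \<in> carrier G. (\<forall>b \<in> B. \<phi> g b = b) \<longrightarrow> \<phi> g \<in> \<phi> ` N"
    by (elim exE conjE)
  then have B: "finite B" "B \<subseteq> \<Omega>" "g \<in> carrier G \<Longrightarrow> (\<And>b. b \<in> B \<Longrightarrow> \<phi> g b = b) \<Longrightarrow> \<phi> g \<in> \<phi> ` N" for g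
    by auto
  show ?thesis
  proof (rule that[OF B(1,2)])
    fix g assume g: "g \<in> carrier G" "\<And>b. b \<in> B \<Longrightarrow> \<phi> g b = b"
    then obtain h where h: "h \<in> N" "\<phi> g = \<phi> h" using B(3) by blast
    then have "g = h" using \<phi>_inj[OF g(1)] N by auto
    then show "g \<in> N" using h(1) by simp
  qed
qed

lemma simple_finite_subextension:
  assumes "x \<in> \<Omega>"
  shows "finite_subextension (ac.span (monoid_gen {x}))"
proof -
  let ?E = "ac.span (monoid_gen {x})"
  obtain B where B: "finite B" "?E \<subseteq> ac.span B"
    using finite_dimensional_algebra[of "{x}"] by auto
  obtain C where C: "C \<subseteq> ?E" "ac.independent C" "?E \<subseteq> ac.span C"
    by (rule ac.basis_exists[of ?E])
  have "finite C" using ac.independent_span_bound[OF B(1) C(2)] C(1) B(2) by simp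
  have "\<exists>c. y = (\<Sum>b \<in> C. to_ac (c b) * b)" if "y \<in> ?E" for y
    using C(3) that ac.span_finite[OF \<open>finite C\<close>] by auto
  then have "\<exists>B. finite B \<and> B \<subseteq> ?E \<and> (\<forall>y \<in> ?E. \<exists>c. y = (\<Sum>b \<in> B. to_ac (c b) * b))"
    using \<open>finite C\<close> C(1) by blast
  moreover have "?E \<subseteq> \<Omega>"
    using separable_algebra[of "{x}"] assms by (auto simp: separable_closure_def)
  moreover have "inverse y \<in> ?E" if "y \<in> ?E" for y
    using that by (rule inverse_in_subalgebra)
      (auto intro: ac.span_add span_monoid_gen_mult to_ac_in_span_monoid_gen)
  ultimately show ?thesis
    unfolding finite_subextension_def
    using to_ac_in_span_monoid_gen span_monoid_gen_mult ac.span_diff by (auto simp: image_subset_iff)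
qed

text \<open>The stabilizer is a union of cosets of the fixer of the finite subextension generated by \<open>x\<close>.\<close>

lemma stabilizer_open:
  assumes x: "x \<in> \<Omega>"
  shows "openin T {g \<in> carrier G. \<phi> g x = x}"
proof -
  let ?V = "{g \<in> carrier G. \<phi> g x = x}" and ?E = "ac.span (monoid_gen {x})"
  have xE: "x \<in> ?E" by (intro ac.span_base monoid_gen_superset) simp
  have E: "?E \<subseteq> \<Omega>"
    using simple_finite_subextension[OF x] by (simp add: finite_subextension_def)
  have "\<phi> ` ?V = \<Union> ((\<lambda>v. \<phi> v <#\<^bsub>absolute_Galois_group\<^esub> fixing_subgroup ?E) ` ?V)"
  proof (intro equalityI subsetI)
    fix \<gamma> assume "\<gamma> \<in> \<phi> ` ?V"
    then obtain v where v: "v \<in> ?V" "\<gamma> = \<phi> v" by blast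
    have "\<phi> \<one> \<in> fixing_subgroup ?E"
      using \<phi>_carrier \<phi>_id E by (auto simp: fixing_subgroup_def)
    moreover have "\<gamma> = \<phi> v \<otimes>\<^bsub>absolute_Galois_group\<^esub> \<phi> \<one>" using v \<phi>_hom[of v \<one>] by simp
    ultimately show "\<gamma> \<in> \<Union> ((\<lambda>v. \<phi> v <#\<^bsub>absolute_Galois_group\<^esub> fixing_subgroup ?E) ` ?V)"
      using v(1) unfolding l_coset_def by blast
  next
    fix \<gamma> assume "\<gamma> \<in> \<Union> ((\<lambda>v. \<phi> v <#\<^bsub>absolute_Galois_group\<^esub> fixing_subgroup ?E) ` ?V)"
    then obtain v \<delta> where v: "v \<in> ?V" "\<delta> \<in> fixing_subgroup ?E" "\<gamma> = \<phi> v \<otimes>\<^bsub>absolute_Galois_group\<^esub> \<delta>"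
      unfolding l_coset_def by auto
    obtain d where d: "d \<in> carrier G" "\<delta> = \<phi> d"
      using \<phi>_onto[of \<delta>] v(2) by (auto simp: fixing_subgroup_def)
    then have "\<phi> d x = x" using v(2) xE by (simp add: fixing_subgroup_def)
    then have "v \<otimes> d \<in> ?V" using v(1) d(1) x by (simp add: \<phi>_act)
    moreover have "\<gamma> = \<phi> (v \<otimes> d)" using v d by (simp add: \<phi>_hom)
    ultimately show "\<gamma> \<in> \<phi> ` ?V" by blast
  qed
  moreover have "openin Krull_topology (\<phi> v <#\<^bsub>absolute_Galois_group\<^esub> fixing_subgroup ?E)" if "v \<in> ?V" for v
    unfolding Krull_topology_def
    using \<phi>_carrier that simple_finite_subextension[OF x] by (intro topology_generated_by_Basis) blast
  ultimately have "openin Krull_topology (\<phi> ` ?V)" by auto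
  moreover have "?V \<subseteq> topspace T" using topspace by auto
  ultimately show ?thesis using homeomorphic_map_openness_eq[OF homeo] by blast
qed

text \<open>
  The action on the \<open>p\<close>-th roots of unity factors through a group of order \<open>p - 1\<close>, so it is
  trivial for a pro-\<open>p\<close> group.
\<close>

lemma root_of_unity_fixed:
  assumes pro: "pro_p_group p G T" and p: "Factorial_Ring.prime p"
    and \<zeta>: "\<zeta> \<in> \<Omega>" "\<zeta> ^ p = 1" "\<zeta> \<noteq> 1" and g: "g \<in> carrier G"
  shows "\<phi> g \<zeta> = \<zeta>"
proof -
  let ?V = "{g \<in> carrier G. \<phi> g \<zeta> = \<zeta>}"
  have power: "\<exists>k. \<phi> h \<zeta> = \<zeta> powi k" if "h \<in> carrier G" for h
    using root_of_unity_power_int[OF p \<zeta>(2,3), of "\<phi> h \<zeta>"] act_power[of h \<zeta> p] act_one \<zeta>(1,2) that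
    by simp
  have sub: "subgroup ?V G"
  proof (rule subgroupI)
    show "?V \<noteq> {}" using \<phi>_id \<zeta>(1) by auto
    fix a assume a: "a \<in> ?V"
    then show "inv a \<in> ?V" using act_inv(2)[of a \<zeta>] \<zeta>(1) by simp
  next
    fix a b assume "a \<in> ?V" "b \<in> ?V"
    then show "a \<otimes> b \<in> ?V" using \<zeta>(1) by (simp add: \<phi>_act)
  qed auto
  have "a \<otimes> v \<otimes> inv a \<in> ?V" if a: "a \<in> carrier G" and v: "v \<in> ?V" for a v
  proof -
    obtain k where k: "\<phi> (inv a) \<zeta> = \<zeta> powi k" using power a by blast
    have "\<phi> v (\<zeta> powi k) = \<zeta> powi k" using v \<zeta>(1) by (simp add: act_power_int)
    then have "\<phi> (a \<otimes> v \<otimes> inv a) \<zeta> = \<phi> a (\<phi> (inv a) \<zeta>)"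
      using a v \<zeta>(1) k power_int_in[OF \<zeta>(1), of k] by (simp add: \<phi>_act)
    also have "\<dots> = \<zeta>" using a \<zeta>(1) by (rule act_inv(1))
    finally show ?thesis using a v by simp
  qed
  with sub have V: "?V \<lhd> G" by (simp add: normal_inv_iff)
  obtain n where n: "card (rcosets ?V) = p ^ n"
  proof -
    have "\<forall>N. N \<lhd> G \<and> openin T N \<longrightarrow> (\<exists>n. card (rcosets N) = p ^ n)"
      using pro unfolding pro_p_group_def by (rule conjunct2)
    from this[rule_format, OF conjI[OF V stabilizer_open[OF \<zeta>(1)]]] show ?thesis
      using that by (elim exE)
  qed
  have Q: "group (G Mod ?V)" by (rule normal.factorgroup_is_group[OF V])
  have q: "group_hom G (G Mod ?V) (\<lambda>a. ?V #> a)"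
    by (intro group_hom.intro group_hom_axioms.intro normal.r_coset_hom_Mod[OF V] Q is_group)
  have "order (G Mod ?V) = p ^ n" using n by (simp only: order_def FactGroup_def partial_object.select_convs)
  then have "(?V #> g) [^]\<^bsub>G Mod ?V\<^esub> (p ^ n) = \<one>\<^bsub>G Mod ?V\<^esub>"
    using group.pow_order_eq_1[OF Q group_hom.hom_closed[OF q g]] by (simp only:)
  then have "?V #> (g [^] (p ^ n)) = ?V"
    using group_hom.hom_nat_pow[OF q g, of "p ^ n"] by (simp only: FactGroup_def monoid.select_convs)
  then have gV: "g [^] (p ^ n) \<in> ?V"
    using rcos_self[OF nat_pow_closed[OF g, of "p ^ n"] sub] by (simp only:)
  obtain k where k: "\<phi> g \<zeta> = \<zeta> powi k" using power[OF g] by blast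
  have iter: "\<phi> (g [^] m) \<zeta> = \<zeta> powi (k ^ m)" for m :: nat
  proof (induction m)
    case 0
    then show ?case using \<phi>_id \<zeta>(1) by simp
  next
    case (Suc m)
    have "\<phi> (g [^] Suc m) \<zeta> = \<phi> (g [^] m) (\<zeta> powi k)" using g \<zeta>(1) k by (simp add: \<phi>_act)
    also have "\<dots> = (\<zeta> powi (k ^ m)) powi k" using g \<zeta>(1) Suc by (simp add: act_power_int)
    finally show ?case by (simp add: mult.commute flip: power_int_mult)
  qed
  have "\<zeta> powi (k ^ (p ^ n)) = \<zeta> powi 1" using gV iter[of "p ^ n"] by simp
  then have "[k ^ (p ^ n) = 1] (mod int p)" using power_int_eq_iff_cong[OF p \<zeta>(2,3)] by blast
  moreover have "[k ^ (p ^ n) = k] (mod int p)"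
  proof -
    have fermat: "[k ^ p = k] (mod int p)" for k
    proof -
      define a where "a = nat (k mod int p)"
      have ka: "[k = int a] (mod int p)"
        using prime_gt_0_nat[OF p] by (simp add: a_def cong_def)
      have "[a ^ p = a] (mod p)"
      proof (cases "p dvd a")
        case True
        then have "p dvd a ^ p" using prime_gt_0_nat[OF p] by (simp add: prime_dvd_power_iff[OF p])
        then show ?thesis using True by (metis cong_0_iff cong_sym cong_trans)
      next
        case False
        then have "[a ^ (p - 1) * a = 1 * a] (mod p)"
          by (intro cong_mult fermat_theorem p cong_refl)
        then show ?thesis using prime_gt_0_nat[OF p] by (cases p) (simp_all add: mult.commute)
      qed
      then have "[int a ^ p = int a] (mod int p)" by (simp flip: cong_int_iff)
      then show ?thesis using cong_trans[OF cong_pow[OF ka] cong_trans[OF _ cong_sym[OF ka]]] by blast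
    qed
    show ?thesis
    proof (induction n)
      case (Suc n)
      have "[(k ^ (p ^ n)) ^ p = k ^ (p ^ n)] (mod int p)" by (rule fermat)
      then have "[k ^ (p ^ Suc n) = k ^ (p ^ n)] (mod int p)"
        by (simp add: power_mult[symmetric] mult.commute)
      then show ?case using Suc by (rule cong_trans)
    qed simp
  qed
  ultimately have "[k = 1] (mod int p)" by (rule cong_trans[OF cong_sym, rotated])
  then have "\<zeta> powi k = \<zeta> powi 1" using power_int_eq_iff_cong[OF p \<zeta>(2,3)] by blast
  then show ?thesis using k by simp
qed

end

text \<open>
  The two cases are Artin-Schreier theory, if \<open>p\<close> is the characteristic, and Kummer theory. The open
  set \<open>N\<close>, the kernel of a homomorphism to the Heisenberg group, makes the three coordinates
  depend only on the action on a finite set.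
\<close>

lemma (in Galois_identification) is_norm_mod_of_Heisenberg:
  fixes p :: nat and x1 x2 x3 :: "'a \<Rightarrow> int"
  defines "H \<equiv> {g \<in> carrier G. [x1 g = 0] (mod p)}"
  assumes pro: "pro_p_group p G T" and p: "Factorial_Ring.prime p"
    and x1: "\<And>g h. g \<in> carrier G \<Longrightarrow> h \<in> carrier G \<Longrightarrow> [x1 (g \<otimes> h) = x1 g + x1 h] (mod p)"
    and x2: "\<And>g h. g \<in> carrier G \<Longrightarrow> h \<in> carrier G \<Longrightarrow> [x2 (g \<otimes> h) = x2 g + x2 h] (mod p)"
    and x3: "\<And>g h. g \<in> carrier G \<Longrightarrow> h \<in> carrier G \<Longrightarrow> [x3 (g \<otimes> h) = x3 g + x3 h + x1 g * x2 h] (mod p)"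
    and N: "openin T N" "\<one> \<in> N" "\<And>g. g \<in> N \<Longrightarrow> x1 g = 0 \<and> x2 g = 0 \<and> x3 g = 0"
    and \<sigma>: "\<sigma> \<in> carrier G" "[x1 \<sigma> = 1] (mod p)" "[x2 \<sigma> = 0] (mod p)" "[x3 (\<sigma> [^] p) = 0] (mod p)"
  shows "is_norm_mod p H \<sigma> x2"
proof -
  obtain B where B: "finite B" "B \<subseteq> \<Omega>"
    "\<And>g. g \<in> carrier G \<Longrightarrow> (\<And>b. b \<in> B \<Longrightarrow> \<phi> g b = b) \<Longrightarrow> g \<in> N"
    using fixer_in_open[OF N(1,2)] by blast
  have triv: "[x1 g = 0] (mod p) \<and> [x2 g = 0] (mod p) \<and> [x3 g = 0] (mod p)"
    if g: "g \<in> carrier G" "\<And>b. b \<in> B \<Longrightarrow> \<phi> g b = b" for g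
  proof -
    have "g \<in> N" by (rule B(3)[OF g])
    then show ?thesis using N(3)[of g] by simp
  qed
  show ?thesis
  proof (cases "(of_nat p :: 'f) = 0")
    case True
    then have "CHAR('f) dvd p" by (simp add: of_nat_eq_0_iff_char_dvd)
    moreover have "CHAR('f) \<noteq> 1" using of_nat_CHAR[where ?'a = 'f] by (metis of_nat_1 zero_neq_one)
    ultimately have CHAR: "CHAR('f) = p" using p by (metis prime_nat_iff)
    have CHAR': "CHAR('f alg_closure) = p" using CHAR by simp
    have root: "\<exists>\<omega> \<in> \<Omega>. \<omega> ^ p - \<omega> = w" if "w \<in> \<Omega>" for w
    proof -
      obtain \<omega> where "\<omega> ^ p - \<omega> = w"
        using Artin_Schreier_root_exists[OF prime_gt_1_nat[OF p], of w] by blast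
      then show ?thesis
        using separable_closure_Artin_Schreier_root[OF that, of \<omega>] p CHAR by blast
    qed
    show ?thesis
      unfolding H_def
    proof (rule is_norm_mod_Artin_Schreier[OF p CHAR' x1 x2 B(1,2) _ \<sigma>(1,2) root])
      fix g assume "g \<in> carrier G" "\<And>b. b \<in> B \<Longrightarrow> \<phi> g b = b"
      then show "[x1 g = 0] (mod p) \<and> [x2 g = 0] (mod p)" using triv by blast
    qed
  next
    case False
    obtain \<zeta> :: "'f alg_closure" where \<zeta>: "\<zeta> \<in> \<Omega>" "\<zeta> ^ p = 1" "\<zeta> \<noteq> 1"
      using root_of_unity_exists[OF p False] by blast
    have root: "\<exists>\<omega> \<in> \<Omega>. \<omega> ^ p = w" if "w \<in> \<Omega>" for w
    proof -
      obtain \<omega> where "\<omega> ^ p = w"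
        using nth_root_exists_alg_closed[OF prime_gt_0_nat[OF p], of w] by blast
      then show ?thesis using separable_closure_root[OF that False, of \<omega>] by blast
    qed
    show ?thesis
      unfolding H_def
    proof (rule is_norm_mod_Kummer[OF p x1 x2 x3 B(1,2) _ \<sigma> \<zeta> _ root])
      fix g assume "g \<in> carrier G" "\<And>b. b \<in> B \<Longrightarrow> \<phi> g b = b"
      then show "[x2 g = 0] (mod p) \<and> [x3 g = 0] (mod p)" using triv by blast
    next
      fix g assume "g \<in> carrier G"
      then show "\<phi> g \<zeta> = \<zeta>" by (rule root_of_unity_fixed[OF pro p \<zeta>])
    qed
  qed
qed

section \<open>Groups with the given relator\<close>

lemma relator_cong:
  assumes "\<And>i. i \<in> A \<Longrightarrow> s i = t i" "i1 \<in> A" "i2 \<in> A" "set J \<subseteq> A \<times> A" "set K \<subseteq> A"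
  shows "relator G p q f i1 i2 J K s = relator G p q f i1 i2 J K t"
proof -
  have "map (\<lambda>(i, j). commutator G (s i) (s j)) J = map (\<lambda>(i, j). commutator G (t i) (t j)) J"
    using assms by (intro map_cong) auto
  moreover have "map (\<lambda>k. commutator G (s i1 [^]\<^bsub>G\<^esub> p) (s k)) K = map (\<lambda>k. commutator G (t i1 [^]\<^bsub>G\<^esub> p) (t k)) K"
    using assms by (intro map_cong) auto
  ultimately show ?thesis using assms(1)[OF assms(2)] assms(1)[OF assms(3)] by (simp only: relator_def)
qed

theorem mainTheorem2:
  fixes p q f :: nat
    and I :: "'i set" and i1 i2 :: 'i
    and J :: "('i \<times> 'i) list" and K :: "'i list"
    and \<Gamma> :: "('g, 'm) monoid_scheme" and T :: "'g topology" and \<sigma> :: "'i \<Rightarrow> 'g"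
  defines "A \<equiv> {i1, i2} \<union> I"
  defines "S \<equiv> free_pro_p_group p A" and "s \<equiv> free_pro_p_gen p A"
  assumes "Factorial_Ring.prime p" and "odd p"
    and "i1 \<noteq> i2" and "I \<inter> {i1, i2} = {}"
    and "2 \<le> f" and "f \<le> p - 1"
    and "[q = 0] (mod p\<^sup>2)"
    and "distinct J" and "set J \<subseteq> I \<times> I"
    and "distinct K" and "set K \<subseteq> I"
    and "pro_p_group p \<Gamma> T"
    and "minimally_generated_by \<Gamma> T A \<sigma>"
    and "pro_p_presentation p A
           {s i1 [^]\<^bsub>S\<^esub> q \<otimes>\<^bsub>S\<^esub> iterated_commutator S f (s i1) (s i2)
              \<otimes>\<^bsub>S\<^esub> ordered_product S (map (\<lambda>(i, j). commutator S (s i) (s j)) J)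
              \<otimes>\<^bsub>S\<^esub> ordered_product S (map (\<lambda>k. commutator S (s i1 [^]\<^bsub>S\<^esub> p) (s k)) K)}
           \<Gamma> T \<sigma>"
  shows "\<not> is_absolute_Galois_group TYPE('f::field) \<Gamma> T"
proof
  assume "is_absolute_Galois_group TYPE('f) \<Gamma> T"
  then obtain \<phi> where \<phi>: "\<phi> \<in> iso \<Gamma> (absolute_Galois_group :: ('f alg_closure \<Rightarrow> 'f alg_closure) monoid)"
    "homeomorphic_map T (Krull_topology :: ('f alg_closure \<Rightarrow> 'f alg_closure) topology) \<phi>"
    unfolding is_absolute_Galois_group_def topological_group_iso_def by blast
  note p = \<open>Factorial_Ring.prime p\<close> and pro = \<open>pro_p_group p \<Gamma> T\<close>
  have pres: "pro_p_presentation p A {relator S p q f i1 i2 J K s} \<Gamma> T \<sigma>"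
    using assms(17) by (simp only: relator_def)
  have "p > 1" using p by (rule prime_gt_1_nat)
  have "p\<^sup>2 dvd q" using \<open>[q = 0] (mod p\<^sup>2)\<close> by (simp add: cong_0_iff)
  then have "p dvd q" by (metis dvd_trans dvd_triv_left power2_eq_square)
  have J: "set J \<subseteq> A \<times> A" and K: "set K \<subseteq> A" and i: "i1 \<in> A" "i2 \<in> A"
    using \<open>set J \<subseteq> I \<times> I\<close> \<open>set K \<subseteq> I\<close> by (auto simp: A_def)
  have \<Gamma>: "group \<Gamma>" "topspace T = carrier \<Gamma>"
    using pro by (simp_all add: pro_p_group_def profinite_group_def topological_group_def)
  interpret \<Gamma>: Galois_identification \<Gamma> T \<phi>
    using \<Gamma> \<phi> by (intro Galois_identification.intro Galois_identification_axioms.intro)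
  let ?P = "heisenberg p"
  have P: "group ?P" using \<open>p > 1\<close> by (intro group_heisenberg) simp
  define v :: "'i \<Rightarrow> int \<times> int \<times> int" where
    "v = (\<lambda>i. if i = i1 then (1, 0, 0) else if i = i2 then (0, 1, 0) else (0, 0, 0))"
  have v: "v i1 = (1, 0, 0)" "v i2 = (0, 1, 0)" "\<And>i. i \<in> I \<Longrightarrow> v i = (0, 0, 0)"
    using \<open>i1 \<noteq> i2\<close> \<open>I \<inter> {i1, i2} = {}\<close> by (auto simp: v_def)
  have v_carrier: "v x \<in> carrier ?P" for x using \<open>p > 1\<close> by (simp add: v_def heisenberg_carrier)
  have "{x \<in> A. v x \<noteq> \<one>\<^bsub>?P\<^esub>} \<subseteq> {i1, i2}" by (auto simp: v_def heisenberg_one)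
  then have v_finite: "finite {x \<in> A. v x \<noteq> \<one>\<^bsub>?P\<^esub>}" by (rule finite_subset) simp
  have rel_P: "relator ?P p q f i1 i2 J K t = \<one>\<^bsub>?P\<^esub>" if "\<And>x. x \<in> A \<Longrightarrow> t x = v x" for t
    using that i v \<open>p > 1\<close> \<open>2 \<le> f\<close> \<open>p dvd q\<close> \<open>set J \<subseteq> I \<times> I\<close> \<open>set K \<subseteq> I\<close>
    by (intro relator_heisenberg[where I = I]) (auto simp: A_def)
  have s: "s x \<in> carrier S" if "x \<in> A" for x
    using free_pro_p_gen_in_carrier[OF that] by (simp add: s_def S_def)
  have S: "group S" unfolding S_def by (rule group_free_pro_p_group)
  have rel_hom: "h (relator S p q f i1 i2 J K s) = relator Q p q f i1 i2 J K (\<lambda>i. h (s i))"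
      "relator S p q f i1 i2 J K s \<in> carrier S"
    if "group Q" "h \<in> hom S Q" for h and Q :: "('z, 'y) monoid_scheme"
  proof -
    have "group_hom S Q h" using that S by (simp add: group_hom_def group_hom_axioms_def)
    from group_hom.hom_relator[OF this s i J K]
    show "h (relator S p q f i1 i2 J K s) = relator Q p q f i1 i2 J K (\<lambda>i. h (s i))"
      "relator S p q f i1 i2 J K s \<in> carrier S" by auto
  qed
  obtain \<pi> where \<pi>: "\<pi> \<in> hom S \<Gamma>" "\<And>x. x \<in> A \<Longrightarrow> \<pi> (s x) = \<sigma> x"
    "kernel S \<Gamma> \<pi> = closed_normal_closure S (free_pro_p_topology p A) {relator S p q f i1 i2 J K s}"
    using pres unfolding pro_p_presentation_def S_def s_def by blast
  have \<sigma>: "\<sigma> x \<in> carrier \<Gamma>" if "x \<in> A" for x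
    using hom_in_carrier[OF \<pi>(1) s[OF that]] \<pi>(2)[OF that] by simp
  have "relator S p q f i1 i2 J K s \<in> kernel S \<Gamma> \<pi>"
    unfolding \<pi>(3) closed_normal_closure_def by auto
  then have "relator \<Gamma> p q f i1 i2 J K (\<lambda>i. \<pi> (s i)) = \<one>\<^bsub>\<Gamma>\<^esub>"
    using rel_hom[OF \<Gamma>(1) \<pi>(1)] by (simp add: kernel_def)
  moreover have "relator \<Gamma> p q f i1 i2 J K (\<lambda>i. \<pi> (s i)) = relator \<Gamma> p q f i1 i2 J K \<sigma>"
    by (rule relator_cong[OF \<pi>(2) i J K])
  ultimately have rel: "relator \<Gamma> p q f i1 i2 J K \<sigma> = \<one>\<^bsub>\<Gamma>\<^esub>" by simp
  obtain \<rho> where \<rho>: "\<rho> \<in> hom \<Gamma> ?P" "\<And>x. x \<in> A \<Longrightarrow> \<rho> (\<sigma> x) = v x"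
    "openin T {g \<in> carrier \<Gamma>. \<rho> g = \<one>\<^bsub>?P\<^esub>}"
  proof (rule pro_p_presentation_hom[OF pres \<Gamma> P order_heisenberg p v_carrier v_finite])
    show "{relator S p q f i1 i2 J K s} \<subseteq> carrier (free_pro_p_group p A)"
      using rel_hom(2)[OF \<Gamma>(1) \<pi>(1)] by (simp add: S_def)
    fix \<Phi> r assume "\<Phi> \<in> hom (free_pro_p_group p A) ?P" "\<And>x. x \<in> A \<Longrightarrow> \<Phi> (free_pro_p_gen p A x) = v x"
      "r \<in> {relator S p q f i1 i2 J K s}"
    then show "\<Phi> r = \<one>\<^bsub>?P\<^esub>"
      using rel_hom(1)[OF P, of \<Phi>] rel_P[of "\<lambda>i. \<Phi> (s i)"] by (simp add: S_def s_def)
  qed (rule that)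
  define x1 x2 x3 where "x1 = (\<lambda>g. fst (\<rho> g))" and "x2 = (\<lambda>g. fst (snd (\<rho> g)))"
    and "x3 = (\<lambda>g. snd (snd (\<rho> g)))"
  have \<rho>_eq: "\<rho> g = (x1 g, x2 g, x3 g)" for g by (simp add: x1_def x2_def x3_def)
  have "x1 (g \<otimes>\<^bsub>\<Gamma>\<^esub> h) = (x1 g + x1 h) mod int p \<and> x2 (g \<otimes>\<^bsub>\<Gamma>\<^esub> h) = (x2 g + x2 h) mod int p
      \<and> x3 (g \<otimes>\<^bsub>\<Gamma>\<^esub> h) = (x3 g + x3 h + x1 g * x2 h) mod int p"
    if "g \<in> carrier \<Gamma>" "h \<in> carrier \<Gamma>" for g h
  proof -
    have "\<rho> (g \<otimes>\<^bsub>\<Gamma>\<^esub> h) = \<rho> g \<otimes>\<^bsub>?P\<^esub> \<rho> h" using \<rho>(1) that by (rule hom_mult)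
    then show ?thesis unfolding \<rho>_eq heisenberg_mult by simp
  qed
  then have x: "[x1 (g \<otimes>\<^bsub>\<Gamma>\<^esub> h) = x1 g + x1 h] (mod p)" "[x2 (g \<otimes>\<^bsub>\<Gamma>\<^esub> h) = x2 g + x2 h] (mod p)"
      "[x3 (g \<otimes>\<^bsub>\<Gamma>\<^esub> h) = x3 g + x3 h + x1 g * x2 h] (mod p)"
    if "g \<in> carrier \<Gamma>" "h \<in> carrier \<Gamma>" for g h
    using that by (simp_all add: cong_def)
  have \<rho>_one: "\<rho> \<one>\<^bsub>\<Gamma>\<^esub> = \<one>\<^bsub>?P\<^esub>" using \<rho>(1) \<Gamma>(1) P by (simp add: hom_one)
  have \<sigma>1: "x1 (\<sigma> i1) = 1" "x2 (\<sigma> i1) = 0"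
    using \<rho>(2)[OF i(1)] v(1) by (simp_all add: x1_def x2_def)
  have \<sigma>2: "x1 (\<sigma> i2) = 0" "x2 (\<sigma> i2) = 1"
    using \<rho>(2)[OF i(2)] v(2) by (simp_all add: x1_def x2_def)
  have "\<rho> (\<sigma> i1 [^]\<^bsub>\<Gamma>\<^esub> p) = (0, 0, 0)"
  proof -
    have "group_hom \<Gamma> ?P \<rho>" using \<rho>(1) \<Gamma>(1) P by (simp add: group_hom_def group_hom_axioms_def)
    then have "\<rho> (\<sigma> i1 [^]\<^bsub>\<Gamma>\<^esub> p) = \<rho> (\<sigma> i1) [^]\<^bsub>?P\<^esub> p"
      using \<sigma>[OF i(1)] by (rule group_hom.hom_nat_pow)
    then show ?thesis using \<rho>(2)[OF i(1)] v(1) heisenberg_power[OF \<open>p > 1\<close>, of p] by simp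
  qed
  then have \<sigma>p: "x1 (\<sigma> i1 [^]\<^bsub>\<Gamma>\<^esub> p) = 0" "x3 (\<sigma> i1 [^]\<^bsub>\<Gamma>\<^esub> p) = 0"
    by (simp_all add: x1_def x3_def)
  define H where "H = {g \<in> carrier \<Gamma>. [x1 g = 0] (mod p)}"
  have norm: "\<Gamma>.is_norm_mod p H (\<sigma> i1) x2"
    unfolding H_def
  proof (rule \<Gamma>.is_norm_mod_of_Heisenberg[OF pro p x \<rho>(3) _ _ \<sigma>[OF i(1)]])
    show "\<one>\<^bsub>\<Gamma>\<^esub> \<in> {g \<in> carrier \<Gamma>. \<rho> g = \<one>\<^bsub>?P\<^esub>}" using \<rho>_one by simp
    show "x1 g = 0 \<and> x2 g = 0 \<and> x3 g = 0" if "g \<in> {g \<in> carrier \<Gamma>. \<rho> g = \<one>\<^bsub>?P\<^esub>}" for g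
      using that by (simp add: x1_def x2_def x3_def heisenberg_one)
    show "[x1 (\<sigma> i1) = 1] (mod p)" "[x2 (\<sigma> i1) = 0] (mod p)" "[x3 (\<sigma> i1 [^]\<^bsub>\<Gamma>\<^esub> p) = 0] (mod p)"
      using \<sigma>1 \<sigma>p by simp_all
  qed
  have HN: "H \<lhd> \<Gamma>" unfolding H_def by (rule \<Gamma>.kernel_mod_normal) (rule x(1))
  have in_H: "\<sigma> k \<in> H" if "k \<in> I" for k
    using \<rho>(2)[of k] v(3)[OF that] \<sigma>[of k] that by (simp add: H_def x1_def A_def)
  have "[x2 (\<sigma> i2) = 0] (mod p)"
  proof (rule \<Gamma>.norm_vanishes_by_relator[where s = \<sigma>, OF p \<open>odd p\<close> \<open>f \<le> p - 1\<close> \<open>p\<^sup>2 dvd q\<close> HN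
        \<sigma>[OF i(1)] _ _ _ _ rel[unfolded relator_def] norm])
    show "\<sigma> i1 [^]\<^bsub>\<Gamma>\<^esub> p \<in> H" using \<sigma>p \<sigma>[OF i(1)] by (simp add: H_def)
    show "\<sigma> i2 \<in> H" using \<sigma>2 \<sigma>[OF i(2)] by (simp add: H_def)
    show "\<sigma> j \<in> H \<and> \<sigma> k \<in> H" if "(j, k) \<in> set J" for j k
      using that \<open>set J \<subseteq> I \<times> I\<close> in_H by auto
    show "\<sigma> k \<in> H" if "k \<in> set K" for k using that \<open>set K \<subseteq> I\<close> in_H by auto
  qed
  then show False using \<sigma>2(2) \<open>p > 1\<close> by (simp add: cong_def)
qed

end
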